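(* Let $\mathcal{A}$ be a locally noetherian Grothendieck cosmos such that the unit object $I$ of $\mathcal{A}$ is finitely presented and $\mathcal{A}$ is generated by a small set of invertible-filtered objects. Let $\mathcal{A}_{\mathrm{noeth}}$ be the full subcategory of noetherian objects of $\mathcal{A}$, and let $\mathcal{X}$ be an L-closed subcategory of $\mathcal{A}_{\mathrm{noeth}}$. (1) The following are equivalent, all closure conditions being taken in the abelian category $\mathcal{A}_{\mathrm{noeth}}$: $\mathcal{X}$ is a Serre subcategory; $\mathcal{X}$ is a torsion class; $\mathcal{X}$ is a wide subcategory; $\mathcal{X}$ is an ICE-closed subcategory; $\mathcal{X}$ is a CE-closed subcategory. (2) The following are equivalent in $\mathcal{A}_{\mathrm{noeth}}$: $\mathcal{X}$ is a torsion-free class; $\mathcal{X}$ is an IKE-closed subcategory; $\mathcal{X}$ is an IE-closed subcategory.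
   Context: All subcategories are full and closed under isomorphisms. A Grothendieck cosmos is a symmetric monoidal closed category $(\mathcal{A},\otimes,I)$ whose underlying category is a Grothendieck (abelian) category; it is locally noetherian if the underlying Grothendieck category is, i.e. has a small generating set of noetherian objects. An object $L$ is invertible if there is $M$ with $L\otimes M\cong I$. An object $M$ is invertible-filtered if there is a finite filtration $0=M_0\subseteq M_1\subseteq\cdots\subseteq M_n=M$ with each $M_i/M_{i-1}$ invertible. A subcategory $\mathcal{X}$ is L-closed if $X\otimes L\in\mathcal{X}$ for all $X\in\mathcal{X}$ and all invertible objects $L$ of $\mathcal{A}$. An additive subcategory $\mathcal{X}$ of an abelian category $\mathcal{B}$ is: closed under images (resp. kernels, cokernels) if for every morphism $f\colon X\to Y$ with $X,Y\in\mathcal{X}$ we have $\operatorname{Im} f\in\mathcal{X}$ (resp. $\operatorname{Ker} f$, $\operatorname{Cok} f\in\mathcal{X}$); extension-closed if for every exact sequence $0\to A\to B\to C\to 0$ with $A,C\in\mathcal{X}$ we have $B\in\mathcal{X}$; a torsion-free class if closed under subobjects and extensions; a torsion class if closed under quotients and extensions; a Serre subcategory if closed under subobjects, quotients and extensions; wide if closed under kernels, cokernels and extensions; IE-closed if closed under images and extensions; IKE-closed if closed under images, kernels and extensions; ICE-closed if closed under images, cokernels and extensions; CE-closed if closed under cokernels and extensions. *)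

theory Defs
  imports "HOL-Algebra.Group"
begin

unbundle cardinal_syntax

section \<open>Smallness\<close>

text \<open>
  Smallness is relative to a Grothendieck universe, represented by an uncountable inaccessible
  cardinal \<open>\<kappa>\<close> on some type \<open>'k\<close>: a set (of any type) is small when its cardinality is
  below \<open>\<kappa>\<close>.  As every small set is in bijection with a subset of \<open>'k\<close>, quantifying over
  small index categories whose objects and arrows have type \<open>'k\<close> loses no generality.
\<close>

definition inaccessible :: "'k rel \<Rightarrow> bool" where
  "inaccessible \<kappa> \<longleftrightarrow> Card_order \<kappa> \<and> natLeq <o \<kappa> \<and> regularCard \<kappa> \<and>
     (\<forall>S :: 'k set. |S| <o \<kappa> \<longrightarrow> |Pow S| <o \<kappa>)"

definition small :: "'k rel \<Rightarrow> 'a set \<Rightarrow> bool" where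
  "small \<kappa> S \<longleftrightarrow> |S| <o \<kappa>"


section \<open>Categories\<close>

record ('o, 'm) cat =
  Obj :: "'o set"
  Arr :: "'m set"
  src :: "'m \<Rightarrow> 'o"
  tgt :: "'m \<Rightarrow> 'o"
  idn :: "'o \<Rightarrow> 'm"
  comp :: "'m \<Rightarrow> 'm \<Rightarrow> 'm"  (infixr "\<bullet>\<index>" 70)

definition homs :: "('o, 'm, 'z) cat_scheme \<Rightarrow> 'o \<Rightarrow> 'o \<Rightarrow> 'm set" where
  "homs C A B = {f \<in> Arr C. src C f = A \<and> tgt C f = B}"

locale category =
  fixes C :: "('o, 'm, 'z) cat_scheme" (structure)
  assumes src_in_Obj: "f \<in> Arr C \<Longrightarrow> src C f \<in> Obj C"
    and tgt_in_Obj: "f \<in> Arr C \<Longrightarrow> tgt C f \<in> Obj C"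
    and idn_in_homs: "A \<in> Obj C \<Longrightarrow> idn C A \<in> homs C A A"
    and comp_in_homs: "f \<in> homs C A B \<Longrightarrow> g \<in> homs C B D \<Longrightarrow> g \<bullet> f \<in> homs C A D"
    and comp_idn_left: "f \<in> homs C A B \<Longrightarrow> idn C B \<bullet> f = f"
    and comp_idn_right: "f \<in> homs C A B \<Longrightarrow> f \<bullet> idn C A = f"
    and comp_assoc: "f \<in> homs C A B \<Longrightarrow> g \<in> homs C B D \<Longrightarrow> h \<in> homs C D E \<Longrightarrow>
      (h \<bullet> g) \<bullet> f = h \<bullet> (g \<bullet> f)"

definition full_subcategory :: "('o, 'm, 'z) cat_scheme \<Rightarrow> 'o set \<Rightarrow> ('o, 'm) cat" where
  "full_subcategory C S =
     \<lparr>Obj = S, Arr = {f \<in> Arr C. src C f \<in> S \<and> tgt C f \<in> S},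
      src = src C, tgt = tgt C, idn = idn C, comp = comp C\<rparr>"

context
  fixes C :: "('o, 'm, 'z) cat_scheme" (structure)
begin

definition monic :: "'m \<Rightarrow> bool" where
  "monic m \<longleftrightarrow> m \<in> Arr C \<and>
     (\<forall>f \<in> Arr C. \<forall>g \<in> Arr C. src C f = src C g \<and> tgt C f = src C m \<and> tgt C g = src C m \<and>
        m \<bullet> f = m \<bullet> g \<longrightarrow> f = g)"

definition epic :: "'m \<Rightarrow> bool" where
  "epic e \<longleftrightarrow> e \<in> Arr C \<and>
     (\<forall>f \<in> Arr C. \<forall>g \<in> Arr C. tgt C f = tgt C g \<and> src C f = tgt C e \<and> src C g = tgt C e \<and>
        f \<bullet> e = g \<bullet> e \<longrightarrow> f = g)"

definition is_iso :: "'m \<Rightarrow> bool" where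
  "is_iso f \<longleftrightarrow> f \<in> Arr C \<and>
     (\<exists>g \<in> homs C (tgt C f) (src C f). g \<bullet> f = idn C (src C f) \<and> f \<bullet> g = idn C (tgt C f))"

definition isomorphic :: "'o \<Rightarrow> 'o \<Rightarrow> bool" where
  "isomorphic A B \<longleftrightarrow> (\<exists>f \<in> homs C A B. is_iso f)"

definition zero_object :: "'o \<Rightarrow> bool" where
  "zero_object Z \<longleftrightarrow> Z \<in> Obj C \<and>
     (\<forall>A \<in> Obj C. (\<exists>!f. f \<in> homs C A Z) \<and> (\<exists>!f. f \<in> homs C Z A))"

definition zero_arrow :: "'m \<Rightarrow> bool" where
  "zero_arrow f \<longleftrightarrow> f \<in> Arr C \<and>
     (\<exists>Z a b. zero_object Z \<and> a \<in> homs C (src C f) Z \<and> b \<in> homs C Z (tgt C f) \<and> f = b \<bullet> a)"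

definition is_kernel :: "'m \<Rightarrow> 'm \<Rightarrow> bool" where
  "is_kernel f k \<longleftrightarrow> f \<in> Arr C \<and> k \<in> Arr C \<and> tgt C k = src C f \<and> zero_arrow (f \<bullet> k) \<and>
     (\<forall>h \<in> Arr C. tgt C h = src C f \<and> zero_arrow (f \<bullet> h) \<longrightarrow>
        (\<exists>!u. u \<in> homs C (src C h) (src C k) \<and> k \<bullet> u = h))"

definition is_cokernel :: "'m \<Rightarrow> 'm \<Rightarrow> bool" where
  "is_cokernel f q \<longleftrightarrow> f \<in> Arr C \<and> q \<in> Arr C \<and> src C q = tgt C f \<and> zero_arrow (q \<bullet> f) \<and>
     (\<forall>h \<in> Arr C. src C h = tgt C f \<and> zero_arrow (h \<bullet> f) \<longrightarrow>
        (\<exists>!u. u \<in> homs C (tgt C q) (tgt C h) \<and> u \<bullet> q = h))"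

text \<open>\<open>Im f = Ker (Cok f)\<close>.\<close>

definition is_image :: "'m \<Rightarrow> 'm \<Rightarrow> bool" where
  "is_image f m \<longleftrightarrow> (\<exists>q. is_cokernel f q \<and> is_kernel q m)"

definition short_exact :: "'m \<Rightarrow> 'm \<Rightarrow> bool" where
  "short_exact f g \<longleftrightarrow> is_kernel g f \<and> is_cokernel f g"

definition is_product :: "'o \<Rightarrow> 'o \<Rightarrow> 'o \<Rightarrow> 'm \<Rightarrow> 'm \<Rightarrow> bool" where
  "is_product A B P p q \<longleftrightarrow> p \<in> homs C P A \<and> q \<in> homs C P B \<and>
     (\<forall>X. \<forall>f \<in> homs C X A. \<forall>g \<in> homs C X B. \<exists>!h. h \<in> homs C X P \<and> p \<bullet> h = f \<and> q \<bullet> h = g)"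

definition generating :: "'o set \<Rightarrow> bool" where
  "generating S \<longleftrightarrow> S \<subseteq> Obj C \<and>
     (\<forall>f \<in> Arr C. \<forall>g \<in> Arr C. src C f = src C g \<and> tgt C f = tgt C g \<and> f \<noteq> g \<longrightarrow>
        (\<exists>G \<in> S. \<exists>h \<in> homs C G (src C f). f \<bullet> h \<noteq> g \<bullet> h))"

text \<open>Subobjects of an object are represented by monomorphisms into it, preordered by
  factorization.\<close>

definition sub_le :: "'m \<Rightarrow> 'm \<Rightarrow> bool" where
  "sub_le m n \<longleftrightarrow> (\<exists>u \<in> homs C (src C m) (src C n). n \<bullet> u = m)"

definition noetherian :: "'o \<Rightarrow> bool" where
  "noetherian A \<longleftrightarrow> A \<in> Obj C \<and>
     (\<forall>m :: nat \<Rightarrow> 'm. (\<forall>n. monic (m n) \<and> tgt C (m n) = A \<and> sub_le (m n) (m (Suc n))) \<longrightarrow>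
        (\<exists>N. \<forall>n \<ge> N. sub_le (m n) (m N)))"

end

abbreviation noeth_cat :: "('o, 'm, 'z) cat_scheme \<Rightarrow> ('o, 'm) cat" where
  "noeth_cat C \<equiv> full_subcategory C {A. noetherian C A}"


section \<open>Abelian categories\<close>

definition preadditive :: "('o, 'm, 'z) cat_scheme \<Rightarrow> bool" where
  "preadditive C \<longleftrightarrow>
     (\<exists>(add :: 'm \<Rightarrow> 'm \<Rightarrow> 'm) (zero :: 'o \<Rightarrow> 'o \<Rightarrow> 'm).
        (\<forall>A \<in> Obj C. \<forall>B \<in> Obj C.
           comm_group \<lparr>carrier = homs C A B, mult = add, one = zero A B\<rparr>) \<and>
        (\<forall>A B D. \<forall>f \<in> homs C A B. \<forall>f' \<in> homs C A B. \<forall>g \<in> homs C B D. \<forall>g' \<in> homs C B D.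
           comp C g (add f f') = add (comp C g f) (comp C g f') \<and>
           comp C (add g g') f = add (comp C g f) (comp C g' f)))"

locale abelian_category = category +
  assumes preadditive: "preadditive C"
    and has_zero_object: "\<exists>Z. zero_object C Z"
    and has_products: "A \<in> Obj C \<Longrightarrow> B \<in> Obj C \<Longrightarrow> \<exists>P p q. is_product C A B P p q"
    and has_kernels: "f \<in> Arr C \<Longrightarrow> \<exists>k. is_kernel C f k"
    and has_cokernels: "f \<in> Arr C \<Longrightarrow> \<exists>q. is_cokernel C f q"
    and monic_is_kernel: "monic C m \<Longrightarrow> \<exists>f. is_kernel C f m"
    and epic_is_cokernel: "epic C e \<Longrightarrow> \<exists>f. is_cokernel C f e"


section \<open>Grothendieck categories\<close>

definition small_category :: "'k rel \<Rightarrow> ('a, 'b, 'z) cat_scheme \<Rightarrow> bool" where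
  "small_category \<kappa> J \<longleftrightarrow> category J \<and> small \<kappa> (Obj J) \<and> small \<kappa> (Arr J)"

definition filtered :: "('a, 'b, 'z) cat_scheme \<Rightarrow> bool" where
  "filtered J \<longleftrightarrow> Obj J \<noteq> {} \<and>
     (\<forall>i \<in> Obj J. \<forall>j \<in> Obj J. \<exists>k \<in> Obj J. homs J i k \<noteq> {} \<and> homs J j k \<noteq> {}) \<and>
     (\<forall>i \<in> Obj J. \<forall>j \<in> Obj J. \<forall>u \<in> homs J i j. \<forall>v \<in> homs J i j.
        \<exists>k \<in> Obj J. \<exists>w \<in> homs J j k. comp J w u = comp J w v)"

definition is_functor ::
    "('a, 'b, 'y) cat_scheme \<Rightarrow> ('o, 'm, 'z) cat_scheme \<Rightarrow> ('a \<Rightarrow> 'o) \<Rightarrow> ('b \<Rightarrow> 'm) \<Rightarrow> bool" where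
  "is_functor J C Fo Fa \<longleftrightarrow>
     (\<forall>i \<in> Obj J. Fo i \<in> Obj C \<and> Fa (idn J i) = idn C (Fo i)) \<and>
     (\<forall>i j. \<forall>u \<in> homs J i j. Fa u \<in> homs C (Fo i) (Fo j)) \<and>
     (\<forall>i j k. \<forall>u \<in> homs J i j. \<forall>v \<in> homs J j k. Fa (comp J v u) = comp C (Fa v) (Fa u))"

definition is_natural ::
    "('a, 'b, 'y) cat_scheme \<Rightarrow> ('o, 'm, 'z) cat_scheme \<Rightarrow> ('a \<Rightarrow> 'o) \<Rightarrow> ('b \<Rightarrow> 'm) \<Rightarrow>
     ('a \<Rightarrow> 'o) \<Rightarrow> ('b \<Rightarrow> 'm) \<Rightarrow> ('a \<Rightarrow> 'm) \<Rightarrow> bool" where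
  "is_natural J C Fo Fa Go Ga \<alpha> \<longleftrightarrow>
     (\<forall>j \<in> Obj J. \<alpha> j \<in> homs C (Fo j) (Go j)) \<and>
     (\<forall>i j. \<forall>u \<in> homs J i j. comp C (\<alpha> j) (Fa u) = comp C (Ga u) (\<alpha> i))"

definition is_cocone ::
    "('a, 'b, 'y) cat_scheme \<Rightarrow> ('o, 'm, 'z) cat_scheme \<Rightarrow> ('a \<Rightarrow> 'o) \<Rightarrow> ('b \<Rightarrow> 'm) \<Rightarrow>
     'o \<Rightarrow> ('a \<Rightarrow> 'm) \<Rightarrow> bool" where
  "is_cocone J C Fo Fa K \<iota> \<longleftrightarrow> K \<in> Obj C \<and>
     (\<forall>j \<in> Obj J. \<iota> j \<in> homs C (Fo j) K) \<and>
     (\<forall>i j. \<forall>u \<in> homs J i j. comp C (\<iota> j) (Fa u) = \<iota> i)"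

definition is_colimit ::
    "('a, 'b, 'y) cat_scheme \<Rightarrow> ('o, 'm, 'z) cat_scheme \<Rightarrow> ('a \<Rightarrow> 'o) \<Rightarrow> ('b \<Rightarrow> 'm) \<Rightarrow>
     'o \<Rightarrow> ('a \<Rightarrow> 'm) \<Rightarrow> bool" where
  "is_colimit J C Fo Fa K \<iota> \<longleftrightarrow> is_cocone J C Fo Fa K \<iota> \<and>
     (\<forall>K' \<iota>'. is_cocone J C Fo Fa K' \<iota>' \<longrightarrow>
        (\<exists>!h. h \<in> homs C K K' \<and> (\<forall>j \<in> Obj J. comp C h (\<iota> j) = \<iota>' j)))"

text \<open>In \<open>filtered_colimits_exact\<close>, \<open>a\<close> and \<open>b\<close> are the arrows induced on colimits by the
  natural transformations \<open>\<alpha>\<close> and \<open>\<beta>\<close>.\<close>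

locale grothendieck_category = abelian_category C
  for \<kappa> :: "'k rel" and C :: "('o, 'm, 'z) cat_scheme" (structure) +
  assumes locally_small: "A \<in> Obj C \<Longrightarrow> B \<in> Obj C \<Longrightarrow> small \<kappa> (homs C A B)"
    and cocomplete: "small_category \<kappa> (J :: ('k, 'k) cat) \<Longrightarrow> is_functor J C Fo Fa \<Longrightarrow>
      \<exists>K \<iota>. is_colimit J C Fo Fa K \<iota>"
    and filtered_colimits_exact: "\<lbrakk>small_category \<kappa> (J :: ('k, 'k) cat); filtered J;
      is_functor J C Fo Fa; is_functor J C Go Ga; is_functor J C Ho Ha;
      is_natural J C Fo Fa Go Ga \<alpha>; is_natural J C Go Ga Ho Ha \<beta>;
      \<forall>j \<in> Obj J. short_exact C (\<alpha> j) (\<beta> j);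
      is_colimit J C Fo Fa K \<iota>; is_colimit J C Go Ga K' \<iota>'; is_colimit J C Ho Ha K'' \<iota>'';
      a \<in> homs C K K'; \<forall>j \<in> Obj J. a \<bullet> \<iota> j = \<iota>' j \<bullet> \<alpha> j;
      b \<in> homs C K' K''; \<forall>j \<in> Obj J. b \<bullet> \<iota>' j = \<iota>'' j \<bullet> \<beta> j\<rbrakk> \<Longrightarrow> short_exact C a b"
    and has_generator: "\<exists>G. generating C {G}"

definition locally_noetherian :: "'k rel \<Rightarrow> ('o, 'm, 'z) cat_scheme \<Rightarrow> bool" where
  "locally_noetherian \<kappa> C \<longleftrightarrow>
     (\<exists>S. small \<kappa> S \<and> generating C S \<and> (\<forall>G \<in> S. noetherian C G))"

text \<open>
  The colimit in sets of \<open>j \<mapsto> Hom(A, F j)\<close> is the quotient of the disjoint union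
  \<open>hom_coprod J C Fo A\<close> by the equivalence relation generated by
  \<open>(i, f) \<sim> (j, F u \<circ> f)\<close> for \<open>u : i \<rightarrow> j\<close>.
\<close>

definition hom_coprod ::
    "('a, 'b, 'y) cat_scheme \<Rightarrow> ('o, 'm, 'z) cat_scheme \<Rightarrow> ('a \<Rightarrow> 'o) \<Rightarrow> 'o \<Rightarrow> ('a \<times> 'm) set" where
  "hom_coprod J C Fo A = (SIGMA j : Obj J. homs C A (Fo j))"

definition hom_step ::
    "('a, 'b, 'y) cat_scheme \<Rightarrow> ('o, 'm, 'z) cat_scheme \<Rightarrow> ('a \<Rightarrow> 'o) \<Rightarrow> ('b \<Rightarrow> 'm) \<Rightarrow> 'o \<Rightarrow>
     ('a \<times> 'm) rel" where
  "hom_step J C Fo Fa A =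
     {((i, f), (j, comp C (Fa u) f)) | i j u f. u \<in> homs J i j \<and> f \<in> homs C A (Fo i)}"

definition hom_colim ::
    "('a, 'b, 'y) cat_scheme \<Rightarrow> ('o, 'm, 'z) cat_scheme \<Rightarrow> ('a \<Rightarrow> 'o) \<Rightarrow> ('b \<Rightarrow> 'm) \<Rightarrow> 'o \<Rightarrow>
     ('a \<times> 'm) set set" where
  "hom_colim J C Fo Fa A =
     hom_coprod J C Fo A // (hom_step J C Fo Fa A \<union> (hom_step J C Fo Fa A)\<inverse>)\<^sup>*"

text \<open>\<open>Hom(A, -)\<close> preserves small filtered colimits: the canonical map
  \<open>colim Hom(A, F j) \<rightarrow> Hom(A, colim F)\<close>, \<open>[(j, f)] \<mapsto> \<iota> j \<circ> f\<close>, is a bijection.\<close>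

definition finitely_presented :: "'k rel \<Rightarrow> ('o, 'm, 'z) cat_scheme \<Rightarrow> 'o \<Rightarrow> bool" where
  "finitely_presented \<kappa> C A \<longleftrightarrow> A \<in> Obj C \<and>
     (\<forall>(J :: ('k, 'k) cat) Fo Fa K \<iota>.
        small_category \<kappa> J \<and> filtered J \<and> is_functor J C Fo Fa \<and> is_colimit J C Fo Fa K \<iota> \<longrightarrow>
        bij_betw (\<lambda>c. the_elem ((\<lambda>(j, f). comp C (\<iota> j) f) ` c)) (hom_colim J C Fo Fa A)
          (homs C A K))"


section \<open>Symmetric monoidal closed categories\<close>

record ('o, 'm) mon_cat = "('o, 'm) cat" +
  tens :: "'o \<Rightarrow> 'o \<Rightarrow> 'o"  (infixr "\<odot>\<index>" 75)
  tensa :: "'m \<Rightarrow> 'm \<Rightarrow> 'm"  (infixr "\<star>\<index>" 75)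
  munit :: "'o"
  asc :: "'o \<Rightarrow> 'o \<Rightarrow> 'o \<Rightarrow> 'm"
  lun :: "'o \<Rightarrow> 'm"
  run :: "'o \<Rightarrow> 'm"
  swp :: "'o \<Rightarrow> 'o \<Rightarrow> 'm"

locale symmetric_monoidal_category = category C
  for C :: "('o, 'm, 'z) mon_cat_scheme" (structure) +
  assumes tens_in_Obj: "A \<in> Obj C \<Longrightarrow> B \<in> Obj C \<Longrightarrow> A \<odot> B \<in> Obj C"
    and tensa_in_homs:
      "f \<in> homs C A B \<Longrightarrow> g \<in> homs C A' B' \<Longrightarrow> f \<star> g \<in> homs C (A \<odot> A') (B \<odot> B')"
    and tensa_idn: "A \<in> Obj C \<Longrightarrow> B \<in> Obj C \<Longrightarrow> idn C A \<star> idn C B = idn C (A \<odot> B)"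
    and tensa_comp: "f \<in> homs C A B \<Longrightarrow> g \<in> homs C B D \<Longrightarrow>
      f' \<in> homs C A' B' \<Longrightarrow> g' \<in> homs C B' D' \<Longrightarrow>
      (g \<bullet> f) \<star> (g' \<bullet> f') = (g \<star> g') \<bullet> (f \<star> f')"
    and munit_in_Obj: "munit C \<in> Obj C"
    and asc_in_homs: "A \<in> Obj C \<Longrightarrow> B \<in> Obj C \<Longrightarrow> D \<in> Obj C \<Longrightarrow>
      asc C A B D \<in> homs C ((A \<odot> B) \<odot> D) (A \<odot> (B \<odot> D))"
    and asc_iso: "A \<in> Obj C \<Longrightarrow> B \<in> Obj C \<Longrightarrow> D \<in> Obj C \<Longrightarrow> is_iso C (asc C A B D)"
    and asc_natural: "f \<in> homs C A A' \<Longrightarrow> g \<in> homs C B B' \<Longrightarrow> h \<in> homs C D D' \<Longrightarrow>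
      asc C A' B' D' \<bullet> ((f \<star> g) \<star> h) = (f \<star> (g \<star> h)) \<bullet> asc C A B D"
    and lun_in_homs: "A \<in> Obj C \<Longrightarrow> lun C A \<in> homs C (munit C \<odot> A) A"
    and lun_iso: "A \<in> Obj C \<Longrightarrow> is_iso C (lun C A)"
    and lun_natural: "f \<in> homs C A B \<Longrightarrow> lun C B \<bullet> (idn C (munit C) \<star> f) = f \<bullet> lun C A"
    and run_in_homs: "A \<in> Obj C \<Longrightarrow> run C A \<in> homs C (A \<odot> munit C) A"
    and run_iso: "A \<in> Obj C \<Longrightarrow> is_iso C (run C A)"
    and run_natural: "f \<in> homs C A B \<Longrightarrow> run C B \<bullet> (f \<star> idn C (munit C)) = f \<bullet> run C A"
    and swp_in_homs: "A \<in> Obj C \<Longrightarrow> B \<in> Obj C \<Longrightarrow> swp C A B \<in> homs C (A \<odot> B) (B \<odot> A)"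
    and swp_natural: "f \<in> homs C A A' \<Longrightarrow> g \<in> homs C B B' \<Longrightarrow>
      swp C A' B' \<bullet> (f \<star> g) = (g \<star> f) \<bullet> swp C A B"
    and swp_swp: "A \<in> Obj C \<Longrightarrow> B \<in> Obj C \<Longrightarrow> swp C B A \<bullet> swp C A B = idn C (A \<odot> B)"
    and pentagon: "A \<in> Obj C \<Longrightarrow> B \<in> Obj C \<Longrightarrow> D \<in> Obj C \<Longrightarrow> E \<in> Obj C \<Longrightarrow>
      (idn C A \<star> asc C B D E) \<bullet> asc C A (B \<odot> D) E \<bullet> (asc C A B D \<star> idn C E) =
      asc C A B (D \<odot> E) \<bullet> asc C (A \<odot> B) D E"
    and triangle: "A \<in> Obj C \<Longrightarrow> B \<in> Obj C \<Longrightarrow>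
      (idn C A \<star> lun C B) \<bullet> asc C A (munit C) B = run C A \<star> idn C B"
    and hexagon: "A \<in> Obj C \<Longrightarrow> B \<in> Obj C \<Longrightarrow> D \<in> Obj C \<Longrightarrow>
      asc C B D A \<bullet> swp C A (B \<odot> D) \<bullet> asc C A B D =
      (idn C B \<star> swp C A D) \<bullet> asc C B A D \<bullet> (swp C A B \<star> idn C D)"
    and lun_swp: "A \<in> Obj C \<Longrightarrow> lun C A \<bullet> swp C A (munit C) = run C A"

text \<open>\<open>H\<close> is the internal hom from \<open>A\<close> to \<open>B\<close>, and \<open>ev\<close> is its evaluation map.\<close>

locale symmetric_monoidal_closed_category = symmetric_monoidal_category +
  assumes closed: "A \<in> Obj C \<Longrightarrow> B \<in> Obj C \<Longrightarrow>
    \<exists>H \<in> Obj C. \<exists>ev \<in> homs C (H \<odot> A) B.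
      \<forall>X \<in> Obj C. \<forall>f \<in> homs C (X \<odot> A) B.
        \<exists>!g. g \<in> homs C X H \<and> ev \<bullet> (g \<star> idn C A) = f"

locale grothendieck_cosmos =
  grothendieck_category \<kappa> C + symmetric_monoidal_closed_category C
  for \<kappa> :: "'k rel" and C :: "('o, 'm, 'z) mon_cat_scheme" (structure)

definition invertible :: "('o, 'm, 'z) mon_cat_scheme \<Rightarrow> 'o \<Rightarrow> bool" where
  "invertible C L \<longleftrightarrow> L \<in> Obj C \<and> (\<exists>M \<in> Obj C. isomorphic C (tens C L M) (munit C))"

text \<open>The filtration \<open>0 = M\<^sub>0 \<subseteq> \<dots> \<subseteq> M\<^sub>n = M\<close> is given by monomorphisms
  \<open>m i : M\<^sub>i \<rightarrow> M\<close> with inclusions \<open>u i : M\<^sub>i \<rightarrow> M\<^sub>i\<^sub>+\<^sub>1\<close>, where \<open>q i\<close> is the projection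
  onto \<open>M\<^sub>i\<^sub>+\<^sub>1 / M\<^sub>i\<close>.  The equality \<open>M\<^sub>n = M\<close> of subobjects says that \<open>m n\<close> is an
  isomorphism.\<close>

definition invertible_filtered :: "('o, 'm, 'z) mon_cat_scheme \<Rightarrow> 'o \<Rightarrow> bool" where
  "invertible_filtered C M \<longleftrightarrow> M \<in> Obj C \<and>
     (\<exists>(n :: nat) m u q.
        (\<forall>i \<le> n. monic C (m i) \<and> tgt C (m i) = M) \<and>
        zero_object C (src C (m 0)) \<and> is_iso C (m n) \<and>
        (\<forall>i < n. u i \<in> homs C (src C (m i)) (src C (m (Suc i))) \<and>
           comp C (m (Suc i)) (u i) = m i \<and>
           is_cokernel C (u i) (q i) \<and> invertible C (tgt C (q i))))"


section \<open>Subcategories\<close>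

text \<open>Full subcategories closed under isomorphisms are identified with their sets of objects.\<close>

definition subcategory :: "('o, 'm, 'z) cat_scheme \<Rightarrow> 'o set \<Rightarrow> bool" where
  "subcategory B X \<longleftrightarrow> X \<subseteq> Obj B \<and> (\<forall>M \<in> X. \<forall>N. isomorphic B M N \<longrightarrow> N \<in> X)"

definition L_closed :: "('o, 'm, 'z) mon_cat_scheme \<Rightarrow> 'o set \<Rightarrow> bool" where
  "L_closed C X \<longleftrightarrow> (\<forall>M \<in> X. \<forall>L. invertible C L \<longrightarrow> tens C M L \<in> X)"

text \<open>In the following, the ambient \<open>B\<close> is abelian, so that binary products are direct sums.\<close>

definition additive_subcategory :: "('o, 'm, 'z) cat_scheme \<Rightarrow> 'o set \<Rightarrow> bool" where
  "additive_subcategory B X \<longleftrightarrow> subcategory B X \<and>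
     (\<forall>Z. zero_object B Z \<longrightarrow> Z \<in> X) \<and>
     (\<forall>M \<in> X. \<forall>N \<in> X. \<forall>P p q. is_product B M N P p q \<longrightarrow> P \<in> X)"

context
  fixes B :: "('o, 'm, 'z) cat_scheme" and X :: "'o set"
begin

definition closed_under_images :: bool where
  "closed_under_images \<longleftrightarrow>
     (\<forall>M \<in> X. \<forall>N \<in> X. \<forall>f \<in> homs B M N. \<forall>m. is_image B f m \<longrightarrow> src B m \<in> X)"

definition closed_under_kernels :: bool where
  "closed_under_kernels \<longleftrightarrow>
     (\<forall>M \<in> X. \<forall>N \<in> X. \<forall>f \<in> homs B M N. \<forall>k. is_kernel B f k \<longrightarrow> src B k \<in> X)"

definition closed_under_cokernels :: bool where
  "closed_under_cokernels \<longleftrightarrow>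
     (\<forall>M \<in> X. \<forall>N \<in> X. \<forall>f \<in> homs B M N. \<forall>q. is_cokernel B f q \<longrightarrow> tgt B q \<in> X)"

definition extension_closed :: bool where
  "extension_closed \<longleftrightarrow>
     (\<forall>f g. short_exact B f g \<and> src B f \<in> X \<and> tgt B g \<in> X \<longrightarrow> tgt B f \<in> X)"

definition closed_under_subobjects :: bool where
  "closed_under_subobjects \<longleftrightarrow> (\<forall>m. monic B m \<and> tgt B m \<in> X \<longrightarrow> src B m \<in> X)"

definition closed_under_quotients :: bool where
  "closed_under_quotients \<longleftrightarrow> (\<forall>e. epic B e \<and> src B e \<in> X \<longrightarrow> tgt B e \<in> X)"

definition torsion_free_class :: bool where
  "torsion_free_class \<longleftrightarrow> additive_subcategory B X \<and> closed_under_subobjects \<and> extension_closed"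

definition torsion_class :: bool where
  "torsion_class \<longleftrightarrow> additive_subcategory B X \<and> closed_under_quotients \<and> extension_closed"

definition serre_subcategory :: bool where
  "serre_subcategory \<longleftrightarrow> additive_subcategory B X \<and>
     closed_under_subobjects \<and> closed_under_quotients \<and> extension_closed"

definition wide_subcategory :: bool where
  "wide_subcategory \<longleftrightarrow> additive_subcategory B X \<and>
     closed_under_kernels \<and> closed_under_cokernels \<and> extension_closed"

definition IE_closed :: bool where
  "IE_closed \<longleftrightarrow> additive_subcategory B X \<and> closed_under_images \<and> extension_closed"

definition IKE_closed :: bool where
  "IKE_closed \<longleftrightarrow> additive_subcategory B X \<and>
     closed_under_images \<and> closed_under_kernels \<and> extension_closed"

definition ICE_closed :: bool where
  "ICE_closed \<longleftrightarrow> additive_subcategory B X \<and>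
     closed_under_images \<and> closed_under_cokernels \<and> extension_closed"

definition CE_closed :: bool where
  "CE_closed \<longleftrightarrow> additive_subcategory B X \<and> closed_under_cokernels \<and> extension_closed"

end

end

theory Submission
  imports Defs
begin

text \<open>
  Everything follows from one fact: if \<open>Y\<close> is a nonzero subobject of a noetherian object \<open>M\<close>, then
  there is a nonzero arrow \<open>M \<odot> L \<rightarrow> Y\<close> with \<open>L\<close> invertible.  Given this, let \<open>X\<close> be closed under
  cokernels and \<open>M \<in> X\<close>, and let \<open>K\<^sub>0\<close> be maximal among the subobjects of \<open>K \<subseteq> M\<close> with
  \<open>M/K\<^sub>0 \<in> X\<close>.  If \<open>K\<^sub>0 \<noteq> K\<close>, the cokernel of a nonzero arrow \<open>M/K\<^sub>0 \<odot> L \<rightarrow> K/K\<^sub>0\<close> contradicts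
  maximality.  So \<open>X\<close> is closed under quotients.  Similarly, let \<open>X\<close> be closed under images and
  extensions and let \<open>K\<^sub>0\<close> be maximal among the subobjects of \<open>K \<subseteq> M\<close> that lie in \<open>X\<close>.  If
  \<open>K\<^sub>0 \<noteq> K\<close>, pulling back \<open>K \<rightarrow> K/K\<^sub>0\<close> along a nonzero arrow \<open>M \<odot> L \<rightarrow> M/K\<^sub>0 \<odot> L \<rightarrow> K/K\<^sub>0\<close>
  gives an extension in \<open>X\<close> whose image in \<open>K\<close> is strictly larger than \<open>K\<^sub>0\<close>.

  For modules over a commutative ring the basic fact is proved by localizing at an associated prime
  of \<open>Y\<close>.  Here an ideal element is replaced by an arrow \<open>s\<close> with invertible target, acting on an
  object \<open>Z\<close> by \<open>idn Z \<star> s\<close>.  Prime ideals make sense because every nonzero object receives a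
  nonzero arrow from an invertible object, which follows from generation by invertible-filtered
  objects.
\<close>

section \<open>Categories with a zero object\<close>

text \<open>For modules the basic fact rests on Nakayama: M localized at p maps onto the residue
  field k(p), and clearing denominators gives a nonzero arrow from M to a copy of R/p inside Y. No
  localization is formed here. Instead of asking whether Z vanishes at the prime, one asks whether
  some arrow outside the prime annihilates Z. The residue field becomes a quotient of M that is not
  annihilated in this sense although all its proper quotients are.

  The elements of the prime have invertible targets but arbitrary sources. Sources must be arbitrary
  because kernels of arrows out of invertible objects have to count as elements. Targets must be
  invertible because tensoring with invertible objects is exact, while in general it is only right
  exact. An unwanted source is removed in one of two ways: an invertible object is mapped
  nontrivially into an image, or the arrow is transposed and an invertible object is mapped
  nontrivially into the internal hom.\<close>

context category
begin

lemma homs_iff: "f \<in> homs C A B \<longleftrightarrow> f \<in> Arr C \<and> src C f = A \<and> tgt C f = B"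
  by (simp add: homs_def)

lemma idn_simps [simp]:
  assumes "A \<in> Obj C"
  shows "idn C A \<in> Arr C" "src C (idn C A) = A" "tgt C (idn C A) = A"
  using idn_in_homs[OF assms] by (simp_all add: homs_iff)

lemma comp_simps [simp]:
  assumes "f \<in> Arr C" "g \<in> Arr C" "src C g = tgt C f"
  shows "g \<bullet> f \<in> Arr C" "src C (g \<bullet> f) = src C f" "tgt C (g \<bullet> f) = tgt C g"
  using comp_in_homs[of f "src C f" "tgt C f" g "tgt C g"] assms by (simp_all add: homs_iff)

text \<open>Conditions on sources and targets can be discharged by rewriting, unlike membership in
  \<open>homs\<close>. Composites are normalised to the right; steps that regroup to the left
  instantiate the rule explicitly.\<close>

lemma comp_assoc' [simp]:
  assumes "f \<in> Arr C" "g \<in> Arr C" "h \<in> Arr C" "src C g = tgt C f" "src C h = tgt C g"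
  shows "(h \<bullet> g) \<bullet> f = h \<bullet> (g \<bullet> f)"
  using comp_assoc[of f "src C f" "tgt C f" g "tgt C g" h "tgt C h"] assms by (simp add: homs_iff)

lemma comp_idn [simp]:
  "f \<in> Arr C \<Longrightarrow> tgt C f = B \<Longrightarrow> idn C B \<bullet> f = f"
  "f \<in> Arr C \<Longrightarrow> src C f = B \<Longrightarrow> f \<bullet> idn C B = f"
  using comp_idn_left comp_idn_right by (auto simp: homs_iff)

declare src_in_Obj [simp] tgt_in_Obj [simp]

lemma homs_Obj: "f \<in> homs C A B \<Longrightarrow> A \<in> Obj C \<and> B \<in> Obj C"
  by (auto simp: homs_iff)

lemma monicD:
  assumes "monic C m" "m \<bullet> f = m \<bullet> g" "f \<in> Arr C" "g \<in> Arr C"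
    "src C f = src C g" "tgt C f = src C m" "tgt C g = src C m"
  shows "f = g"
  using assms(1)[unfolded monic_def, THEN conjunct2, rule_format, of f g] assms(2-) by simp

lemma epicD:
  assumes "epic C e" "f \<bullet> e = g \<bullet> e" "f \<in> Arr C" "g \<in> Arr C"
    "tgt C f = tgt C g" "src C f = tgt C e" "src C g = tgt C e"
  shows "f = g"
  using assms(1)[unfolded epic_def, THEN conjunct2, rule_format, of f g] assms(2-) by simp

lemma monic_arr [simp]: "monic C m \<Longrightarrow> m \<in> Arr C"
  and epic_arr [simp]: "epic C e \<Longrightarrow> e \<in> Arr C"
  by (auto simp: monic_def epic_def)

lemma monic_comp:
  assumes "monic C m" "monic C n" "src C m = tgt C n"
  shows "monic C (m \<bullet> n)"
  unfolding monic_def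
proof (intro conjI ballI impI; (elim conjE)?)
  fix f g assume *: "f \<in> Arr C" "g \<in> Arr C" "src C f = src C g" "tgt C f = src C (m \<bullet> n)"
    "tgt C g = src C (m \<bullet> n)" "(m \<bullet> n) \<bullet> f = (m \<bullet> n) \<bullet> g"
  have "n \<bullet> f = n \<bullet> g"
    by (rule monicD[OF assms(1)]) (use assms * in auto)
  then show "f = g"
    by (rule monicD[OF assms(2)]) (use assms * in auto)
qed (use assms in auto)

lemma epic_comp:
  assumes "epic C m" "epic C n" "src C m = tgt C n"
  shows "epic C (m \<bullet> n)"
  unfolding epic_def
proof (intro conjI ballI impI; (elim conjE)?)
  fix f g assume *: "f \<in> Arr C" "g \<in> Arr C" "tgt C f = tgt C g" "src C f = tgt C (m \<bullet> n)"
    "src C g = tgt C (m \<bullet> n)" "f \<bullet> (m \<bullet> n) = g \<bullet> (m \<bullet> n)"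
  have "f \<bullet> m = g \<bullet> m"
    by (rule epicD[OF assms(2)]) (use assms * in auto)
  then show "f = g"
    by (rule epicD[OF assms(1)]) (use assms * in auto)
qed (use assms in auto)

lemma monic_cancel:
  assumes "monic C (m \<bullet> n)" "m \<in> Arr C" "n \<in> Arr C" "src C m = tgt C n"
  shows "monic C n"
  unfolding monic_def
proof (intro conjI ballI impI; (elim conjE)?)
  fix f g assume *: "f \<in> Arr C" "g \<in> Arr C" "src C f = src C g" "tgt C f = src C n"
    "tgt C g = src C n" "n \<bullet> f = n \<bullet> g"
  show "f = g"
    by (rule monicD[OF assms(1)]) (use assms * in auto)
qed (use assms in auto)

lemma epic_cancel:
  assumes "epic C (m \<bullet> n)" "m \<in> Arr C" "n \<in> Arr C" "src C m = tgt C n"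
  shows "epic C m"
  unfolding epic_def
proof (intro conjI ballI impI; (elim conjE)?)
  fix f g assume *: "f \<in> Arr C" "g \<in> Arr C" "tgt C f = tgt C g" "src C f = tgt C m"
    "src C g = tgt C m" "f \<bullet> m = g \<bullet> m"
  have "f \<bullet> (m \<bullet> n) = g \<bullet> (m \<bullet> n)"
    using assms * comp_assoc'[of n m f] comp_assoc'[of n m g] by simp
  then show "f = g"
    by (rule epicD[OF assms(1)]) (use assms * in auto)
qed (use assms in auto)

lemma iso_arr [simp]: "is_iso C f \<Longrightarrow> f \<in> Arr C"
  by (auto simp: is_iso_def)

lemma isoI:
  assumes "f \<in> Arr C" "g \<in> Arr C" "src C g = tgt C f" "tgt C g = src C f"
    "g \<bullet> f = idn C (src C f)" "f \<bullet> g = idn C (tgt C f)"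
  shows "is_iso C f"
  unfolding is_iso_def homs_def using assms by blast

lemma isoE:
  assumes "is_iso C f"
  obtains g where "g \<in> Arr C" "src C g = tgt C f" "tgt C g = src C f"
    "g \<bullet> f = idn C (src C f)" "f \<bullet> g = idn C (tgt C f)" "is_iso C g"
proof -
  obtain g where g: "g \<in> Arr C" "src C g = tgt C f" "tgt C g = src C f"
    "g \<bullet> f = idn C (src C f)" "f \<bullet> g = idn C (tgt C f)"
    using assms unfolding is_iso_def homs_def by blast
  have "is_iso C g"
    by (rule isoI[of g f]) (use assms g in simp_all)
  then show thesis using g that by blast
qed

lemma idn_iso: "A \<in> Obj C \<Longrightarrow> is_iso C (idn C A)"
  by (rule isoI[of _ "idn C A"]) simp_all

lemma monic_idn: "A \<in> Obj C \<Longrightarrow> monic C (idn C A)"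
  unfolding monic_def by (intro conjI ballI impI; (elim conjE)?) simp_all

lemma epic_idn: "A \<in> Obj C \<Longrightarrow> epic C (idn C A)"
  unfolding epic_def by (intro conjI ballI impI; (elim conjE)?) simp_all

lemma iso_monic: assumes "is_iso C f" shows "monic C f"
proof -
  obtain g where g: "g \<in> Arr C" "src C g = tgt C f" "g \<bullet> f = idn C (src C f)"
    using isoE[OF assms] by blast
  then have "monic C (g \<bullet> f)" using assms by (simp add: monic_idn)
  then show ?thesis using g assms by (intro monic_cancel[of g f]) simp_all
qed

lemma iso_epic: assumes "is_iso C f" shows "epic C f"
proof -
  obtain g where g: "g \<in> Arr C" "tgt C g = src C f" "f \<bullet> g = idn C (tgt C f)"
    using isoE[OF assms] by blast
  then have "epic C (f \<bullet> g)" using assms by (simp add: epic_idn)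
  then show ?thesis using g assms by (intro epic_cancel[of f g]) simp_all
qed

lemma iso_comp:
  assumes "is_iso C f" "is_iso C g" "src C g = tgt C f"
  shows "is_iso C (g \<bullet> f)"
proof -
  obtain f' where f': "f' \<in> Arr C" "src C f' = tgt C f" "tgt C f' = src C f"
    "f' \<bullet> f = idn C (src C f)" "f \<bullet> f' = idn C (tgt C f)" using isoE[OF assms(1)] by blast
  obtain g' where g': "g' \<in> Arr C" "src C g' = tgt C g" "tgt C g' = src C g"
    "g' \<bullet> g = idn C (src C g)" "g \<bullet> g' = idn C (tgt C g)" using isoE[OF assms(2)] by blast
  have 1: "g' \<bullet> (g \<bullet> f) = f"
    using assms f' g' comp_assoc'[of f g g'] by simp
  have 2: "f \<bullet> (f' \<bullet> g') = g'"
    using assms f' g' comp_assoc'[of g' f' f] by simp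
  show ?thesis
    by (rule isoI[of _ "f' \<bullet> g'"]) (use assms f' g' 1 2 in auto)
qed

lemma isomorphic_iff:
  "isomorphic C A B \<longleftrightarrow> (\<exists>f. is_iso C f \<and> src C f = A \<and> tgt C f = B)"
  by (auto simp: isomorphic_def homs_iff)

lemma isomorphic_sym: "isomorphic C A B \<Longrightarrow> isomorphic C B A"
  unfolding isomorphic_iff using isoE by metis

lemma isomorphic_refl: "A \<in> Obj C \<Longrightarrow> isomorphic C A A"
  unfolding isomorphic_iff by (intro exI[of _ "idn C A"]) (simp add: idn_iso)

lemma isomorphic_trans [trans]:
  assumes "isomorphic C A B" "isomorphic C B D" shows "isomorphic C A D"
proof -
  obtain f g where "is_iso C f" "src C f = A" "tgt C f = B" "is_iso C g" "src C g = B" "tgt C g = D"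
    using assms unfolding isomorphic_iff by blast
  then show ?thesis
    unfolding isomorphic_iff by (intro exI[of _ "g \<bullet> f"]) (simp add: iso_comp)
qed

section \<open>Kernels and cokernels through their factorization property\<close>

lemma kernelD:
  assumes "is_kernel C f k"
  shows "f \<in> Arr C" "k \<in> Arr C" "tgt C k = src C f" "zero_arrow C (f \<bullet> k)"
  using assms by (auto simp: is_kernel_def)

lemma cokernelD:
  assumes "is_cokernel C f q"
  shows "f \<in> Arr C" "q \<in> Arr C" "src C q = tgt C f" "zero_arrow C (q \<bullet> f)"
  using assms by (auto simp: is_cokernel_def)

lemma kernel_factor:
  assumes "is_kernel C f k" "h \<in> Arr C" "tgt C h = src C f" "zero_arrow C (f \<bullet> h)"
  obtains u where "u \<in> Arr C" "src C u = src C h" "tgt C u = src C k" "k \<bullet> u = h"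
  using assms unfolding is_kernel_def homs_def by blast

lemma cokernel_factor:
  assumes "is_cokernel C f q" "h \<in> Arr C" "src C h = tgt C f" "zero_arrow C (h \<bullet> f)"
  obtains u where "u \<in> Arr C" "src C u = tgt C q" "tgt C u = tgt C h" "u \<bullet> q = h"
  using assms unfolding is_cokernel_def homs_def by blast

end

text \<open>Arguments about kernels that use no addition are kept apart: the locale is interpreted
  both in the given category and in its category of noetherian objects, so the latter need not be
  shown to be abelian.\<close>

locale category_with_zero = category +
  assumes zero_object_ex: "\<exists>Z. zero_object C Z"
begin

lemma zero_arr [simp]: "zero_arrow C f \<Longrightarrow> f \<in> Arr C"
  by (simp add: zero_arrow_def)

lemma zero_arrowE:
  assumes "zero_arrow C f"
  obtains Z a b where "zero_object C Z" "a \<in> Arr C" "src C a = src C f" "tgt C a = Z"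
    "b \<in> Arr C" "src C b = Z" "tgt C b = tgt C f" "b \<bullet> a = f"
  using assms unfolding zero_arrow_def homs_def by blast

lemma zero_arrowI:
  assumes "zero_object C Z" "a \<in> Arr C" "tgt C a = Z" "b \<in> Arr C" "src C b = Z"
  shows "zero_arrow C (b \<bullet> a)"
  using assms unfolding zero_arrow_def homs_def 
  by - (intro conjI, simp, rule exI[of _ Z], rule exI[of _ a], rule exI[of _ b], simp)

lemma zero_comp_left [simp]:
  assumes "zero_arrow C f" "g \<in> Arr C" "src C g = tgt C f"
  shows "zero_arrow C (g \<bullet> f)"
proof -
  obtain Z a b where *: "zero_object C Z" "a \<in> Arr C" "src C a = src C f" "tgt C a = Z"
    "b \<in> Arr C" "src C b = Z" "tgt C b = tgt C f" "b \<bullet> a = f" using zero_arrowE[OF assms(1)] by blast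
  then have "zero_arrow C ((g \<bullet> b) \<bullet> a)"
    by (intro zero_arrowI[of Z]) (use assms in auto)
  then show ?thesis using * assms by auto
qed

lemma zero_comp_right [simp]:
  assumes "zero_arrow C f" "g \<in> Arr C" "tgt C g = src C f"
  shows "zero_arrow C (f \<bullet> g)"
proof -
  obtain Z a b where *: "zero_object C Z" "a \<in> Arr C" "src C a = src C f" "tgt C a = Z"
    "b \<in> Arr C" "src C b = Z" "tgt C b = tgt C f" "b \<bullet> a = f" using zero_arrowE[OF assms(1)] by blast
  then have "zero_arrow C (b \<bullet> (a \<bullet> g))"
    by (intro zero_arrowI[of Z]) (use assms in auto)
  then show ?thesis using * assms by auto
qed

lemma zero_comp_assoc:
  assumes "zero_arrow C (g \<bullet> f)" "g \<in> Arr C" "f \<in> Arr C" "x \<in> Arr C"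
    "src C g = tgt C f" "src C f = tgt C x"
  shows "zero_arrow C (g \<bullet> (f \<bullet> x))"
  using zero_comp_right[OF assms(1), of x] assms by simp

lemma zero_object_Obj: "zero_object C Z \<Longrightarrow> Z \<in> Obj C"
  by (simp add: zero_object_def)

lemma zero_object_unique:
  assumes "zero_object C Z" "f \<in> Arr C" "g \<in> Arr C"
  shows "tgt C f = Z \<Longrightarrow> tgt C g = Z \<Longrightarrow> src C f = src C g \<Longrightarrow> f = g"
    and "src C f = Z \<Longrightarrow> src C g = Z \<Longrightarrow> tgt C f = tgt C g \<Longrightarrow> f = g"
proof -
  show "f = g" if "tgt C f = Z" "tgt C g = Z" "src C f = src C g"
  proof -
    have "\<exists>!h. h \<in> homs C (src C f) Z" using assms by (simp add: zero_object_def)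
    then show ?thesis using that assms unfolding homs_iff by metis
  qed
  show "f = g" if "src C f = Z" "src C g = Z" "tgt C f = tgt C g"
  proof -
    have "\<exists>!h. h \<in> homs C Z (tgt C f)" using assms by (simp add: zero_object_def)
    then show ?thesis using that assms unfolding homs_iff by metis
  qed
qed

lemma zero_object_arrow:
  assumes "zero_object C Z" "f \<in> Arr C" "src C f = Z \<or> tgt C f = Z"
  shows "zero_arrow C f"
proof -
  have Z: "Z \<in> Obj C" using assms(1) by (rule zero_object_Obj)
  show ?thesis
    using zero_arrowI[OF assms(1), of f "idn C Z"] zero_arrowI[OF assms(1), of "idn C Z" f]
      assms(2,3) Z by auto
qed

text \<open>The two arrows may factor through different zero objects; the arrow \<open>u\<close>
  between these makes both triangles commute by uniqueness.\<close>

lemma zero_unique: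
  assumes "zero_arrow C f" "zero_arrow C g" "src C f = src C g" "tgt C f = tgt C g"
  shows "f = g"
proof -
  obtain Z a b where f: "zero_object C Z" "a \<in> Arr C" "src C a = src C f" "tgt C a = Z"
    "b \<in> Arr C" "src C b = Z" "tgt C b = tgt C f" "b \<bullet> a = f" using zero_arrowE[OF assms(1)] by blast
  obtain Z' a' b' where g: "zero_object C Z'" "a' \<in> Arr C" "src C a' = src C g" "tgt C a' = Z'"
    "b' \<in> Arr C" "src C b' = Z'" "tgt C b' = tgt C g" "b' \<bullet> a' = g" using zero_arrowE[OF assms(2)] by blast
  obtain u where u: "u \<in> Arr C" "src C u = Z" "tgt C u = Z'"
    using f(1) g(1) unfolding zero_object_def homs_def by blast
  have 1: "u \<bullet> a = a'" by (rule zero_object_unique(1)[OF g(1)]) (use f g u assms in auto)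
  have 2: "b' \<bullet> u = b" by (rule zero_object_unique(2)[OF f(1)]) (use f g u assms in auto)
  have "b' \<bullet> (u \<bullet> a) = (b' \<bullet> u) \<bullet> a" using f g u by simp
  then show ?thesis using 1 2 f g by simp
qed

lemma zero_ex:
  assumes "A \<in> Obj C" "B \<in> Obj C"
  obtains f where "zero_arrow C f" "src C f = A" "tgt C f = B"
proof -
  obtain Z where Z: "zero_object C Z" using zero_object_ex by blast
  obtain a where a: "a \<in> Arr C" "src C a = A" "tgt C a = Z"
    using Z assms unfolding zero_object_def homs_def by blast
  obtain b where b: "b \<in> Arr C" "src C b = Z" "tgt C b = B"
    using Z assms unfolding zero_object_def homs_def by blast
  have "zero_arrow C (b \<bullet> a)" by (rule zero_arrowI[OF Z]) (use a b in auto)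
  then show ?thesis using that a b by simp
qed

text \<open>Without addition, \<open>f\<close> is compared with a zero arrow \<open>z\<close> of the
  same source and target: both composites with \<open>m\<close> are zero, hence equal, and
  \<open>m\<close> cancels.\<close>

lemma monic_zeroD:
  assumes "monic C m" "zero_arrow C (m \<bullet> f)" "f \<in> Arr C" "tgt C f = src C m"
  shows "zero_arrow C f"
proof -
  have m [simp]: "m \<in> Arr C" using assms(1) by (rule monic_arr)
  obtain z where z: "zero_arrow C z" "src C z = src C f" "tgt C z = src C m"
    by (rule zero_ex[of "src C f" "src C m"]) (use assms in auto)
  have "zero_arrow C (m \<bullet> z)" using z by simp
  then have "m \<bullet> f = m \<bullet> z" using assms z by - (rule zero_unique, auto simp: homs_iff)
  then have "f = z" using assms z by - (rule monicD[OF assms(1)], auto simp: homs_iff)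
  then show ?thesis using z by simp
qed

lemma epic_zeroD:
  assumes "epic C e" "zero_arrow C (f \<bullet> e)" "f \<in> Arr C" "src C f = tgt C e"
  shows "zero_arrow C f"
proof -
  have m [simp]: "e \<in> Arr C" using assms(1) by (rule epic_arr)
  obtain z where z: "zero_arrow C z" "src C z = tgt C e" "tgt C z = tgt C f"
    by (rule zero_ex[of "tgt C e" "tgt C f"]) (use assms in auto)
  have "zero_arrow C (z \<bullet> e)" using z by simp
  then have "f \<bullet> e = z \<bullet> e" using assms z by - (rule zero_unique, auto simp: homs_iff)
  then have "f = z" using assms z by - (rule epicD[OF assms(1)], auto simp: homs_iff)
  then show ?thesis using z by simp
qed

lemma zero_idn_arrow:
  assumes "zero_arrow C (idn C A)" "f \<in> Arr C" "src C f = A \<or> tgt C f = A"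
  shows "zero_arrow C f"
proof -
  have "A \<in> Obj C" using assms by auto
  then show ?thesis
    using zero_comp_left[OF assms(1), of f] zero_comp_right[OF assms(1), of f] assms(2,3)
    by auto
qed

lemma kernel_monic:
  assumes "is_kernel C f k" shows "monic C k"
  unfolding monic_def
proof (intro conjI ballI impI; (elim conjE)?)
  note k [simp] = kernelD[OF assms]
  fix x y assume *: "x \<in> Arr C" "y \<in> Arr C" "src C x = src C y" "tgt C x = src C k"
    "tgt C y = src C k" "k \<bullet> x = k \<bullet> y"
  have "zero_arrow C ((f \<bullet> k) \<bullet> y)" using * by - (rule zero_comp_right, auto)
  then have 1: "zero_arrow C (f \<bullet> (k \<bullet> y))" using * by simp
  have "\<forall>h \<in> Arr C. tgt C h = src C f \<and> zero_arrow C (f \<bullet> h) \<longrightarrow>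
      (\<exists>!u. u \<in> homs C (src C h) (src C k) \<and> k \<bullet> u = h)"
    using assms unfolding is_kernel_def by blast
  from this[rule_format, of "k \<bullet> y"]
  have "\<exists>!u. u \<in> homs C (src C y) (src C k) \<and> k \<bullet> u = k \<bullet> y" using 1 * by simp
  then show "x = y" by (rule ex1E) (use * in \<open>metis homs_iff\<close>)
qed (use kernelD[OF assms] in auto)

lemma cokernel_epic:
  assumes "is_cokernel C f k" shows "epic C k"
  unfolding epic_def
proof (intro conjI ballI impI; (elim conjE)?)
  note k [simp] = cokernelD[OF assms]
  fix x y assume *: "x \<in> Arr C" "y \<in> Arr C" "tgt C x = tgt C y" "src C x = tgt C k"
    "src C y = tgt C k" "x \<bullet> k = y \<bullet> k"
  have "zero_arrow C (y \<bullet> (k \<bullet> f))" using * by - (rule zero_comp_left, auto)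
  then have 1: "zero_arrow C ((y \<bullet> k) \<bullet> f)" using * by simp
  have "\<forall>h \<in> Arr C. src C h = tgt C f \<and> zero_arrow C (h \<bullet> f) \<longrightarrow>
      (\<exists>!u. u \<in> homs C (tgt C k) (tgt C h) \<and> u \<bullet> k = h)"
    using assms unfolding is_cokernel_def by blast
  from this[rule_format, of "y \<bullet> k"]
  have "\<exists>!u. u \<in> homs C (tgt C k) (tgt C y) \<and> u \<bullet> k = y \<bullet> k" using 1 * by simp
  then show "x = y" by (rule ex1E) (use * in \<open>metis homs_iff\<close>)
qed (use cokernelD[OF assms] in auto)

text \<open>For a monic \<open>k\<close> factorizations are automatically unique, so only their
  existence has to be supplied.\<close>

lemma kernelI:
  assumes "f \<in> Arr C" "monic C k" "tgt C k = src C f" "zero_arrow C (f \<bullet> k)"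
    and "\<And>h. h \<in> Arr C \<Longrightarrow> tgt C h = src C f \<Longrightarrow> zero_arrow C (f \<bullet> h) \<Longrightarrow>
      \<exists>u \<in> Arr C. src C u = src C h \<and> tgt C u = src C k \<and> k \<bullet> u = h"
  shows "is_kernel C f k"
  unfolding is_kernel_def
proof (intro conjI ballI impI; (elim conjE)?)
  fix h assume h: "h \<in> Arr C" "tgt C h = src C f" "zero_arrow C (f \<bullet> h)"
  from assms(5)[OF this] obtain u where
    u: "u \<in> Arr C" "src C u = src C h" "tgt C u = src C k" "k \<bullet> u = h" by blast
  show "\<exists>!u. u \<in> homs C (src C h) (src C k) \<and> k \<bullet> u = h"
  proof (rule ex1I[of _ u])
    fix v assume "v \<in> homs C (src C h) (src C k) \<and> k \<bullet> v = h"
    then show "v = u" using u by - (rule monicD[OF assms(2)], auto simp: homs_iff)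
  qed (use u in \<open>auto simp: homs_iff\<close>)
qed (use assms in auto)

lemma cokernelI:
  assumes "f \<in> Arr C" "epic C q" "src C q = tgt C f" "zero_arrow C (q \<bullet> f)"
    and "\<And>h. h \<in> Arr C \<Longrightarrow> src C h = tgt C f \<Longrightarrow> zero_arrow C (h \<bullet> f) \<Longrightarrow>
      \<exists>u \<in> Arr C. src C u = tgt C q \<and> tgt C u = tgt C h \<and> u \<bullet> q = h"
  shows "is_cokernel C f q"
  unfolding is_cokernel_def
proof (intro conjI ballI impI; (elim conjE)?)
  fix h assume h: "h \<in> Arr C" "src C h = tgt C f" "zero_arrow C (h \<bullet> f)"
  from assms(5)[OF this] obtain u where
    u: "u \<in> Arr C" "src C u = tgt C q" "tgt C u = tgt C h" "u \<bullet> q = h" by blast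
  show "\<exists>!u. u \<in> homs C (tgt C q) (tgt C h) \<and> u \<bullet> q = h"
  proof (rule ex1I[of _ u])
    fix v assume "v \<in> homs C (tgt C q) (tgt C h) \<and> v \<bullet> q = h"
    then show "v = u" using u by - (rule epicD[OF assms(2)], auto simp: homs_iff)
  qed (use u in \<open>auto simp: homs_iff\<close>)
qed (use assms in auto)

text \<open>Of the additive structure only differences are used later, mostly to test whether they
  vanish. Bilinearity makes composition preserve neutral elements and inverses, hence differences.
  Vanishing is phrased by \<open>zero_arrow\<close>, which depends on no chosen addition.\<close>

lemma difference_ex:
  assumes "preadditive C"
  shows "\<exists>dif. \<forall>f \<in> Arr C. \<forall>g \<in> Arr C. src C f = src C g \<and> tgt C f = tgt C g \<longrightarrow>
    dif f g \<in> homs C (src C f) (tgt C f) \<and>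
    (zero_arrow C (dif f g) \<longleftrightarrow> f = g) \<and> (zero_arrow C g \<longrightarrow> dif f g = f) \<and>
    (\<forall>x \<in> Arr C. tgt C x = src C f \<longrightarrow> dif f g \<bullet> x = dif (f \<bullet> x) (g \<bullet> x)) \<and>
    (\<forall>y \<in> Arr C. src C y = tgt C f \<longrightarrow> y \<bullet> dif f g = dif (y \<bullet> f) (y \<bullet> g))"
proof -
  obtain add :: "'b \<Rightarrow> 'b \<Rightarrow> 'b" and zero where
    grp: "\<And>A B. A \<in> Obj C \<Longrightarrow> B \<in> Obj C \<Longrightarrow>
      comm_group \<lparr>carrier = homs C A B, mult = add, one = zero A B\<rparr>"
    and dist: "\<And>A B D f f' g g'. f \<in> homs C A B \<Longrightarrow> f' \<in> homs C A B \<Longrightarrow> g \<in> homs C B D \<Longrightarrow>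
      g' \<in> homs C B D \<Longrightarrow> g \<bullet> add f f' = add (g \<bullet> f) (g \<bullet> f') \<and> add g g' \<bullet> f = add (g \<bullet> f) (g' \<bullet> f)"
    using assms unfolding preadditive_def by metis
  define G where "G A B = \<lparr>carrier = homs C A B, mult = add, one = zero A B\<rparr>" for A B
  define neg where "neg f = inv\<^bsub>G (src C f) (tgt C f)\<^esub> f" for f
  define dif where "dif f g = add f (neg g)" for f g
  have G: "comm_group (G A B)" if "A \<in> Obj C" "B \<in> Obj C" for A B
    using grp that unfolding G_def by blast
  have G_simps [simp]: "carrier (G A B) = homs C A B" "mult (G A B) = add" "one (G A B) = zero A B" for A B
    by (simp_all add: G_def)
  have add_closed: "add f g \<in> homs C A B" if "f \<in> homs C A B" "g \<in> homs C A B" for f g A B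
  proof -
    interpret comm_group "G A B" using G homs_Obj[OF that(1)] by blast
    show ?thesis using m_closed that by simp
  qed
  have zero_closed: "zero A B \<in> homs C A B" if "A \<in> Obj C" "B \<in> Obj C" for A B
  proof -
    interpret comm_group "G A B" using G that by blast
    show ?thesis using one_closed by simp
  qed
  \<comment> \<open>Neutral elements are recognised as the idempotents of a group; by bilinearity a
    composite with a neutral element is idempotent.\<close>
  have idem: "f = zero A B" if "f \<in> homs C A B" "add f f = f" for f A B
  proof -
    interpret comm_group "G A B" using G homs_Obj[OF that(1)] by blast
    show ?thesis using that l_cancel_one[of f f] by simp
  qed
  have zero_left: "g \<bullet> zero A B = zero A D" if "g \<in> homs C B D" "A \<in> Obj C" for g A B D
  proof (rule idem)
    have B: "B \<in> Obj C" using homs_Obj[OF that(1)] by simp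
    note z = zero_closed[OF that(2) B]
    interpret comm_group "G A B" using G that B by blast
    have "add (zero A B) (zero A B) = zero A B" using l_one[of "zero A B"] z by simp
    then show "add (g \<bullet> zero A B) (g \<bullet> zero A B) = g \<bullet> zero A B" using dist[OF z z that(1) that(1)] by simp
    show "g \<bullet> zero A B \<in> homs C A D" using comp_in_homs[OF z that(1)] .
  qed
  have zero_right: "zero B D \<bullet> g = zero A D" if "g \<in> homs C A B" "D \<in> Obj C" for g A B D
  proof (rule idem)
    have B: "B \<in> Obj C" using homs_Obj[OF that(1)] by simp
    note z = zero_closed[OF B that(2)]
    interpret comm_group "G B D" using G that B by blast
    have "add (zero B D) (zero B D) = zero B D" using l_one[of "zero B D"] z by simp
    then show "add (zero B D \<bullet> g) (zero B D \<bullet> g) = zero B D \<bullet> g" using dist[OF that(1) that(1) z z] by simp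
    show "zero B D \<bullet> g \<in> homs C A D" using comp_in_homs[OF that(1) z] .
  qed
  \<comment> \<open>The neutral element factors through the zero object \<open>Z\<close>, because
    composites of neutral elements are neutral. So the two notions of zero coincide.\<close>
  have zero_iff: "zero_arrow C f \<longleftrightarrow> f = zero A B" if f: "f \<in> homs C A B" for f A B
  proof -
    obtain Z where Z: "zero_object C Z" using zero_object_ex by blast
    have AB: "A \<in> Obj C" "B \<in> Obj C" using homs_Obj[OF f] by simp_all
    have ZO: "Z \<in> Obj C" using Z by (rule zero_object_Obj)
    have z: "zero Z B \<bullet> zero A Z = zero A B" "zero A Z \<in> homs C A Z" "zero Z B \<in> homs C Z B"
      using zero_left zero_closed AB ZO by blast+
    have "zero_arrow C (zero Z B \<bullet> zero A Z)"
      by (rule zero_arrowI[OF Z]) (use z(2,3) in \<open>simp_all add: homs_iff\<close>)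
    then have 1: "zero_arrow C (zero A B)" using z by simp
    show ?thesis
    proof
      assume "zero_arrow C f"
      then show "f = zero A B"
        by (rule zero_unique[OF _ 1]) (use f zero_closed[OF AB] in \<open>simp_all add: homs_iff\<close>)
    qed (use 1 in simp)
  qed
  have neg: "neg f \<in> homs C A B \<and> add f (neg f) = zero A B" if "f \<in> homs C A B" for f A B
  proof -
    interpret comm_group "G A B" using G homs_Obj[OF that(1)] by blast
    show ?thesis using that r_inv[of f] inv_closed[of f] by (simp add: neg_def homs_iff)
  qed
  have neg_unique: "g = neg f" if "f \<in> homs C A B" "g \<in> homs C A B" "add f g = zero A B" for f g A B
  proof -
    interpret comm_group "G A B" using G homs_Obj[OF that(1)] by blast
    show ?thesis using that inv_equality[of g f] m_comm[of f g] by (simp add: neg_def homs_iff)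
  qed
  show ?thesis
  proof (rule exI[of _ dif], intro ballI impI; elim conjE)
    fix f g assume "f \<in> Arr C" "g \<in> Arr C" "src C f = src C g" "tgt C f = tgt C g"
    then have fg: "f \<in> homs C (src C f) (tgt C f)" "g \<in> homs C (src C f) (tgt C f)" by (simp_all add: homs_iff)
    define A B where "A = src C f" "B = tgt C f"
    then have f: "f \<in> homs C A B" and g: "g \<in> homs C A B" using fg by simp_all
    note ng = neg[OF g, THEN conjunct1]
    interpret comm_group "G A B" using G homs_Obj[OF f] by blast
    have 1: "dif f g \<in> homs C A B" unfolding dif_def by (rule add_closed[OF f ng])
    have 2: "zero_arrow C (dif f g) \<longleftrightarrow> f = g"
    proof
      assume "f = g"
      then show "zero_arrow C (dif f g)" using neg[OF g] zero_iff 1 by (simp add: dif_def)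
    next
      assume "zero_arrow C (dif f g)"
      then have "add f (neg g) = zero A B" using 1 zero_iff unfolding dif_def by blast
      then have "add f (neg g) = add g (neg g)" using neg[OF g] by simp
      then show "f = g" using right_cancel[of "neg g" f g] f g ng by simp
    qed
    have 3: "zero_arrow C g \<longrightarrow> dif f g = f"
    proof
      assume "zero_arrow C g"
      then have g0: "g = zero A B" using zero_iff[OF g] by simp
      then have "add g g = zero A B" using l_one[of g] g by simp
      then have "neg g = g" using neg_unique[OF g g] by simp
      then show "dif f g = f" using r_one[of f] f g0 by (simp add: dif_def)
    qed
    have 4: "dif f g \<bullet> x = dif (f \<bullet> x) (g \<bullet> x)" if "x \<in> Arr C" "tgt C x = A" for x
    proof -
      have x: "x \<in> homs C (src C x) A" using that by (simp add: homs_iff)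
      have gx: "g \<bullet> x \<in> homs C (src C x) B" "neg g \<bullet> x \<in> homs C (src C x) B"
        using comp_in_homs[OF x] g ng by auto
      have "add (g \<bullet> x) (neg g \<bullet> x) = zero (src C x) B"
        using dist[OF x x g ng] neg[OF g] zero_right[OF x, of B] homs_Obj[OF g] by simp
      then have "neg g \<bullet> x = neg (g \<bullet> x)" using neg_unique gx by blast
      then show ?thesis using dist[OF x x f ng] by (simp add: dif_def)
    qed
    have 5: "y \<bullet> dif f g = dif (y \<bullet> f) (y \<bullet> g)" if "y \<in> Arr C" "src C y = B" for y
    proof -
      have y: "y \<in> homs C B (tgt C y)" using that by (simp add: homs_iff)
      have gy: "y \<bullet> g \<in> homs C A (tgt C y)" "y \<bullet> neg g \<in> homs C A (tgt C y)"
        using comp_in_homs[OF _ y] g ng by auto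
      have "add (y \<bullet> g) (y \<bullet> neg g) = zero A (tgt C y)"
        using dist[OF g ng y y] neg[OF g] zero_left[OF y, of A] homs_Obj[OF g] by simp
      then have "y \<bullet> neg g = neg (y \<bullet> g)" using neg_unique gy by blast
      then show ?thesis using dist[OF f ng y y] by (simp add: dif_def)
    qed
    show "dif f g \<in> homs C (src C f) (tgt C f) \<and>
    (zero_arrow C (dif f g) \<longleftrightarrow> f = g) \<and> (zero_arrow C g \<longrightarrow> dif f g = f) \<and>
    (\<forall>x \<in> Arr C. tgt C x = src C f \<longrightarrow> dif f g \<bullet> x = dif (f \<bullet> x) (g \<bullet> x)) \<and>
    (\<forall>y \<in> Arr C. src C y = tgt C f \<longrightarrow> y \<bullet> dif f g = dif (y \<bullet> f) (y \<bullet> g))"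
      using 1 2 3 4 5 unfolding A_B_def by simp
  qed
qed

end


section \<open>Abelian categories\<close>

sublocale abelian_category \<subseteq> category_with_zero C
  by unfold_locales (rule has_zero_object)

context abelian_category
begin

text \<open>\<open>preadditive\<close> only asserts that an addition exists, so one difference
  operation is fixed by choice; nothing later depends on which.\<close>

definition dif :: "'b \<Rightarrow> 'b \<Rightarrow> 'b" where
  "dif = (SOME dif. \<forall>f \<in> Arr C. \<forall>g \<in> Arr C. src C f = src C g \<and> tgt C f = tgt C g \<longrightarrow>
    dif f g \<in> homs C (src C f) (tgt C f) \<and>
    (zero_arrow C (dif f g) \<longleftrightarrow> f = g) \<and> (zero_arrow C g \<longrightarrow> dif f g = f) \<and>
    (\<forall>x \<in> Arr C. tgt C x = src C f \<longrightarrow> dif f g \<bullet> x = dif (f \<bullet> x) (g \<bullet> x)) \<and>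
    (\<forall>y \<in> Arr C. src C y = tgt C f \<longrightarrow> y \<bullet> dif f g = dif (y \<bullet> f) (y \<bullet> g)))"

lemma dif_props:
  assumes "f \<in> Arr C" "g \<in> Arr C" "src C f = src C g" "tgt C f = tgt C g"
  shows "dif f g \<in> Arr C" "src C (dif f g) = src C f" "tgt C (dif f g) = tgt C f"
    "zero_arrow C (dif f g) \<longleftrightarrow> f = g" "zero_arrow C g \<Longrightarrow> dif f g = f"
    "x \<in> Arr C \<Longrightarrow> tgt C x = src C f \<Longrightarrow> dif f g \<bullet> x = dif (f \<bullet> x) (g \<bullet> x)"
    "y \<in> Arr C \<Longrightarrow> src C y = tgt C f \<Longrightarrow> y \<bullet> dif f g = dif (y \<bullet> f) (y \<bullet> g)"
  using someI_ex[OF difference_ex[OF preadditive], folded dif_def, rule_format, OF assms(1,2)] assms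
  by (simp_all add: homs_iff)

text \<open>If \<open>m \<bullet> f\<close> and \<open>m \<bullet> g\<close> agree, \<open>m\<close>
  annihilates \<open>dif f g\<close>, so cancellation reduces to a trivial kernel.\<close>

lemma monicI:
  assumes "m \<in> Arr C"
    and "\<And>x. x \<in> Arr C \<Longrightarrow> tgt C x = src C m \<Longrightarrow> zero_arrow C (m \<bullet> x) \<Longrightarrow> zero_arrow C x"
  shows "monic C m"
  unfolding monic_def
proof (intro conjI ballI impI; (elim conjE)?)
  fix f g assume *: "f \<in> Arr C" "g \<in> Arr C" "src C f = src C g" "tgt C f = src C m"
    "tgt C g = src C m" "m \<bullet> f = m \<bullet> g"
  have "m \<bullet> dif f g = dif (m \<bullet> f) (m \<bullet> g)"
    using * assms(1) by (simp add: dif_props)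
  moreover have "zero_arrow C (dif (m \<bullet> f) (m \<bullet> g))"
    using * assms(1) by (simp add: dif_props)
  ultimately have "zero_arrow C (dif f g)"
    using * assms(1) assms(2)[of "dif f g"] by (simp add: dif_props(1-3))
  then show "f = g" using * by (simp add: dif_props)
qed (fact assms)

lemma epicI:
  assumes "m \<in> Arr C"
    and "\<And>x. x \<in> Arr C \<Longrightarrow> src C x = tgt C m \<Longrightarrow> zero_arrow C (x \<bullet> m) \<Longrightarrow> zero_arrow C x"
  shows "epic C m"
  unfolding epic_def
proof (intro conjI ballI impI; (elim conjE)?)
  fix f g assume *: "f \<in> Arr C" "g \<in> Arr C" "tgt C f = tgt C g" "src C f = tgt C m"
    "src C g = tgt C m" "f \<bullet> m = g \<bullet> m"
  have "dif f g \<bullet> m = dif (f \<bullet> m) (g \<bullet> m)"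
    using * assms(1) by (simp add: dif_props)
  moreover have "zero_arrow C (dif (f \<bullet> m) (g \<bullet> m))"
    using * assms(1) by (simp add: dif_props)
  ultimately have "zero_arrow C (dif f g)"
    using * assms(1) assms(2)[of "dif f g"] by (simp add: dif_props(1-3))
  then show "f = g" using * by (simp add: dif_props)
qed (fact assms)

section \<open>Monics as kernels, epics as cokernels, image factorization and pullbacks\<close>

lemma monic_kernel_of_cokernel:
  assumes m: "monic C m" and q: "is_cokernel C m q"
  shows "is_kernel C q m"
proof -
  note [simp] = cokernelD[OF q]
  obtain f where f: "is_kernel C f m" using monic_is_kernel[OF m] by blast
  note [simp] = kernelD[OF f]
  \<comment> \<open>\<open>m\<close> is the kernel of some \<open>f\<close>, and \<open>f\<close>
    factors through the cokernel \<open>q\<close>; hence whatever \<open>q\<close> kills is killed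
    by \<open>f\<close> and factors through \<open>m\<close>.\<close>
  obtain v where v: "v \<in> Arr C" "src C v = tgt C q" "tgt C v = tgt C f" "v \<bullet> q = f"
    by (rule cokernel_factor[OF q, of f]) simp_all
  show ?thesis
  proof (rule kernelI)
    fix h assume h: "h \<in> Arr C" "tgt C h = src C q" "zero_arrow C (q \<bullet> h)"
    then have "zero_arrow C (v \<bullet> (q \<bullet> h))" using v by simp
    then have "zero_arrow C ((v \<bullet> q) \<bullet> h)" using v h by (subst comp_assoc') simp_all
    then have "zero_arrow C (f \<bullet> h)" using v by simp
    then show "\<exists>u \<in> Arr C. src C u = src C h \<and> tgt C u = src C m \<and> m \<bullet> u = h"
      using kernel_factor[OF f, of h] h by auto
  qed (use m in simp_all)
qed

lemma epic_cokernel_of_kernel: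
  assumes m: "epic C m" and q: "is_kernel C m q"
  shows "is_cokernel C q m"
proof -
  note [simp] = kernelD[OF q]
  obtain f where f: "is_cokernel C f m" using epic_is_cokernel[OF m] by blast
  note [simp] = cokernelD[OF f]
  obtain v where v: "v \<in> Arr C" "src C v = src C f" "tgt C v = src C q" "q \<bullet> v = f"
    by (rule kernel_factor[OF q, of f]) simp_all
  show ?thesis
  proof (rule cokernelI)
    fix h assume h: "h \<in> Arr C" "src C h = tgt C q" "zero_arrow C (h \<bullet> q)"
    then have "zero_arrow C ((h \<bullet> q) \<bullet> v)" using v by - (rule zero_comp_right, simp_all)
    then have "zero_arrow C (h \<bullet> f)" using v h by simp
    then show "\<exists>u \<in> Arr C. src C u = tgt C m \<and> tgt C u = tgt C h \<and> u \<bullet> m = h"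
      using cokernel_factor[OF f, of h] h by auto
  qed (use m in simp_all)
qed

text \<open>An arrow kills \<open>m \<bullet> e\<close> exactly when it kills \<open>m\<close>. Thus
  an arrow and the monic part of its factorization share their cokernel.\<close>

lemma cokernel_comp_epic:
  assumes q: "is_cokernel C (m \<bullet> e) q" and e: "epic C e" and m: "m \<in> Arr C" "src C m = tgt C e"
  shows "is_cokernel C m q"
proof (rule cokernelI)
  note [simp] = m epic_arr[OF e]
  note Q = cokernelD[OF q, simplified]
  show "zero_arrow C (q \<bullet> m)"
    by (rule epic_zeroD[OF e]) (use Q in simp_all)
  fix h assume h: "h \<in> Arr C" "src C h = tgt C m" "zero_arrow C (h \<bullet> m)"
  have "zero_arrow C ((h \<bullet> m) \<bullet> e)" using h by - (rule zero_comp_right, simp_all)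
  then have "zero_arrow C (h \<bullet> (m \<bullet> e))" using h by simp
  then show "\<exists>u \<in> Arr C. src C u = tgt C q \<and> tgt C u = tgt C h \<and> u \<bullet> q = h"
    using cokernel_factor[OF q, of h] h by auto
qed (use cokernelD[OF q] cokernel_epic[OF q] m e in simp_all)

lemma kernel_comp_monic:
  assumes m: "monic C m" and e: "e \<in> Arr C" "src C m = tgt C e"
  shows "is_kernel C (m \<bullet> e) k \<longleftrightarrow> is_kernel C e k"
proof
  note [simp] = e monic_arr[OF m]
  assume q: "is_kernel C (m \<bullet> e) k"
  note Q = kernelD[OF q, simplified]
  show "is_kernel C e k"
  proof (rule kernelI)
    show "zero_arrow C (e \<bullet> k)"
      by (rule monic_zeroD[OF m]) (use Q in simp_all)
    fix h assume h: "h \<in> Arr C" "tgt C h = src C e" "zero_arrow C (e \<bullet> h)"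
    then have "zero_arrow C ((m \<bullet> e) \<bullet> h)" by simp
    then show "\<exists>u \<in> Arr C. src C u = src C h \<and> tgt C u = src C k \<and> k \<bullet> u = h"
      using kernel_factor[OF q, of h] h by auto
  qed (use Q kernel_monic[OF q] in simp_all)
next
  note [simp] = e monic_arr[OF m]
  assume q: "is_kernel C e k"
  note Q = kernelD[OF q, simplified]
  show "is_kernel C (m \<bullet> e) k"
  proof (rule kernelI)
    show "zero_arrow C ((m \<bullet> e) \<bullet> k)" using Q by simp
    fix h assume h: "h \<in> Arr C" "tgt C h = src C (m \<bullet> e)" "zero_arrow C ((m \<bullet> e) \<bullet> h)"
    then have "zero_arrow C (e \<bullet> h)" using monic_zeroD[OF m, of "e \<bullet> h"] by simp
    then show "\<exists>u \<in> Arr C. src C u = src C h \<and> tgt C u = src C k \<and> k \<bullet> u = h"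
      using kernel_factor[OF q, of h] h by auto
  qed (use Q kernel_monic[OF q] in simp_all)
qed

text \<open>\<open>m\<close> is the kernel of the cokernel of \<open>f\<close>, and the point is
  that \<open>e\<close> is epic. If \<open>z \<bullet> e\<close> vanishes and \<open>k\<close> is
  the kernel of \<open>z\<close>, then \<open>f\<close> factors through
  \<open>m \<bullet> k\<close>, which is again a kernel, say of \<open>w\<close>. So
  \<open>w\<close> kills \<open>f\<close>, hence \<open>m\<close>; then \<open>m\<close> factors
  through \<open>m \<bullet> k\<close>, the arrow \<open>k\<close> has a right inverse, and
  \<open>z\<close> vanishes.\<close>

lemma factorization:
  assumes f: "f \<in> Arr C"
  obtains e m where "epic C e" "monic C m" "src C e = src C f" "tgt C m = tgt C f"
    "src C m = tgt C e" "m \<bullet> e = f"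
proof -
  note [simp] = f
  obtain q where q: "is_cokernel C f q" using has_cokernels f by blast
  note [simp] = cokernelD[OF q]
  obtain m where m: "is_kernel C q m" using has_kernels[of q] by auto
  note M [simp] = kernelD[OF m]
  note mm = kernel_monic[OF m]
  obtain e where e [simp]: "e \<in> Arr C" "src C e = src C f" "tgt C e = src C m" and me: "m \<bullet> e = f"
    by (rule kernel_factor[OF m, of f]) simp_all
  have "epic C e"
  proof (rule epicI)
    fix z assume z [simp]: "z \<in> Arr C" "src C z = tgt C e" and ze: "zero_arrow C (z \<bullet> e)"
    obtain k where k: "is_kernel C z k" using has_kernels[of z] by auto
    note [simp] = kernelD[OF k]
    note mk = kernel_monic[OF k]
    obtain e' where e': "e' \<in> Arr C" "src C e' = src C e" "tgt C e' = src C k" "k \<bullet> e' = e"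
      by (rule kernel_factor[OF k, of e]) (use ze in simp_all)
    have "monic C (m \<bullet> k)" by (rule monic_comp[OF mm mk]) simp
    then obtain w where w: "is_kernel C w (m \<bullet> k)" using monic_is_kernel by blast
    note W = kernelD[OF w, simplified]
    have "zero_arrow C ((w \<bullet> (m \<bullet> k)) \<bullet> e')" using W e' by - (rule zero_comp_right, simp_all)
    then have "zero_arrow C (w \<bullet> f)" using W e' me by simp
    then obtain w' where w': "w' \<in> Arr C" "src C w' = tgt C q" "w' \<bullet> q = w"
      using cokernel_factor[OF q, of w] W by auto
    have "zero_arrow C (w \<bullet> m)" using w' comp_assoc'[of m q w'] by simp
    then obtain u where u: "u \<in> Arr C" "src C u = src C m" "tgt C u = src C (m \<bullet> k)" "(m \<bullet> k) \<bullet> u = m"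
      using kernel_factor[OF w, of m] W by auto
    have "k \<bullet> u = idn C (src C m)"
      by (rule monicD[OF mm]) (use u in simp_all)
    moreover have "zero_arrow C ((z \<bullet> k) \<bullet> u)" using u by - (rule zero_comp_right, simp_all)
    ultimately show "zero_arrow C z" using u by simp
  qed simp
  then show ?thesis using that[of e m] mm me by simp
qed

text \<open>An epic kernel of \<open>f\<close> forces \<open>f\<close> to be zero, so the identity
  factors through \<open>m\<close>.\<close>

lemma monic_epic_iso:
  assumes m: "monic C m" and e: "epic C m" shows "is_iso C m"
proof -
  obtain f where f: "is_kernel C f m" using monic_is_kernel[OF m] by blast
  note [simp] = kernelD[OF f]
  have "zero_arrow C f" by (rule epic_zeroD[OF e]) simp_all
  then obtain u where u: "u \<in> Arr C" "src C u = tgt C m" "tgt C u = src C m" "m \<bullet> u = idn C (tgt C m)"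
    using kernel_factor[OF f, of "idn C (src C f)"] by auto
  have "m \<bullet> (u \<bullet> m) = (m \<bullet> u) \<bullet> m" using u by (subst comp_assoc') simp_all
  then have "m \<bullet> (u \<bullet> m) = m" using u by simp
  then have "u \<bullet> m = idn C (src C m)"
    by - (rule monicD[OF m], use u in simp_all)
  then show ?thesis by - (rule isoI[of m u], use u in simp_all)
qed

text \<open>The pullback is the kernel \<open>k\<close> of the difference \<open>d\<close> of
  \<open>q \<bullet> x\<close> and \<open>p \<bullet> y\<close> on the product. Along the first
  injection \<open>d\<close> restricts to \<open>q\<close>, so \<open>d\<close> is epic and is the
  cokernel of \<open>k\<close>; this transfers epicness from \<open>q\<close> to the projection
  \<open>b\<close>.\<close>

lemma pullback_epic:
  assumes q: "epic C q" and n: "is_kernel C q n" and p: "p \<in> Arr C" "tgt C p = tgt C q"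
  obtains a b n' where "a \<in> Arr C" "src C a = tgt C n'" "tgt C a = src C q"
    "b \<in> Arr C" "tgt C b = src C p" "q \<bullet> a = p \<bullet> b"
    "short_exact C n' b" "src C n' = src C n" "a \<bullet> n' = n" "epic C b"
proof -
  note [simp] = epic_arr[OF q] p
  note N [simp] = kernelD[OF n]
  let ?N = "src C q" and ?D = "src C p"
  obtain P x y where prod: "is_product C ?N ?D P x y" using has_products[of ?N ?D] by auto
  then have [simp]: "x \<in> Arr C" "src C x = P" "tgt C x = ?N" "y \<in> Arr C" "src C y = P" "tgt C y = ?D"
    unfolding is_product_def homs_iff by simp_all
  have pair: "\<exists>!h. h \<in> homs C (src C f) P \<and> x \<bullet> h = f \<and> y \<bullet> h = g"
    if "f \<in> Arr C" "tgt C f = ?N" "g \<in> Arr C" "tgt C g = ?D" "src C f = src C g" for f g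
    using prod that unfolding is_product_def by (simp add: homs_iff)
  obtain z0 where z0 [simp]: "zero_arrow C z0" "src C z0 = ?N" "tgt C z0 = ?D"
    using zero_ex[of ?N ?D] by auto
  obtain z1 where z1 [simp]: "zero_arrow C z1" "src C z1 = ?D" "tgt C z1 = ?N"
    using zero_ex[of ?D ?N] by auto
  obtain i where i [simp]: "i \<in> Arr C" "src C i = ?N" "tgt C i = P" "x \<bullet> i = idn C ?N" "y \<bullet> i = z0"
    using pair[of "idn C ?N" z0] by (auto simp: homs_iff)
  obtain j where j [simp]: "j \<in> Arr C" "src C j = ?D" "tgt C j = P" "x \<bullet> j = z1" "y \<bullet> j = idn C ?D"
    using pair[of z1 "idn C ?D"] by (auto simp: homs_iff)
  define d where "d = dif (q \<bullet> x) (p \<bullet> y)"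
  have d [simp]: "d \<in> Arr C" "src C d = P" "tgt C d = tgt C q" unfolding d_def by (simp_all add: dif_props)
  have dh: "zero_arrow C (d \<bullet> h) \<longleftrightarrow> q \<bullet> (x \<bullet> h) = p \<bullet> (y \<bullet> h)" if "h \<in> Arr C" "tgt C h = P" for h
    unfolding d_def using that by (simp add: dif_props)
  have di: "d \<bullet> i = q"
  proof -
    have "dif ((q \<bullet> x) \<bullet> i) ((p \<bullet> y) \<bullet> i) = (q \<bullet> x) \<bullet> i"
      by (rule dif_props(5)) simp_all
    then show ?thesis
      unfolding d_def using dif_props(6)[of "q \<bullet> x" "p \<bullet> y" i] by simp
  qed
  have ed: "epic C d" using epic_cancel[of d i] q di by simp
  obtain k where k: "is_kernel C d k" using has_kernels[of d] by auto
  note [simp] = kernelD[OF k]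
  have cok: "is_cokernel C k d" by (rule epic_cokernel_of_kernel[OF ed k])
  have qp: "q \<bullet> (x \<bullet> k) = p \<bullet> (y \<bullet> k)" using dh[of k] by simp
  \<comment> \<open>If \<open>w\<close> kills the projection, \<open>w \<bullet> y\<close> factors
    as \<open>v \<bullet> d\<close>. Along the injection \<open>i\<close> this shows that
    \<open>v \<bullet> q\<close>, hence \<open>v\<close>, vanishes; along \<open>j\<close> it then
    shows that \<open>w\<close> does.\<close>
  have eb: "epic C (y \<bullet> k)"
  proof (rule epicI)
    fix w assume w [simp]: "w \<in> Arr C" "src C w = tgt C (y \<bullet> k)" and "zero_arrow C (w \<bullet> (y \<bullet> k))"
    then have "zero_arrow C ((w \<bullet> y) \<bullet> k)" by simp
    then obtain v where v: "v \<in> Arr C" "src C v = tgt C d" "tgt C v = tgt C w" "v \<bullet> d = w \<bullet> y"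
      using cokernel_factor[OF cok, of "w \<bullet> y"] by auto
    have "v \<bullet> q = v \<bullet> (d \<bullet> i)" using di by simp
    also have "\<dots> = (v \<bullet> d) \<bullet> i" using v by (subst comp_assoc') simp_all
    also have "\<dots> = w \<bullet> (y \<bullet> i)" unfolding v(4) by simp
    finally have "zero_arrow C (v \<bullet> q)" by simp
    then have "zero_arrow C v" using epic_zeroD[OF q, of v] v by simp
    then have "zero_arrow C (v \<bullet> (d \<bullet> j))" using v(1-3) by simp
    moreover have "w = v \<bullet> (d \<bullet> j)" using v comp_assoc'[of j d v] by simp
    ultimately show "zero_arrow C w" by simp
  qed simp
  obtain z2 where z2 [simp]: "zero_arrow C z2" "src C z2 = src C n" "tgt C z2 = ?D"
    using zero_ex[of "src C n" ?D] by auto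
  \<comment> \<open>The arrow \<open>(n, 0)\<close> lands in the pullback and lifts there to the
    kernel \<open>n'\<close> of the projection.\<close>
  obtain l where l [simp]: "l \<in> Arr C" "src C l = src C n" "tgt C l = P" "x \<bullet> l = n" "y \<bullet> l = z2"
    using pair[of n z2] by (auto simp: homs_iff)
  have "q \<bullet> (x \<bullet> l) = p \<bullet> (y \<bullet> l)" by (rule zero_unique) simp_all
  then have "zero_arrow C (d \<bullet> l)" using dh[of l] by simp
  then obtain n' where n' [simp]: "n' \<in> Arr C" "src C n' = src C n" "tgt C n' = src C k" and kn: "k \<bullet> n' = l"
    using kernel_factor[OF k, of l] by auto
  have xkn: "x \<bullet> (k \<bullet> n') = n" "y \<bullet> (k \<bullet> n') = z2" using kn by simp_all
  have mn': "monic C n'"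
    by (rule monic_cancel[of "x \<bullet> k" n']) (use xkn kernel_monic[OF n] in simp_all)
  have "is_kernel C (y \<bullet> k) n'"
  proof (rule kernelI)
    fix h assume h: "h \<in> Arr C" "tgt C h = src C (y \<bullet> k)" "zero_arrow C ((y \<bullet> k) \<bullet> h)"
    then have h1: "zero_arrow C (y \<bullet> (k \<bullet> h))" by simp
    have "zero_arrow C ((d \<bullet> k) \<bullet> h)" using h by - (rule zero_comp_right, simp_all)
    then have "q \<bullet> (x \<bullet> (k \<bullet> h)) = p \<bullet> (y \<bullet> (k \<bullet> h))" using dh[of "k \<bullet> h"] h by simp
    then have "zero_arrow C (q \<bullet> (x \<bullet> (k \<bullet> h)))" using h1 h by simp
    then obtain u where u: "u \<in> Arr C" "src C u = src C h" "tgt C u = src C n" "n \<bullet> u = x \<bullet> (k \<bullet> h)"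
      using kernel_factor[OF n, of "x \<bullet> (k \<bullet> h)"] h by auto
    have "\<exists>!w. w \<in> homs C (src C h) P \<and> x \<bullet> w = x \<bullet> (k \<bullet> h) \<and> y \<bullet> w = y \<bullet> (k \<bullet> h)"
      using pair[of "x \<bullet> (k \<bullet> h)" "y \<bullet> (k \<bullet> h)"] h by simp
    moreover have "x \<bullet> (l \<bullet> u) = (x \<bullet> l) \<bullet> u" using u by (subst comp_assoc') simp_all
    then have "x \<bullet> (l \<bullet> u) = x \<bullet> (k \<bullet> h)" using u(4) by simp
    moreover have "y \<bullet> (l \<bullet> u) = (y \<bullet> l) \<bullet> u" using u by (subst comp_assoc') simp_all
    then have "zero_arrow C (y \<bullet> (l \<bullet> u))" using u by simp
    then have "y \<bullet> (l \<bullet> u) = y \<bullet> (k \<bullet> h)" using h1 by - (rule zero_unique, use h u in simp_all)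
    moreover have "l \<bullet> u \<in> homs C (src C h) P" "k \<bullet> h \<in> homs C (src C h) P"
      using u h by (simp_all add: homs_iff)
    ultimately have "l \<bullet> u = k \<bullet> h" by blast
    moreover have "l \<bullet> u = k \<bullet> (n' \<bullet> u)" using u kn comp_assoc'[of u n' k] by simp
    ultimately have "n' \<bullet> u = h"
      by - (rule monicD[OF kernel_monic[OF k]], use u h in simp_all)
    then show "\<exists>u \<in> Arr C. src C u = src C h \<and> tgt C u = src C n' \<and> n' \<bullet> u = h"
      using u by auto
  qed (use xkn mn' in simp_all)
  moreover from this have "is_cokernel C n' (y \<bullet> k)" by (rule epic_cokernel_of_kernel[OF eb])
  ultimately have "short_exact C n' (y \<bullet> k)" by (simp add: short_exact_def)
  then show ?thesis
    using that[of "x \<bullet> k" n' "y \<bullet> k"] qp xkn eb by simp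
qed

subsection \<open>Noetherian objects\<close>

lemma sub_le_iff:
  "sub_le C m n \<longleftrightarrow> (\<exists>u \<in> Arr C. src C u = src C m \<and> tgt C u = src C n \<and> n \<bullet> u = m)"
  by (auto simp: sub_le_def homs_iff)

lemma sub_leE:
  assumes "sub_le C m n"
  obtains u where "u \<in> Arr C" "src C u = src C m" "tgt C u = src C n" "n \<bullet> u = m"
  using assms unfolding sub_le_iff by blast

lemma sub_leI:
  "u \<in> Arr C \<Longrightarrow> src C u = src C m \<Longrightarrow> tgt C u = src C n \<Longrightarrow> n \<bullet> u = m \<Longrightarrow> sub_le C m n"
  unfolding sub_le_iff by blast

lemma kernel_sub_le_iff:
  assumes "is_kernel C f k" "h \<in> Arr C" "tgt C h = src C f"
  shows "sub_le C h k \<longleftrightarrow> zero_arrow C (f \<bullet> h)"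
proof
  note [simp] = kernelD[OF assms(1)]
  assume "sub_le C h k"
  then obtain u where u: "u \<in> Arr C" "src C u = src C h" "tgt C u = src C k" "k \<bullet> u = h"
    by (rule sub_leE)
  have "zero_arrow C ((f \<bullet> k) \<bullet> u)" using u by - (rule zero_comp_right, simp_all)
  then show "zero_arrow C (f \<bullet> h)" using u by simp
next
  assume "zero_arrow C (f \<bullet> h)"
  then show "sub_le C h k" using kernel_factor[OF assms(1-3)] sub_leI by metis
qed

lemma noetherian_Obj: "noetherian C A \<Longrightarrow> A \<in> Obj C"
  by (simp add: noetherian_def)

text \<open>Otherwise dependent choice yields an ascending chain that never stabilizes.
  \<open>S\<close> consists of monomorphisms rather than subobjects, so maximality means that
  factorization in one direction implies factorization in the other.\<close>

lemma noetherian_maximal: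
  assumes A: "noetherian C A" and S: "S \<noteq> {}" "\<And>m. m \<in> S \<Longrightarrow> monic C m \<and> tgt C m = A"
  obtains m where "m \<in> S" "\<And>n. n \<in> S \<Longrightarrow> sub_le C m n \<Longrightarrow> sub_le C n m"
proof (rule ccontr)
  assume "\<not> thesis"
  then have next_ex: "\<exists>n. n \<in> S \<and> sub_le C m n \<and> \<not> sub_le C n m" if "m \<in> S" for m
    using that \<open>\<And>m. m \<in> S \<Longrightarrow> (\<And>n. n \<in> S \<Longrightarrow> sub_le C m n \<Longrightarrow> sub_le C n m) \<Longrightarrow> thesis\<close> by blast
  have "\<exists>f :: nat \<Rightarrow> 'b. \<forall>i. f i \<in> S \<and> (sub_le C (f i) (f (Suc i)) \<and> \<not> sub_le C (f (Suc i)) (f i))"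
    by (rule dependent_nat_choice) (use S(1) next_ex in blast)+
  then obtain f :: "nat \<Rightarrow> 'b" where f: "\<And>i. f i \<in> S" "\<And>i. sub_le C (f i) (f (Suc i))"
    "\<And>i. \<not> sub_le C (f (Suc i)) (f i)" by blast
  then obtain N where "\<forall>i \<ge> N. sub_le C (f i) (f N)"
    using A S(2) unfolding noetherian_def by meson
  then show False using f(3)[of N] by simp
qed

lemma noetherian_sub:
  assumes i: "monic C i" and A: "noetherian C (tgt C i)"
  shows "noetherian C (src C i)"
  unfolding noetherian_def
proof (intro conjI allI impI)
  note [simp] = monic_arr[OF i]
  show "src C i \<in> Obj C" by simp
  have le_iff: "sub_le C (i \<bullet> m) (i \<bullet> n) \<longleftrightarrow> sub_le C m n"
    if mn: "monic C m \<and> tgt C m = src C i" "monic C n \<and> tgt C n = src C i" for m n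
  proof -
    have [simp]: "m \<in> Arr C" "n \<in> Arr C" "tgt C m = src C i" "tgt C n = src C i" using mn by simp_all
    have "n \<bullet> u = m" if "u \<in> Arr C" "src C u = src C m" "tgt C u = src C n" "i \<bullet> (n \<bullet> u) = i \<bullet> m" for u
      by (rule monicD[OF i that(4)]) (use that in simp_all)
    then have "sub_le C m n" if "sub_le C (i \<bullet> m) (i \<bullet> n)"
      using that by (auto elim!: sub_leE intro: sub_leI)
    moreover have "sub_le C (i \<bullet> m) (i \<bullet> n)" if "sub_le C m n"
      using that by (auto elim!: sub_leE intro: sub_leI)
    ultimately show ?thesis by blast
  qed
  fix m :: "nat \<Rightarrow> 'b"
  assume m: "\<forall>n. monic C (m n) \<and> tgt C (m n) = src C i \<and> sub_le C (m n) (m (Suc n))"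
  have "\<forall>n. monic C (i \<bullet> m n) \<and> tgt C (i \<bullet> m n) = tgt C i \<and> sub_le C (i \<bullet> m n) (i \<bullet> m (Suc n))"
    using m i by (auto intro!: monic_comp simp: le_iff)
  then have "\<exists>N. \<forall>n \<ge> N. sub_le C (i \<bullet> m n) (i \<bullet> m N)"
    using A[unfolded noetherian_def, THEN conjunct2, rule_format, of "\<lambda>n. i \<bullet> m n"] by blast
  then show "\<exists>N. \<forall>n \<ge> N. sub_le C (m n) (m N)" using m by (simp add: le_iff)
qed

text \<open>Subobjects of the quotient are replaced by their preimages, obtained as kernels of
  \<open>q n \<bullet> e\<close> with \<open>q n\<close> the cokernel of \<open>m n\<close>.
  Inclusions on either side amount to factorizations of these cokernels through each other, so
  preimages preserve and reflect inclusion.\<close>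

lemma noetherian_quotient:
  assumes e: "epic C e" and A: "noetherian C (src C e)"
  shows "noetherian C (tgt C e)"
  unfolding noetherian_def
proof (intro conjI allI impI)
  note [simp] = epic_arr[OF e]
  show "tgt C e \<in> Obj C" by simp
  fix m :: "nat \<Rightarrow> 'b"
  assume m: "\<forall>n. monic C (m n) \<and> tgt C (m n) = tgt C e \<and> sub_le C (m n) (m (Suc n))"
  then have [simp]: "m n \<in> Arr C" "tgt C (m n) = tgt C e" for n by simp_all
  obtain q where q: "\<And>n. is_cokernel C (m n) (q n)" using has_cokernels[of "m _"] by simp metis
  have [simp]: "q n \<in> Arr C" "src C (q n) = tgt C e" "zero_arrow C (q n \<bullet> m n)" for n
    using cokernelD[OF q[of n]] by simp_all
  obtain p where p: "\<And>n. is_kernel C (q n \<bullet> e) (p n)" using has_kernels[of "q _ \<bullet> e"] by simp metis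
  have [simp]: "p n \<in> Arr C" "tgt C (p n) = src C e" for n
    using kernelD[OF p[of n]] by simp_all
  have ker_m: "is_kernel C (q n) (m n)" for n
    using m monic_kernel_of_cokernel q by blast
  have cok_p: "is_cokernel C (p n) (q n \<bullet> e)" for n
    by (rule epic_cokernel_of_kernel[OF epic_comp[OF cokernel_epic[OF q] e] p]) simp
  have le_iff: "sub_le C (p k) (p n) \<longleftrightarrow> sub_le C (m k) (m n)" for k n
  proof
    assume "sub_le C (p k) (p n)"
    then have "zero_arrow C ((q n \<bullet> e) \<bullet> p k)" using kernel_sub_le_iff[OF p[of n], of "p k"] by simp
    then obtain v where v: "v \<in> Arr C" "src C v = tgt C (q k)"
      "tgt C v = tgt C (q n)" "v \<bullet> (q k \<bullet> e) = q n \<bullet> e"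
      using cokernel_factor[OF cok_p[of k], of "q n \<bullet> e"] by auto
    have "v \<bullet> q k = q n"
      by (rule epicD[OF e]) (use v in simp_all)
    then have "q n \<bullet> m k = v \<bullet> (q k \<bullet> m k)" using v comp_assoc'[of "m k" "q k" v] by simp
    then have "zero_arrow C (q n \<bullet> m k)" using v by simp
    then show "sub_le C (m k) (m n)" using kernel_sub_le_iff[OF ker_m[of n], of "m k"] by simp
  next
    assume "sub_le C (m k) (m n)"
    then have "zero_arrow C (q n \<bullet> m k)" using kernel_sub_le_iff[OF ker_m[of n], of "m k"] by simp
    then obtain v where v: "v \<in> Arr C" "src C v = tgt C (q k)" "v \<bullet> q k = q n"
      using cokernel_factor[OF q[of k], of "q n"] by auto
    have "zero_arrow C (v \<bullet> ((q k \<bullet> e) \<bullet> p k))"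
      using v kernelD(4)[OF p[of k]] by - (rule zero_comp_left, simp_all)
    then have "zero_arrow C ((q n \<bullet> e) \<bullet> p k)"
      using v comp_assoc'[of "e \<bullet> p k" "q k" v] by simp
    then show "sub_le C (p k) (p n)" using kernel_sub_le_iff[OF p[of n], of "p k"] by simp
  qed
  have "\<forall>n. monic C (p n) \<and> tgt C (p n) = src C e \<and> sub_le C (p n) (p (Suc n))"
    using m kernel_monic[OF p] by (auto simp: le_iff)
  then have "\<exists>N. \<forall>n \<ge> N. sub_le C (p n) (p N)"
    using A[unfolded noetherian_def, THEN conjunct2, rule_format, of p] by blast
  then show "\<exists>N. \<forall>n \<ge> N. sub_le C (m n) (m N)" by (simp add: le_iff)
qed

lemma noetherian_zero_object: "zero_object C Z \<Longrightarrow> noetherian C Z"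
  unfolding noetherian_def
proof (intro conjI allI impI)
  assume Z: "zero_object C Z"
  then show "Z \<in> Obj C" by (rule zero_object_Obj)
  fix m :: "nat \<Rightarrow> 'b"
  assume m: "\<forall>n. monic C (m n) \<and> tgt C (m n) = Z \<and> sub_le C (m n) (m (Suc n))"
  have "sub_le C (m n) (m 0)" for n
  proof -
    have m' [simp]: "m k \<in> Arr C" "tgt C (m k) = Z" for k using m by simp_all
    obtain u where u: "zero_arrow C u" "src C u = src C (m n)" "tgt C u = src C (m 0)"
      using zero_ex[of "src C (m n)" "src C (m 0)"] by auto
    have "m 0 \<bullet> u = m n"
      by (rule zero_unique) (use u zero_object_arrow[OF Z, of "m n"] in simp_all)
    then show ?thesis using u by (intro sub_leI[of u]) simp_all
  qed
  then show "\<exists>N. \<forall>n \<ge> N. sub_le C (m n) (m N)" by blast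
qed

lemma sub_le_trans: "sub_le C l m \<Longrightarrow> sub_le C m n \<Longrightarrow> n \<in> Arr C \<Longrightarrow> sub_le C l n"
proof -
  assume n: "n \<in> Arr C" and "sub_le C l m" "sub_le C m n"
  then obtain u v where u: "u \<in> Arr C" "src C u = src C l" "tgt C u = src C m" "m \<bullet> u = l"
    and v: "v \<in> Arr C" "src C v = src C m" "tgt C v = src C n" "n \<bullet> v = m"
    by (metis sub_leE)
  then show ?thesis using n comp_assoc'[of u v n] by (intro sub_leI[of "v \<bullet> u"]) simp_all
qed

lemma sub_le_refl: "m \<in> Arr C \<Longrightarrow> sub_le C m m"
  by (rule sub_leI[of "idn C (src C m)"]) simp_all

text \<open>A chain in the middle object leaves traces \<open>a n\<close> in the subobject and
  images \<open>j n\<close> in the quotient. Once both are stationary, an argument in the style of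
  the five lemma shows that the inclusions in the chain are isomorphisms.\<close>

lemma noetherian_extension:
  assumes ip: "short_exact C i p" and A: "noetherian C (src C i)" and D: "noetherian C (tgt C p)"
  shows "noetherian C (tgt C i)"
  unfolding noetherian_def
proof (intro conjI allI impI)
  have ki: "is_kernel C p i" and cp: "is_cokernel C i p" using ip by (simp_all add: short_exact_def)
  note [simp] = kernelD[OF ki]
  note mi = kernel_monic[OF ki] and ep = cokernel_epic[OF cp]
  show "tgt C i \<in> Obj C" using kernelD(1)[OF ki] by simp
  fix m :: "nat \<Rightarrow> 'b"
  assume m: "\<forall>n. monic C (m n) \<and> tgt C (m n) = tgt C i \<and> sub_le C (m n) (m (Suc n))"
  then have [simp]: "m n \<in> Arr C" "tgt C (m n) = src C p" for n by simp_all
  have mono: "sub_le C (m k) (m n)" if "k \<le> n" for k n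
    using that
  proof (induction rule: dec_induct)
    case (step n)
    then show ?case using m sub_le_trans[of "m k" "m n" "m (Suc n)"] by simp
  qed (simp add: sub_le_refl)
  \<comment> \<open>The kernel \<open>k n\<close> of \<open>p \<bullet> m n\<close> is the
    intersection of \<open>m n\<close> with the subobject \<open>i\<close>, and \<open>j n\<close>
    is the image of \<open>m n\<close> in the quotient.\<close>
  have "\<exists>k e j. is_kernel C (p \<bullet> m n) k \<and> epic C e \<and> monic C j \<and> src C e = src C (p \<bullet> m n) \<and>
    tgt C j = tgt C (p \<bullet> m n) \<and> src C j = tgt C e \<and> j \<bullet> e = p \<bullet> m n" for n
    using has_kernels[of "p \<bullet> m n"] factorization[of "p \<bullet> m n"] by (simp, metis)
  then obtain k e j where k: "\<And>n. is_kernel C (p \<bullet> m n) (k n)"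
    and e: "\<And>n. epic C (e n)" and j: "\<And>n. monic C (j n)"
    and ej: "\<And>n. src C (e n) = src C (p \<bullet> m n)" "\<And>n. tgt C (j n) = tgt C (p \<bullet> m n)"
      "\<And>n. src C (j n) = tgt C (e n)" "\<And>n. j n \<bullet> e n = p \<bullet> m n"
    by metis
  have [simp]: "e n \<in> Arr C" "src C (e n) = src C (m n)" "j n \<in> Arr C" "tgt C (j n) = tgt C p"
    "src C (j n) = tgt C (e n)" for n
    using ej e[of n] j[of n] by simp_all
  have [simp]: "k n \<in> Arr C" "tgt C (k n) = src C (m n)" "zero_arrow C (p \<bullet> (m n \<bullet> k n))" for n
    using kernelD[OF k[of n]] by simp_all
  have ck: "is_cokernel C (k n) (e n)" for n
  proof (rule epic_cokernel_of_kernel[OF e])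
    show "is_kernel C (e n) (k n)"
      using k[of n] kernel_comp_monic[OF j[of n], of "e n"] by (simp add: ej(4))
  qed
  have "\<exists>a \<in> Arr C. src C a = src C (k n) \<and> tgt C a = src C i \<and> i \<bullet> a = m n \<bullet> k n" for n
    using kernel_factor[OF ki, of "m n \<bullet> k n"] by auto
  then obtain a where a [simp]: "\<And>n. a n \<in> Arr C" "\<And>n. src C (a n) = src C (k n)"
    "\<And>n. tgt C (a n) = src C i" and ia: "\<And>n. i \<bullet> a n = m n \<bullet> k n"
    by metis
  have ma: "monic C (a n)" for n
  proof (rule monic_cancel[of i])
    show "monic C (i \<bullet> a n)" unfolding ia
      by (rule monic_comp) (use m kernel_monic[OF k[of n]] in simp_all)
  qed simp_all
  have inc_a: "sub_le C (a l) (a n)" and inc_j: "sub_le C (j l) (j n)" if ln: "l \<le> n" for l n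
  proof -
    obtain u where u [simp]: "u \<in> Arr C" "src C u = src C (m l)" "tgt C u = src C (m n)" and mu: "m n \<bullet> u = m l"
      using mono[OF ln] by (auto elim: sub_leE)
    have muk: "m n \<bullet> (u \<bullet> k l) = m l \<bullet> k l" using comp_assoc'[of "k l" u "m n"] mu by simp
    have "zero_arrow C ((p \<bullet> m n) \<bullet> (u \<bullet> k l))" using muk by simp
    then obtain v where v [simp]: "v \<in> Arr C" "src C v = src C (k l)" "tgt C v = src C (k n)" and kv: "k n \<bullet> v = u \<bullet> k l"
      using kernel_factor[OF k[of n], of "u \<bullet> k l"] by auto
    have "i \<bullet> (a n \<bullet> v) = i \<bullet> a l"
      using comp_assoc'[of v "a n" i] comp_assoc'[of v "k n" "m n"] ia muk kv by simp
    then have "a n \<bullet> v = a l" by - (rule monicD[OF mi], simp_all)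
    then show "sub_le C (a l) (a n)" by (intro sub_leI[of v]) simp_all
    have "zero_arrow C ((e n \<bullet> u) \<bullet> k l)"
      using cokernelD(4)[OF ck[of n]] by (simp add: kv[symmetric] zero_comp_assoc)
    then obtain w where w [simp]: "w \<in> Arr C" "src C w = tgt C (e l)" "tgt C w = tgt C (e n)" and we: "w \<bullet> e l = e n \<bullet> u"
      using cokernel_factor[OF ck[of l], of "e n \<bullet> u"] by auto
    have "(j n \<bullet> w) \<bullet> e l = j l \<bullet> e l"
      using we ej(4)[of l] comp_assoc'[of u "e n" "j n"] ej(4)[of n] mu by simp
    then have "j n \<bullet> w = j l" by - (rule epicD[OF e[of l]], simp_all)
    then show "sub_le C (j l) (j n)" by (intro sub_leI[of w]) simp_all
  qed
  have "\<exists>N. \<forall>n \<ge> N. sub_le C (a n) (a N)"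
    using A[unfolded noetherian_def, THEN conjunct2, rule_format, of a] ma inc_a by simp
  then obtain N1 where N1: "\<And>n. n \<ge> N1 \<Longrightarrow> sub_le C (a n) (a N1)" by blast
  have "\<exists>N. \<forall>n \<ge> N. sub_le C (j n) (j N)"
    using D[unfolded noetherian_def, THEN conjunct2, rule_format, of j] j inc_j by simp
  then obtain N2 where N2: "\<And>n. n \<ge> N2 \<Longrightarrow> sub_le C (j n) (j N2)" by blast
  define N where "N = max N1 N2"
  have "sub_le C (m n) (m N)" if nN: "n \<ge> N" for n
  proof -
    have "sub_le C (a n) (a N)" by (rule sub_le_trans[OF N1 inc_a]) (use nN in \<open>simp_all add: N_def\<close>)
    moreover have "sub_le C (j n) (j N)" by (rule sub_le_trans[OF N2 inc_j]) (use nN in \<open>simp_all add: N_def\<close>)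
    ultimately obtain v w where v [simp]: "v \<in> Arr C" "src C v = src C (k n)" "tgt C v = src C (k N)" and av: "a N \<bullet> v = a n"
      and w [simp]: "w \<in> Arr C" "src C w = tgt C (e n)" "tgt C w = tgt C (e N)" and jw: "j N \<bullet> w = j n"
      unfolding sub_le_iff by auto
    obtain u where u [simp]: "u \<in> Arr C" "src C u = src C (m N)" "tgt C u = src C (m n)" and mu: "m n \<bullet> u = m N"
      using mono[OF nN] by (auto elim: sub_leE)
    have mm: "monic C (m n)" using m by simp
    have "m n \<bullet> (u \<bullet> (k N \<bullet> v)) = m N \<bullet> (k N \<bullet> v)" using comp_assoc'[of "k N \<bullet> v" u "m n"] mu by simp
    also have "\<dots> = i \<bullet> (a N \<bullet> v)" using comp_assoc'[of v "k N" "m N"] comp_assoc'[of v "a N" i] ia by simp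
    also have "\<dots> = m n \<bullet> k n" using av ia by simp
    finally have ukv: "u \<bullet> (k N \<bullet> v) = k n" by - (rule monicD[OF mm], simp_all)
    have "j N \<bullet> (w \<bullet> (e n \<bullet> u)) = j n \<bullet> (e n \<bullet> u)" using comp_assoc'[of "e n \<bullet> u" w "j N"] jw by simp
    also have "\<dots> = p \<bullet> (m n \<bullet> u)" using comp_assoc'[of u "e n" "j n"] ej(4)[of n] by simp
    also have "\<dots> = j N \<bullet> e N" using mu ej(4) by simp
    finally have weu: "w \<bullet> (e n \<bullet> u) = e N" by - (rule monicD[OF j[of N]], simp_all)
    \<comment> \<open>\<open>w\<close> compares two stationary images, so it is an isomorphism, and
      \<open>e n \<bullet> u\<close> inherits epicness from \<open>e N\<close>.\<close>
    have mw: "monic C w" by (rule monic_cancel[of "j N"]) (use jw j in simp_all)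
    have "epic C (w \<bullet> (e n \<bullet> u))" using weu e by simp
    then have "epic C w" by (rule epic_cancel) simp_all
    with mw have "is_iso C w" by (rule monic_epic_iso)
    then have "epic C (e n \<bullet> u)"
    proof (rule isoE)
      fix w' assume w': "w' \<in> Arr C" "src C w' = tgt C w" "tgt C w' = src C w" "w' \<bullet> w = idn C (src C w)"
        "is_iso C w'"
      have "e n \<bullet> u = w' \<bullet> e N" using w' comp_assoc'[of "e n \<bullet> u" w w'] weu by simp
      then show ?thesis using epic_comp[OF iso_epic[OF w'(5)] e[of N]] w' by simp
    qed
    \<comment> \<open>An arrow killing \<open>u\<close> kills \<open>k n\<close>, which factors
      through \<open>u\<close> because the traces agree. So it has the form
      \<open>y \<bullet> e n\<close>, where \<open>y\<close> kills the epic
      \<open>e n \<bullet> u\<close>.\<close>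
    have "epic C u"
    proof (rule epicI)
      fix x assume x [simp]: "x \<in> Arr C" "src C x = tgt C u" and xu: "zero_arrow C (x \<bullet> u)"
      have "zero_arrow C ((x \<bullet> u) \<bullet> (k N \<bullet> v))" by (rule zero_comp_right) (use xu in simp_all)
      then have "zero_arrow C (x \<bullet> k n)" using ukv by simp
      then obtain y where y: "y \<in> Arr C" "src C y = tgt C (e n)" "y \<bullet> e n = x"
        using cokernel_factor[OF ck[of n], of x] by auto
      have "zero_arrow C (y \<bullet> (e n \<bullet> u))" using y xu comp_assoc'[of u "e n" y] by simp
      then have "zero_arrow C y" using epic_zeroD[OF \<open>epic C (e n \<bullet> u)\<close>, of y] y by simp
      then show "zero_arrow C x" using y by (metis zero_comp_right \<open>\<And>n. e n \<in> Arr C\<close>)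
    qed simp
    moreover have "monic C u"
      by (rule monic_cancel[of "m n"]) (use mu m in simp_all)
    ultimately have "is_iso C u" by (simp add: monic_epic_iso)
    then show ?thesis
    proof (rule isoE)
      fix u' assume u': "u' \<in> Arr C" "src C u' = tgt C u" "tgt C u' = src C u" "u \<bullet> u' = idn C (tgt C u)"
      have "m N \<bullet> u' = m n" using u' comp_assoc'[of u' u "m n"] mu by simp
      then show ?thesis using u' by (intro sub_leI[of u']) simp_all
    qed
  qed
  then show "\<exists>N. \<forall>n \<ge> N. sub_le C (m n) (m N)" by blast
qed

end

section \<open>Closed monoidal abelian categories\<close>

locale abelian_closed_category =
  abelian_category C + symmetric_monoidal_closed_category C
  for C :: "('o, 'm, 'z) mon_cat_scheme" (structure)
begin

lemma tens_Obj [simp]: "A \<in> Obj C \<Longrightarrow> B \<in> Obj C \<Longrightarrow> A \<odot> B \<in> Obj C"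
  by (rule tens_in_Obj)

lemma tensa_simps [simp]:
  assumes "f \<in> Arr C" "g \<in> Arr C"
  shows "f \<star> g \<in> Arr C" "src C (f \<star> g) = src C f \<odot> src C g" "tgt C (f \<star> g) = tgt C f \<odot> tgt C g"
  using tensa_in_homs[of f "src C f" "tgt C f" g "src C g" "tgt C g"] assms by (simp_all add: homs_iff)

declare tensa_idn [simp] munit_in_Obj [simp]

lemma interchange:
  assumes "f \<in> Arr C" "g \<in> Arr C" "f' \<in> Arr C" "g' \<in> Arr C" "src C g = tgt C f" "src C g' = tgt C f'"
  shows "(g \<star> g') \<bullet> (f \<star> f') = (g \<bullet> f) \<star> (g' \<bullet> f')"
  using tensa_comp[of f "src C f" "tgt C f" g "tgt C g" f' "src C f'" "tgt C f'" g' "tgt C g'"] assms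
  by (simp add: homs_iff)

lemma interchange':
  assumes "f \<in> Arr C" "g \<in> Arr C" "f' \<in> Arr C" "g' \<in> Arr C" "src C g = tgt C f" "src C g' = tgt C f'"
    "h \<in> Arr C" "tgt C h = src C f \<odot> src C f'"
  shows "(g \<star> g') \<bullet> ((f \<star> f') \<bullet> h) = ((g \<bullet> f) \<star> (g' \<bullet> f')) \<bullet> h"
  using comp_assoc'[of h "f \<star> f'" "g \<star> g'"] assms by (simp add: interchange)

lemma asc_simps [simp]:
  assumes "A \<in> Obj C" "B \<in> Obj C" "D \<in> Obj C"
  shows "asc C A B D \<in> Arr C" "src C (asc C A B D) = (A \<odot> B) \<odot> D" "tgt C (asc C A B D) = A \<odot> (B \<odot> D)"
  using asc_in_homs[OF assms] by (simp_all add: homs_iff)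

lemma lun_simps [simp]:
  assumes "A \<in> Obj C"
  shows "lun C A \<in> Arr C" "src C (lun C A) = munit C \<odot> A" "tgt C (lun C A) = A"
  using lun_in_homs[OF assms] by (simp_all add: homs_iff)

lemma run_simps [simp]:
  assumes "A \<in> Obj C"
  shows "run C A \<in> Arr C" "src C (run C A) = A \<odot> munit C" "tgt C (run C A) = A"
  using run_in_homs[OF assms] by (simp_all add: homs_iff)

lemma swp_simps [simp]:
  assumes "A \<in> Obj C" "B \<in> Obj C"
  shows "swp C A B \<in> Arr C" "src C (swp C A B) = A \<odot> B" "tgt C (swp C A B) = B \<odot> A"
  using swp_in_homs[OF assms] by (simp_all add: homs_iff)

lemma swp_iso: "A \<in> Obj C \<Longrightarrow> B \<in> Obj C \<Longrightarrow> is_iso C (swp C A B)"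
  by (rule isoI[of _ "swp C B A"]) (simp_all add: swp_swp)

lemma swp_nat:
  "f \<in> Arr C \<Longrightarrow> g \<in> Arr C \<Longrightarrow>
    swp C (tgt C f) (tgt C g) \<bullet> (f \<star> g) = (g \<star> f) \<bullet> swp C (src C f) (src C g)"
  by (rule swp_natural) (simp_all add: homs_iff)

lemma asc_nat:
  "f \<in> Arr C \<Longrightarrow> g \<in> Arr C \<Longrightarrow> h \<in> Arr C \<Longrightarrow>
    asc C (tgt C f) (tgt C g) (tgt C h) \<bullet> ((f \<star> g) \<star> h) =
    (f \<star> (g \<star> h)) \<bullet> asc C (src C f) (src C g) (src C h)"
  by (rule asc_natural) (simp_all add: homs_iff)

text \<open>Carries vanishing across the naturality squares of the symmetry and the
  associator.\<close>

lemma zero_conj_iff: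
  assumes "a \<bullet> f = g \<bullet> b" "is_iso C a" "is_iso C b" "f \<in> Arr C" "g \<in> Arr C"
    "src C a = tgt C f" "tgt C b = src C g"
  shows "zero_arrow C f \<longleftrightarrow> zero_arrow C g"
proof
  assume "zero_arrow C f"
  then have "zero_arrow C (g \<bullet> b)" using zero_comp_left[of f a] assms by simp
  then show "zero_arrow C g" using epic_zeroD[OF iso_epic[OF assms(3)], of g] assms by simp
next
  assume "zero_arrow C g"
  then have "zero_arrow C (a \<bullet> f)" using zero_comp_right[of g b] assms by simp
  then show "zero_arrow C f" using monic_zeroD[OF iso_monic[OF assms(2)], of f] assms by simp
qed

lemma zero_swp_iff:
  "f \<in> Arr C \<Longrightarrow> g \<in> Arr C \<Longrightarrow> zero_arrow C (f \<star> g) \<longleftrightarrow> zero_arrow C (g \<star> f)"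
  by (rule zero_conj_iff[OF swp_nat[of f g]]) (simp_all add: swp_iso)

lemma zero_asc_iff:
  "f \<in> Arr C \<Longrightarrow> g \<in> Arr C \<Longrightarrow> h \<in> Arr C \<Longrightarrow>
    zero_arrow C ((f \<star> g) \<star> h) \<longleftrightarrow> zero_arrow C (f \<star> (g \<star> h))"
  by (rule zero_conj_iff[OF asc_nat[of f g h]]) (simp_all add: asc_iso)

section \<open>Right exactness of the tensor product from the internal hom\<close>

lemma internal_hom_ex:
  assumes "A \<in> Obj C" "B \<in> Obj C"
  shows "\<exists>H ev. H \<in> Obj C \<and> ev \<in> Arr C \<and> src C ev = H \<odot> A \<and> tgt C ev = B \<and>
    (\<forall>X \<in> Obj C. \<forall>f \<in> Arr C. src C f = X \<odot> A \<and> tgt C f = B \<longrightarrow>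
      (\<exists>!g. g \<in> Arr C \<and> src C g = X \<and> tgt C g = H \<and> ev \<bullet> (g \<star> idn C A) = f))"
proof -
  obtain H ev where "H \<in> Obj C" "ev \<in> homs C (H \<odot> A) B"
    "\<forall>X \<in> Obj C. \<forall>f \<in> homs C (X \<odot> A) B. \<exists>!g. g \<in> homs C X H \<and> ev \<bullet> (g \<star> idn C A) = f"
    using closed[OF assms] by blast
  then show ?thesis by (intro exI[of _ H] exI[of _ ev]) (simp add: homs_iff conj_assoc)
qed

text \<open>Vanishing comes from closedness: arrows out of \<open>Z \<odot> D\<close> correspond to
  arrows out of the zero object \<open>Z\<close>, so they are all zero, and
  \<open>f \<star> g\<close> factors through such an object.\<close>

lemma zero_tensa_left:
  assumes f: "zero_arrow C f" and g: "g \<in> Arr C"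
  shows "zero_arrow C (f \<star> g)"
proof -
  obtain Z a b where *: "zero_object C Z" "a \<in> Arr C" "src C a = src C f" "tgt C a = Z"
    "b \<in> Arr C" "src C b = Z" "tgt C b = tgt C f" "b \<bullet> a = f"
    using zero_arrowE[OF f] by blast
  have Z: "Z \<in> Obj C" using * by (simp add: zero_object_Obj)
  have "zero_arrow C x" if x: "x \<in> Arr C" "src C x = Z \<odot> D" "D \<in> Obj C" for x D
  proof -
    have xO: "tgt C x \<in> Obj C" using x by simp
    obtain H ev where H: "\<forall>X \<in> Obj C. \<forall>f \<in> Arr C. src C f = X \<odot> D \<and> tgt C f = tgt C x \<longrightarrow>
      (\<exists>!g. g \<in> Arr C \<and> src C g = X \<and> tgt C g = H \<and> ev \<bullet> (g \<star> idn C D) = f)"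
      using internal_hom_ex[OF x(3) xO] by blast
    obtain z where z: "zero_arrow C z" "src C z = Z \<odot> D" "tgt C z = tgt C x"
      using zero_ex[of "Z \<odot> D" "tgt C x"] x Z by auto
    obtain g where g: "g \<in> Arr C" "src C g = Z" "tgt C g = H" "ev \<bullet> (g \<star> idn C D) = x"
      using H[rule_format, of Z x] Z x by auto
    obtain h where h: "h \<in> Arr C" "src C h = Z" "tgt C h = H" "ev \<bullet> (h \<star> idn C D) = z"
      using H[rule_format, of Z z] Z z by auto
    have "g = h" using zero_object_unique(2)[OF *(1), of g h] g h by simp
    then show ?thesis using g h z by simp
  qed
  from this[of "b \<star> g" "src C g"] have "zero_arrow C (b \<star> g)" using * g by simp
  then have "zero_arrow C ((b \<star> g) \<bullet> (a \<star> idn C (src C g)))" using * g by simp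
  then show ?thesis using * g by (simp add: interchange)
qed

lemma zero_tensa_right: "zero_arrow C f \<Longrightarrow> g \<in> Arr C \<Longrightarrow> zero_arrow C (g \<star> f)"
  using zero_tensa_left[of f g] zero_swp_iff[of f g] by simp

declare zero_tensa_left [simp] zero_tensa_right [simp]

text \<open>The adjunction in the form used below: uniqueness of transposes is weakened to the
  detection of zero, which suffices since equalities are tested by vanishing.\<close>

lemma transpose_ex:
  assumes A: "A \<in> Obj C" and B: "B \<in> Obj C"
  shows "\<exists>H ev. H \<in> Obj C \<and> ev \<in> Arr C \<and> src C ev = H \<odot> A \<and> tgt C ev = B \<and>
    (\<forall>X \<in> Obj C. \<forall>f \<in> Arr C. src C f = X \<odot> A \<and> tgt C f = B \<longrightarrow>
      (\<exists>g \<in> Arr C. src C g = X \<and> tgt C g = H \<and> ev \<bullet> (g \<star> idn C A) = f)) \<and>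
    (\<forall>g \<in> Arr C. tgt C g = H \<and> zero_arrow C (ev \<bullet> (g \<star> idn C A)) \<longrightarrow> zero_arrow C g)"
proof -
  obtain H ev where H: "H \<in> Obj C" and ev: "ev \<in> Arr C" "src C ev = H \<odot> A" "tgt C ev = B"
    and ex: "\<forall>X \<in> Obj C. \<forall>f \<in> Arr C. src C f = X \<odot> A \<and> tgt C f = B \<longrightarrow>
      (\<exists>!g. g \<in> Arr C \<and> src C g = X \<and> tgt C g = H \<and> ev \<bullet> (g \<star> idn C A) = f)"
    using internal_hom_ex[OF A B] by blast
  have "zero_arrow C g" if g: "g \<in> Arr C" "tgt C g = H" "zero_arrow C (ev \<bullet> (g \<star> idn C A))" for g
  proof -
    obtain z where z: "zero_arrow C z" "src C z = src C g" "tgt C z = H"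
      using zero_ex[of "src C g" H] g H by auto
    have eq: "ev \<bullet> (z \<star> idn C A) = ev \<bullet> (g \<star> idn C A)"
      by (rule zero_unique) (use z g ev A in simp_all)
    have "\<exists>!h. h \<in> Arr C \<and> src C h = src C g \<and> tgt C h = H \<and> ev \<bullet> (h \<star> idn C A) = ev \<bullet> (g \<star> idn C A)"
      by (rule ex[rule_format]) (use g ev A in simp_all)
    then have "z = g" by (rule ex1E) (metis eq z zero_arr g(1,2))
    then show ?thesis using z by simp
  qed
  then show ?thesis using H ev ex by (intro exI[of _ H] exI[of _ ev]) blast
qed

text \<open>Tensoring with \<open>D\<close> is a left adjoint: an arrow killing
  \<open>e \<star> idn C D\<close> has a transpose \<open>g\<close> that kills
  \<open>e\<close>.\<close>

lemma epic_tensa_left: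
  assumes e: "epic C e" and D: "D \<in> Obj C"
  shows "epic C (e \<star> idn C D)"
proof (rule epicI)
  note [simp] = epic_arr[OF e] D
  show "e \<star> idn C D \<in> Arr C" by simp
  fix x assume x: "x \<in> Arr C" "src C x = tgt C (e \<star> idn C D)" "zero_arrow C (x \<bullet> (e \<star> idn C D))"
  have xO: "tgt C x \<in> Obj C" using x by simp
  obtain H ev where H: "H \<in> Obj C" "ev \<in> Arr C" "src C ev = H \<odot> D" "tgt C ev = tgt C x"
    "\<forall>X \<in> Obj C. \<forall>f \<in> Arr C. src C f = X \<odot> D \<and> tgt C f = tgt C x \<longrightarrow>
      (\<exists>g \<in> Arr C. src C g = X \<and> tgt C g = H \<and> ev \<bullet> (g \<star> idn C D) = f)"
    "\<forall>g \<in> Arr C. tgt C g = H \<and> zero_arrow C (ev \<bullet> (g \<star> idn C D)) \<longrightarrow> zero_arrow C g"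
    using transpose_ex[OF D xO] by blast
  obtain g where g: "g \<in> Arr C" "src C g = tgt C e" "tgt C g = H" "ev \<bullet> (g \<star> idn C D) = x"
    using H(5)[rule_format, of "tgt C e" x] x by auto
  have "x \<bullet> (e \<star> idn C D) = (ev \<bullet> (g \<star> idn C D)) \<bullet> (e \<star> idn C D)" unfolding g(4) ..
  also have "\<dots> = ev \<bullet> ((g \<bullet> e) \<star> idn C D)" using g(1-3) H(2,3) by (simp add: interchange)
  finally have "zero_arrow C (g \<bullet> e)" using H(6)[rule_format, of "g \<bullet> e"] x g(1-3) by simp
  then have "zero_arrow C g" using epic_zeroD[OF e, of g] g by simp
  then have "zero_arrow C (ev \<bullet> (g \<star> idn C D))" using H(1-4) g(1-3) by simp
  then show "zero_arrow C x" using g by simp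
qed

lemma epic_tensa_right:
  assumes e: "epic C e" and D: "D \<in> Obj C"
  shows "epic C (idn C D \<star> e)"
proof (rule epicI)
  note [simp] = epic_arr[OF e] D
  show "idn C D \<star> e \<in> Arr C" by simp
  fix x assume x: "x \<in> Arr C" "src C x = tgt C (idn C D \<star> e)" "zero_arrow C (x \<bullet> (idn C D \<star> e))"
  have "zero_arrow C ((x \<bullet> (idn C D \<star> e)) \<bullet> swp C (src C e) D)"
    by (rule zero_comp_right) (use x in simp_all)
  then have "zero_arrow C ((x \<bullet> swp C (tgt C e) D) \<bullet> (e \<star> idn C D))"
    using x swp_nat[of e "idn C D"] by simp
  then have "zero_arrow C (x \<bullet> swp C (tgt C e) D)"
    by - (rule epic_zeroD[OF epic_tensa_left[OF e D]], use x in simp_all)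
  then show "zero_arrow C x"
    using epic_zeroD[OF iso_epic[OF swp_iso[of "tgt C e" D]], of x] x by simp
qed

text \<open>The transpose of \<open>h\<close> kills \<open>k\<close>, so it factors through
  \<open>c\<close>, and the factorization is transposed back.\<close>

lemma cokernel_tensa_left:
  assumes c: "is_cokernel C k c" and D: "D \<in> Obj C"
    and h: "h \<in> Arr C" "src C h = tgt C k \<odot> D" "zero_arrow C (h \<bullet> (k \<star> idn C D))"
  obtains v where "v \<in> Arr C" "src C v = tgt C c \<odot> D" "tgt C v = tgt C h" "v \<bullet> (c \<star> idn C D) = h"
proof -
  note [simp] = cokernelD[OF c] D
  have hO: "tgt C h \<in> Obj C" using h by simp
  obtain H ev where H: "H \<in> Obj C" "ev \<in> Arr C" "src C ev = H \<odot> D" "tgt C ev = tgt C h"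
    "\<forall>X \<in> Obj C. \<forall>f \<in> Arr C. src C f = X \<odot> D \<and> tgt C f = tgt C h \<longrightarrow>
      (\<exists>g \<in> Arr C. src C g = X \<and> tgt C g = H \<and> ev \<bullet> (g \<star> idn C D) = f)"
    "\<forall>g \<in> Arr C. tgt C g = H \<and> zero_arrow C (ev \<bullet> (g \<star> idn C D)) \<longrightarrow> zero_arrow C g"
    using transpose_ex[OF D hO] by blast
  obtain g where g: "g \<in> Arr C" "src C g = tgt C k" "tgt C g = H" "ev \<bullet> (g \<star> idn C D) = h"
    using H(5)[rule_format, of "tgt C k" h] h by auto
  have "h \<bullet> (k \<star> idn C D) = (ev \<bullet> (g \<star> idn C D)) \<bullet> (k \<star> idn C D)" unfolding g(4) ..
  also have "\<dots> = ev \<bullet> ((g \<bullet> k) \<star> idn C D)" using g(1-3) H(2,3) by (simp add: interchange)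
  finally have "zero_arrow C (g \<bullet> k)" using H(6)[rule_format, of "g \<bullet> k"] h g(1-3) by simp
  then obtain u where u: "u \<in> Arr C" "src C u = tgt C c" "tgt C u = H" "u \<bullet> c = g"
    using cokernel_factor[OF c, of g] g by auto
  have "(ev \<bullet> (u \<star> idn C D)) \<bullet> (c \<star> idn C D) = h" using u H(2,3) g by (simp add: interchange)
  then show ?thesis using that[of "ev \<bullet> (u \<star> idn C D)"] H(1-4) u by simp
qed

lemma cokernel_tensa_right:
  assumes c: "is_cokernel C k c" and D: "D \<in> Obj C"
    and h: "h \<in> Arr C" "src C h = D \<odot> tgt C k" "zero_arrow C (h \<bullet> (idn C D \<star> k))"
  obtains v where "v \<in> Arr C" "src C v = D \<odot> tgt C c" "tgt C v = tgt C h" "v \<bullet> (idn C D \<star> c) = h"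
proof -
  note [simp] = cokernelD[OF c] D
  have [simp]: "D \<odot> tgt C k \<in> Obj C" by simp
  have "zero_arrow C ((h \<bullet> (idn C D \<star> k)) \<bullet> swp C (src C k) D)"
    by (rule zero_comp_right) (use h in simp_all)
  then have "zero_arrow C ((h \<bullet> swp C (tgt C k) D) \<bullet> (k \<star> idn C D))"
    using h swp_nat[of k "idn C D"] by simp
  then obtain v where v: "v \<in> Arr C" "src C v = tgt C c \<odot> D" "tgt C v = tgt C h"
    "v \<bullet> (c \<star> idn C D) = h \<bullet> swp C (tgt C k) D"
    using cokernel_tensa_left[OF c D, of "h \<bullet> swp C (tgt C k) D"] h by auto
  have "(v \<bullet> swp C D (tgt C c)) \<bullet> (idn C D \<star> c) = v \<bullet> ((c \<star> idn C D) \<bullet> swp C D (tgt C k))"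
    using v(1-3) swp_nat[of "idn C D" c] by simp
  also have "\<dots> = (v \<bullet> (c \<star> idn C D)) \<bullet> swp C D (tgt C k)" using v(1-3) by simp
  also have "\<dots> = h" unfolding v(4) using h by (simp add: swp_swp)
  finally show ?thesis using that[of "v \<bullet> swp C D (tgt C c)"] v by simp
qed

lemma isomorphic_tens:
  assumes "isomorphic C A A'" "isomorphic C B B'"
  shows "isomorphic C (A \<odot> B) (A' \<odot> B')"
proof -
  obtain f g where f: "is_iso C f" "src C f = A" "tgt C f = A'"
    and g: "is_iso C g" "src C g = B" "tgt C g = B'"
    using assms unfolding isomorphic_iff by blast
  obtain f' where f': "f' \<in> Arr C" "src C f' = tgt C f" "tgt C f' = src C f"
    "f' \<bullet> f = idn C (src C f)" "f \<bullet> f' = idn C (tgt C f)" using isoE[OF f(1)] by blast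
  obtain g' where g': "g' \<in> Arr C" "src C g' = tgt C g" "tgt C g' = src C g"
    "g' \<bullet> g = idn C (src C g)" "g \<bullet> g' = idn C (tgt C g)" using isoE[OF g(1)] by blast
  have [simp]: "A \<in> Obj C" "A' \<in> Obj C" "B \<in> Obj C" "B' \<in> Obj C"
    using f g src_in_Obj[of f] tgt_in_Obj[of f] src_in_Obj[of g] tgt_in_Obj[of g] by simp_all
  have "is_iso C (f \<star> g)"
    by (rule isoI[of _ "f' \<star> g'"]) (use f g f' g' in \<open>simp_all add: interchange\<close>)
  then show ?thesis unfolding isomorphic_iff using f g by (intro exI[of _ "f \<star> g"]) simp
qed

lemma isomorphic_asc:
  "A \<in> Obj C \<Longrightarrow> B \<in> Obj C \<Longrightarrow> D \<in> Obj C \<Longrightarrow> isomorphic C ((A \<odot> B) \<odot> D) (A \<odot> (B \<odot> D))"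
  unfolding isomorphic_iff by (intro exI[of _ "asc C A B D"]) (simp add: asc_iso)

lemma isomorphic_swp: "A \<in> Obj C \<Longrightarrow> B \<in> Obj C \<Longrightarrow> isomorphic C (A \<odot> B) (B \<odot> A)"
  unfolding isomorphic_iff by (intro exI[of _ "swp C A B"]) (simp add: swp_iso)

lemma isomorphic_run: "A \<in> Obj C \<Longrightarrow> isomorphic C (A \<odot> munit C) A"
  unfolding isomorphic_iff by (intro exI[of _ "run C A"]) (simp add: run_iso)

subsection \<open>Invertible objects\<close>

lemma invertible_Obj [simp]: "invertible C L \<Longrightarrow> L \<in> Obj C"
  by (simp add: invertible_def)

lemma invertible_munit: "invertible C (munit C)"
  unfolding invertible_def using isomorphic_run[of "munit C"] by auto

lemma invertible_tens:
  assumes "invertible C L" "invertible C L'"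
  shows "invertible C (L \<odot> L')"
proof -
  obtain M M' where M: "M \<in> Obj C" "isomorphic C (L \<odot> M) (munit C)"
    "M' \<in> Obj C" "isomorphic C (L' \<odot> M') (munit C)"
    using assms unfolding invertible_def by blast
  have L [simp]: "L \<in> Obj C" "L' \<in> Obj C" using assms by simp_all
  have "isomorphic C ((L \<odot> L') \<odot> (M' \<odot> M)) (L \<odot> (L' \<odot> (M' \<odot> M)))"
    by (rule isomorphic_asc) (use M in simp_all)
  also have "isomorphic C (L \<odot> (L' \<odot> (M' \<odot> M))) (L \<odot> ((L' \<odot> M') \<odot> M))"
    by (intro isomorphic_tens isomorphic_refl isomorphic_sym[OF isomorphic_asc]) (use M in simp_all)
  also have "isomorphic C (L \<odot> ((L' \<odot> M') \<odot> M)) (L \<odot> (munit C \<odot> M))"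
    by (intro isomorphic_tens isomorphic_refl) (use M in simp_all)
  also have "isomorphic C (L \<odot> (munit C \<odot> M)) (L \<odot> (M \<odot> munit C))"
    by (intro isomorphic_tens isomorphic_refl isomorphic_swp) (use M in simp_all)
  also have "isomorphic C (L \<odot> (M \<odot> munit C)) (L \<odot> M)"
    by (intro isomorphic_tens isomorphic_refl isomorphic_run) (use M in simp_all)
  also note M(2)
  finally show ?thesis unfolding invertible_def using M by auto
qed

text \<open>No triangle identities are imposed on the isomorphism \<open>j\<close> from
  \<open>L \<odot> M\<close> to the unit. Naturality of \<open>\<rho>\<close> alone makes tensoring
  with \<open>L\<close> faithful and, combined with faithfulness for \<open>M\<close>, full.\<close>

lemma untensor_ex:
  assumes "L \<in> Obj C" "M \<in> Obj C" "isomorphic C (L \<odot> M) (munit C)"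
  shows "\<exists>\<rho>. (\<forall>A \<in> Obj C. is_iso C (\<rho> A) \<and> src C (\<rho> A) = (A \<odot> L) \<odot> M \<and> tgt C (\<rho> A) = A) \<and>
    (\<forall>f \<in> Arr C. f \<bullet> \<rho> (src C f) = \<rho> (tgt C f) \<bullet> ((f \<star> idn C L) \<star> idn C M))"
proof -
  note [simp] = assms(1,2)
  obtain j where j: "is_iso C j" and [simp]: "src C j = L \<odot> M" "tgt C j = munit C"
    using assms unfolding isomorphic_iff by blast
  have [simp]: "j \<in> Arr C" using j by simp
  have idj: "is_iso C (idn C A \<star> j)" if [simp]: "A \<in> Obj C" for A
  proof -
    obtain j' where j': "j' \<in> Arr C" "src C j' = munit C" "tgt C j' = L \<odot> M"
      "j' \<bullet> j = idn C (L \<odot> M)" "j \<bullet> j' = idn C (munit C)" using isoE[OF j] unfolding \<open>src C j = _\<close> \<open>tgt C j = _\<close> by blast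
    show ?thesis
      by (rule isoI[of _ "idn C A \<star> j'"]) (use j' in \<open>simp_all add: interchange\<close>)
  qed
  define \<rho> where "\<rho> A = run C A \<bullet> ((idn C A \<star> j) \<bullet> asc C A L M)" for A
  have 1: "is_iso C (\<rho> A) \<and> src C (\<rho> A) = (A \<odot> L) \<odot> M \<and> tgt C (\<rho> A) = A" if "A \<in> Obj C" for A
    unfolding \<rho>_def using that
    by (intro conjI iso_comp[OF iso_comp[OF asc_iso idj] run_iso]) simp_all
  have 2: "f \<bullet> \<rho> (src C f) = \<rho> (tgt C f) \<bullet> ((f \<star> idn C L) \<star> idn C M)" if [simp]: "f \<in> Arr C" for f
  proof -
    have r: "run C (tgt C f) \<bullet> (f \<star> idn C (munit C)) = f \<bullet> run C (src C f)"
      by (rule run_natural) (simp add: homs_iff)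
    have "f \<bullet> \<rho> (src C f) = (f \<bullet> run C (src C f)) \<bullet> ((idn C (src C f) \<star> j) \<bullet> asc C (src C f) L M)"
      by (simp add: \<rho>_def)
    also have "\<dots> = run C (tgt C f) \<bullet> ((f \<star> j) \<bullet> asc C (src C f) L M)"
      unfolding r[symmetric] by (simp add: interchange')
    also have "\<dots> = run C (tgt C f) \<bullet> ((idn C (tgt C f) \<star> j) \<bullet> ((f \<star> idn C (L \<odot> M)) \<bullet> asc C (src C f) L M))"
      by (simp add: interchange')
    also have "(f \<star> idn C (L \<odot> M)) \<bullet> asc C (src C f) L M = asc C (tgt C f) L M \<bullet> ((f \<star> idn C L) \<star> idn C M)"
      using asc_nat[of f "idn C L" "idn C M"] by simp
    finally show ?thesis by (simp add: \<rho>_def)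
  qed
  show ?thesis using 1 2 by blast
qed

lemma invertible_dual:
  assumes "invertible C L"
  obtains M where "invertible C M" "isomorphic C (L \<odot> M) (munit C)" "isomorphic C (M \<odot> L) (munit C)"
proof -
  obtain M where M: "M \<in> Obj C" "isomorphic C (L \<odot> M) (munit C)"
    using assms unfolding invertible_def by blast
  have "isomorphic C (M \<odot> L) (L \<odot> M)" by (rule isomorphic_swp) (use M assms in simp_all)
  then have "isomorphic C (M \<odot> L) (munit C)" using M isomorphic_trans by blast
  then show ?thesis using that M assms unfolding invertible_def by blast
qed

section \<open>Tensoring with an invertible object as an equivalence\<close>

lemma invertible_faithful:
  assumes L: "invertible C L" and f: "f \<in> Arr C" "g \<in> Arr C" "src C f = src C g" "tgt C f = tgt C g"
    and eq: "f \<star> idn C L = g \<star> idn C L"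
  shows "f = g"
proof -
  obtain M where M: "invertible C M" "isomorphic C (L \<odot> M) (munit C)"
    using invertible_dual[OF L] by blast
  obtain \<rho> where \<rho>: "\<forall>A \<in> Obj C. is_iso C (\<rho> A) \<and> src C (\<rho> A) = (A \<odot> L) \<odot> M \<and> tgt C (\<rho> A) = A"
    "\<forall>f \<in> Arr C. f \<bullet> \<rho> (src C f) = \<rho> (tgt C f) \<bullet> ((f \<star> idn C L) \<star> idn C M)"
    using untensor_ex[of L M] M L by auto
  have "f \<bullet> \<rho> (src C f) = g \<bullet> \<rho> (src C f)" using \<rho>(2) f eq by metis
  moreover have "is_iso C (\<rho> (src C f))" "tgt C (\<rho> (src C f)) = src C f" using \<rho>(1) f by simp_all
  ultimately show ?thesis
    by - (rule epicD[OF iso_epic[of "\<rho> (src C f)"]], use f in simp_all)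
qed

lemma zero_invertible_iff:
  assumes L: "invertible C L" and f: "f \<in> Arr C"
  shows "zero_arrow C (f \<star> idn C L) \<longleftrightarrow> zero_arrow C f"
proof
  assume z: "zero_arrow C (f \<star> idn C L)"
  obtain z where z': "zero_arrow C z" "src C z = src C f" "tgt C z = tgt C f"
    using zero_ex[of "src C f" "tgt C f"] f by auto
  have "f \<star> idn C L = z \<star> idn C L" by (rule zero_unique) (use z z' f L in simp_all)
  then have "f = z" by - (rule invertible_faithful[OF L], use z' f in simp_all)
  then show "zero_arrow C f" using z' by simp
qed (use L f in simp)

text \<open>\<open>f\<close> is \<open>h \<star> idn C M\<close> conjugated by
  \<open>\<rho>\<close>. By naturality, \<open>f \<star> idn C L\<close> and \<open>h\<close> agree
  after tensoring with \<open>M\<close>, and \<open>M\<close> is invertible too.\<close>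

lemma invertible_full:
  assumes L: "invertible C L" and A: "A \<in> Obj C" "B \<in> Obj C"
    and h: "h \<in> Arr C" "src C h = A \<odot> L" "tgt C h = B \<odot> L"
  obtains f where "f \<in> Arr C" "src C f = A" "tgt C f = B" "f \<star> idn C L = h"
proof -
  obtain M where M: "invertible C M" "isomorphic C (L \<odot> M) (munit C)"
    using invertible_dual[OF L] by blast
  obtain \<rho> where \<rho>: "\<forall>A \<in> Obj C. is_iso C (\<rho> A) \<and> src C (\<rho> A) = (A \<odot> L) \<odot> M \<and> tgt C (\<rho> A) = A"
    "\<forall>f \<in> Arr C. f \<bullet> \<rho> (src C f) = \<rho> (tgt C f) \<bullet> ((f \<star> idn C L) \<star> idn C M)"
    using untensor_ex[of L M] M L by auto
  have [simp]: "is_iso C (\<rho> A)" "src C (\<rho> A) = (A \<odot> L) \<odot> M" "tgt C (\<rho> A) = A" "\<rho> A \<in> Arr C"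
    "is_iso C (\<rho> B)" "src C (\<rho> B) = (B \<odot> L) \<odot> M" "tgt C (\<rho> B) = B" "\<rho> B \<in> Arr C"
    using \<rho>(1) A by simp_all
  note [simp] = A h invertible_Obj[OF L] invertible_Obj[OF M(1)]
  obtain r where r: "r \<in> Arr C" "src C r = A" "tgt C r = (A \<odot> L) \<odot> M" "r \<bullet> \<rho> A = idn C ((A \<odot> L) \<odot> M)"
    using isoE[of "\<rho> A"] unfolding \<open>src C (\<rho> A) = _\<close> \<open>tgt C (\<rho> A) = _\<close>
    using \<open>is_iso C (\<rho> A)\<close> by blast
  define f where "f = \<rho> B \<bullet> ((h \<star> idn C M) \<bullet> r)"
  have f [simp]: "f \<in> Arr C" "src C f = A" "tgt C f = B" unfolding f_def using r by simp_all
  have "f \<bullet> \<rho> A = \<rho> B \<bullet> (h \<star> idn C M)" unfolding f_def using r by simp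
  moreover have "f \<bullet> \<rho> A = \<rho> B \<bullet> ((f \<star> idn C L) \<star> idn C M)" using \<rho>(2)[rule_format, of f] by simp
  ultimately have "\<rho> B \<bullet> ((f \<star> idn C L) \<star> idn C M) = \<rho> B \<bullet> (h \<star> idn C M)" by simp
  then have "(f \<star> idn C L) \<star> idn C M = h \<star> idn C M"
    by - (rule monicD[OF iso_monic[of "\<rho> B"]], simp_all)
  then have "f \<star> idn C L = h"
    by - (rule invertible_faithful[OF M(1)], simp_all)
  then show ?thesis using that f by blast
qed

text \<open>The source of \<open>x\<close> is isomorphic to
  \<open>(src C x \<odot> M) \<odot> L\<close>, so fullness applies. Tests for monics and kernels
  after tensoring with \<open>L\<close> are thereby reduced to tests before it.\<close>

lemma invertible_cover:
  assumes L: "invertible C L" and A: "A \<in> Obj C" and X: "x \<in> Arr C" "tgt C x = A \<odot> L"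
  obtains f r where "f \<in> Arr C" "tgt C f = A" "is_iso C r" "tgt C r = src C x"
    "src C r = src C f \<odot> L" "x \<bullet> r = f \<star> idn C L"
proof -
  obtain M where M: "invertible C M" "isomorphic C (M \<odot> L) (munit C)"
    using invertible_dual[OF L] by blast
  obtain \<rho> where \<rho>: "\<forall>A \<in> Obj C. is_iso C (\<rho> A) \<and> src C (\<rho> A) = (A \<odot> M) \<odot> L \<and> tgt C (\<rho> A) = A"
    using untensor_ex[of M L] M L by auto
  define r where "r = \<rho> (src C x)"
  have r: "is_iso C r" "src C r = (src C x \<odot> M) \<odot> L" "tgt C r = src C x"
    unfolding r_def using \<rho> X by simp_all
  obtain f where "f \<in> Arr C" "src C f = src C x \<odot> M" "tgt C f = A" "f \<star> idn C L = x \<bullet> r"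
    using invertible_full[OF L _ A, of "src C x \<odot> M" "x \<bullet> r"] X r M by auto
  then show ?thesis using that[of f r] r by simp
qed

lemma invertible_monic:
  assumes L: "invertible C L" and m: "monic C m"
  shows "monic C (m \<star> idn C L)"
proof (rule monicI)
  note [simp] = invertible_Obj[OF L] monic_arr[OF m]
  show "m \<star> idn C L \<in> Arr C" by simp
  fix x assume x: "x \<in> Arr C" "tgt C x = src C (m \<star> idn C L)" "zero_arrow C ((m \<star> idn C L) \<bullet> x)"
  have xt: "tgt C x = src C m \<odot> L" and mO: "src C m \<in> Obj C" using x by simp_all
  obtain f r where f: "f \<in> Arr C" "tgt C f = src C m" "is_iso C r" "tgt C r = src C x"
    "src C r = src C f \<odot> L" "x \<bullet> r = f \<star> idn C L"
    using invertible_cover[OF L mO x(1) xt] by blast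
  have "zero_arrow C (((m \<star> idn C L) \<bullet> x) \<bullet> r)"
    by (rule zero_comp_right[OF x(3)]) (use x f in simp_all)
  then have "zero_arrow C ((m \<bullet> f) \<star> idn C L)" using x f by (simp add: interchange)
  then have "zero_arrow C (m \<bullet> f)" using zero_invertible_iff[OF L, of "m \<bullet> f"] f by simp
  then have "zero_arrow C f" using monic_zeroD[OF m, of f] f by simp
  then have "zero_arrow C (x \<bullet> r)" using f by simp
  then show "zero_arrow C x" using epic_zeroD[OF iso_epic[OF f(3)], of x] x f by simp
qed

lemma invertible_kernel:
  assumes L: "invertible C L" and k: "is_kernel C c k"
    and h: "h \<in> Arr C" "tgt C h = src C c \<odot> L" "zero_arrow C ((c \<star> idn C L) \<bullet> h)"
  obtains u where "u \<in> Arr C" "src C u = src C h" "tgt C u = src C k \<odot> L" "(k \<star> idn C L) \<bullet> u = h"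
proof -
  note [simp] = invertible_Obj[OF L] kernelD[OF k]
  have cO: "src C c \<in> Obj C" using kernelD(1)[OF k] by simp
  obtain f r where f: "f \<in> Arr C" "tgt C f = src C c" "is_iso C r" "tgt C r = src C h"
    "src C r = src C f \<odot> L" "h \<bullet> r = f \<star> idn C L"
    using invertible_cover[OF L cO h(1) h(2)] by blast
  have "zero_arrow C (((c \<star> idn C L) \<bullet> h) \<bullet> r)"
    by (rule zero_comp_right[OF h(3)]) (use h f in simp_all)
  then have "zero_arrow C ((c \<bullet> f) \<star> idn C L)" using h f by (simp add: interchange)
  then have "zero_arrow C (c \<bullet> f)" using zero_invertible_iff[OF L, of "c \<bullet> f"] f by simp
  then obtain u where u: "u \<in> Arr C" "src C u = src C f" "tgt C u = src C k" "k \<bullet> u = f"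
    using kernel_factor[OF k, of f] f by auto
  obtain s where s: "s \<in> Arr C" "src C s = tgt C r" "tgt C s = src C r" "r \<bullet> s = idn C (tgt C r)"
    using isoE[OF f(3)] by blast
  have "(k \<star> idn C L) \<bullet> ((u \<star> idn C L) \<bullet> s) = (f \<star> idn C L) \<bullet> s"
    using u s f by (simp add: interchange')
  also have "\<dots> = h" using f(6)[symmetric] s f(1-5) h by simp
  finally show ?thesis using that[of "(u \<star> idn C L) \<bullet> s"] u s f by simp
qed

end

section \<open>Annihilators and associated primes\<close>

context abelian_closed_category
begin

text \<open>The counterpart of two elements having product zero. \<open>perp (idn C Z) s\<close>
  says that \<open>s\<close> annihilates the object \<open>Z\<close>; the arrows \<open>s\<close>
  with \<open>perp \<pi> s\<close> form the annihilator of \<open>\<pi>\<close>, regarded as an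
  element of its target.\<close>

definition perp :: "'m \<Rightarrow> 'm \<Rightarrow> bool" where
  "perp f g \<longleftrightarrow> zero_arrow C (f \<star> g)"

lemma perp_sym: "f \<in> Arr C \<Longrightarrow> g \<in> Arr C \<Longrightarrow> perp f g \<longleftrightarrow> perp g f"
  unfolding perp_def by (rule zero_swp_iff)

lemma perp_comp_left:
  assumes "perp f g" "f \<in> Arr C" "g \<in> Arr C" "x \<in> Arr C" "src C x = tgt C f"
  shows "perp (x \<bullet> f) g"
proof -
  have "zero_arrow C ((x \<star> idn C (tgt C g)) \<bullet> (f \<star> g))"
    using assms by (intro zero_comp_left) (simp_all add: perp_def)
  then show ?thesis using assms by (simp add: interchange perp_def)
qed

lemma perp_comp_right:
  assumes "perp f g" "f \<in> Arr C" "g \<in> Arr C" "x \<in> Arr C" "tgt C x = src C f"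
  shows "perp (f \<bullet> x) g"
proof -
  have "zero_arrow C ((f \<star> g) \<bullet> (x \<star> idn C (src C g)))"
    using assms by (intro zero_comp_right) (simp_all add: perp_def)
  then show ?thesis using assms by (simp add: interchange perp_def)
qed

lemma perp_epic:
  assumes "epic C e" "perp (f \<bullet> e) g" "f \<in> Arr C" "g \<in> Arr C" "src C f = tgt C e"
  shows "perp f g"
proof -
  have "zero_arrow C ((f \<star> g) \<bullet> (e \<star> idn C (src C g)))"
    using assms by (simp add: interchange perp_def)
  then show ?thesis
    unfolding perp_def using assms epic_zeroD[OF epic_tensa_left[OF assms(1), of "src C g"], of "f \<star> g"]
    by simp
qed

text \<open>Tensoring with the invertible target of \<open>g\<close> keeps \<open>m\<close> monic.
  This is why elements of ideals are required to have invertible targets.\<close>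

lemma perp_monic:
  assumes "monic C m" "perp (m \<bullet> f) g" "f \<in> Arr C" "g \<in> Arr C" "src C m = tgt C f"
    "invertible C (tgt C g)"
  shows "perp f g"
proof -
  note [simp] = monic_arr[OF assms(1)]
  have "zero_arrow C ((m \<star> idn C (tgt C g)) \<bullet> (f \<star> g))"
    using assms by (simp add: interchange perp_def)
  then show ?thesis
    unfolding perp_def using assms monic_zeroD[OF invertible_monic[OF assms(6) assms(1)], of "f \<star> g"]
    by simp
qed

text \<open>Symmetry and associator bring \<open>f\<close> next to \<open>g\<close>, so that the
  factor \<open>h\<close> can be split off when annihilation by \<open>g\<close> is
  examined.\<close>

lemma zero_rotate_iff:
  assumes "f \<in> Arr C" "g \<in> Arr C" "h \<in> Arr C"
  shows "perp (f \<star> h) g \<longleftrightarrow> zero_arrow C ((g \<star> f) \<star> h)"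
  using assms zero_swp_iff[of "f \<star> h" g] zero_asc_iff[of g f h] by (simp add: perp_def)

lemma perp_tensa:
  assumes "perp f g" "f \<in> Arr C" "g \<in> Arr C" "h \<in> Arr C"
  shows "perp (f \<star> h) g"
  using assms perp_sym[of f g] zero_rotate_iff[of f g h] by (simp add: perp_def)

lemma perp_invertible_iff:
  assumes "invertible C L" "f \<in> Arr C" "g \<in> Arr C"
  shows "perp (f \<star> idn C L) g \<longleftrightarrow> perp f g"
  using assms perp_sym[of f g] zero_rotate_iff[of f g "idn C L"] zero_invertible_iff[of L "g \<star> f"]
  by (simp add: perp_def)

text \<open>Endomorphisms of an invertible object are multiplications by scalars \<open>I \<rightarrow> I\<close>.\<close>

lemma scalar_ex:
  assumes P: "invertible C P" and \<theta>: "\<theta> \<in> Arr C" "src C \<theta> = P" "tgt C \<theta> = P"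
    and x: "x \<in> Arr C" "src C x = P"
  obtains \<theta>' where "\<theta>' \<in> Arr C" "src C \<theta>' = tgt C x" "x \<bullet> \<theta> = \<theta>' \<bullet> x"
proof -
  note [simp] = \<theta> x invertible_Obj[OF P]
  have lunE: "\<exists>l. l \<in> Arr C \<and> src C l = A \<and> tgt C l = munit C \<odot> A \<and> l \<bullet> lun C A = idn C (munit C \<odot> A)"
    if A: "A \<in> Obj C" for A
  proof -
    obtain l where "l \<in> Arr C" "src C l = tgt C (lun C A)" "tgt C l = src C (lun C A)"
      "l \<bullet> lun C A = idn C (src C (lun C A))"
      using isoE[OF lun_iso[OF A]] by blast
    then show ?thesis using A by auto
  qed
  obtain l where l [simp]: "l \<in> Arr C" "src C l = P" "tgt C l = munit C \<odot> P"
    and ll: "l \<bullet> lun C P = idn C (munit C \<odot> P)" using lunE[of P] by auto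
  obtain w where w [simp]: "w \<in> Arr C" "src C w = tgt C x" "tgt C w = munit C \<odot> tgt C x"
    and ww: "w \<bullet> lun C (tgt C x) = idn C (munit C \<odot> tgt C x)" using lunE[of "tgt C x"] by auto
  \<comment> \<open>Conjugating \<open>\<theta>\<close> by the unit isomorphism gives an
    endomorphism of \<open>munit C \<odot> P\<close>; fullness of tensoring with \<open>P\<close>
    makes it a scalar \<open>c\<close>.\<close>
  obtain c where c [simp]: "c \<in> Arr C" "src C c = munit C" "tgt C c = munit C"
    and cl: "c \<star> idn C P = l \<bullet> (\<theta> \<bullet> lun C P)"
    using invertible_full[OF P, of "munit C" "munit C" "l \<bullet> (\<theta> \<bullet> lun C P)"] by auto
  have lcl: "lun C P \<bullet> (c \<star> idn C P) = \<theta> \<bullet> lun C P"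
  proof -
    have "is_iso C (lun C P)" by (rule lun_iso) simp
    then have "lun C P \<bullet> l = idn C P"
    proof (rule isoE)
      fix g assume g: "g \<in> Arr C" "src C g = tgt C (lun C P)" "tgt C g = src C (lun C P)"
        "g \<bullet> lun C P = idn C (src C (lun C P))" "lun C P \<bullet> g = idn C (tgt C (lun C P))"
      have "l = l \<bullet> (lun C P \<bullet> g)" using g by simp
      also have "\<dots> = (l \<bullet> lun C P) \<bullet> g" using g(1-3) by simp
      also have "\<dots> = g" unfolding ll using g(1-3) by simp
      finally show ?thesis using g(5) by simp
    qed
    then show ?thesis unfolding cl using comp_assoc'[of "\<theta> \<bullet> lun C P" l "lun C P"] by simp
  qed
  \<comment> \<open>Multiplication by the same scalar \<open>c\<close>, now on the target of
    \<open>x\<close>. It commutes past \<open>x\<close> because the two act on different tensor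
    factors.\<close>
  define \<theta>' where "\<theta>' = lun C (tgt C x) \<bullet> ((c \<star> idn C (tgt C x)) \<bullet> w)"
  have nat: "lun C (tgt C x) \<bullet> (idn C (munit C) \<star> x) = x \<bullet> lun C P"
    by (rule lun_natural) (simp add: homs_iff)
  have "(x \<bullet> \<theta>) \<bullet> lun C P = x \<bullet> (lun C P \<bullet> (c \<star> idn C P))" using lcl by simp
  also have "\<dots> = (lun C (tgt C x) \<bullet> (idn C (munit C) \<star> x)) \<bullet> (c \<star> idn C P)" unfolding nat by simp
  also have "\<dots> = lun C (tgt C x) \<bullet> ((c \<star> idn C (tgt C x)) \<bullet> (idn C (munit C) \<star> x))"
    by (simp add: interchange)
  also have "\<dots> = \<theta>' \<bullet> (lun C (tgt C x) \<bullet> (idn C (munit C) \<star> x))"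
    unfolding \<theta>'_def using comp_assoc'[of "idn C (munit C) \<star> x" "lun C (tgt C x)" w] ww by simp
  also have "\<dots> = (\<theta>' \<bullet> x) \<bullet> lun C P" unfolding nat \<theta>'_def by simp
  finally have "(x \<bullet> \<theta>) \<bullet> lun C P = (\<theta>' \<bullet> x) \<bullet> lun C P" .
  then have "x \<bullet> \<theta> = \<theta>' \<bullet> x"
    by - (rule epicD[OF iso_epic[OF lun_iso[of P]]], simp_all add: \<theta>'_def)
  then show ?thesis using that[of \<theta>'] by (simp add: \<theta>'_def)
qed

text \<open>For modules this says that an element of the annihilator of \<open>x\<close> annihilates the cyclic
  submodule generated by \<open>x\<close>.  It holds because the symmetry of \<open>L \<odot> L\<close> is a scalar.\<close>

lemma perp_of_zero_comp:
  assumes L: "invertible C L" and e: "e \<in> Arr C" "src C e = L" and k: "k \<in> Arr C" "tgt C k = L"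
    and ek: "zero_arrow C (e \<bullet> k)"
  shows "perp e k"
proof -
  note [simp] = e k invertible_Obj[OF L]
  \<comment> \<open>Swapping the two copies of \<open>L\<close> is an endomorphism of the invertible
    object \<open>L \<odot> L\<close>, so it can be moved to the other side of
    \<open>e \<star> idn C L\<close>.\<close>
  obtain \<theta> where \<theta> [simp]: "\<theta> \<in> Arr C" "src C \<theta> = tgt C e \<odot> L" and
    c: "(e \<star> idn C L) \<bullet> swp C L L = \<theta> \<bullet> (e \<star> idn C L)"
    using scalar_ex[OF invertible_tens[OF L L], of "swp C L L" "e \<star> idn C L"] by auto
  \<comment> \<open>After the swap, \<open>k\<close> acts on the same factor as \<open>e\<close>,
    where the composite is zero.\<close>
  have "(e \<star> k) \<bullet> swp C (src C k) L = (e \<star> idn C L) \<bullet> ((idn C L \<star> k) \<bullet> swp C (src C k) L)"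
    by (simp add: interchange')
  also have "\<dots> = ((e \<star> idn C L) \<bullet> swp C L L) \<bullet> (k \<star> idn C L)"
    using swp_nat[of k "idn C L"] by simp
  also have "\<dots> = \<theta> \<bullet> ((e \<bullet> k) \<star> idn C L)" unfolding c by (simp add: interchange)
  finally have "zero_arrow C ((e \<star> k) \<bullet> swp C (src C k) L)" using ek by simp
  then show ?thesis unfolding perp_def
    by - (rule epic_zeroD[OF iso_epic[OF swp_iso[of "src C k" L]]], simp_all)
qed

text \<open>Tensoring with the inverse \<open>M\<close> moves \<open>L\<close> from the source of
  \<open>h\<close> to its target. An arrow on \<open>A \<odot> L\<close> can then compete with
  arrows on \<open>A\<close> for a maximal kernel.\<close>

lemma untwist:
  assumes L: "invertible C L" and A: "A \<in> Obj C" and h: "h \<in> Arr C" "src C h = A \<odot> L"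
  obtains M p where "invertible C M" "p \<in> Arr C" "src C p = A" "tgt C p = tgt C h \<odot> M"
    "\<And>x. x \<in> Arr C \<Longrightarrow> tgt C x = A \<Longrightarrow> zero_arrow C (p \<bullet> x) \<longleftrightarrow> zero_arrow C (h \<bullet> (x \<star> idn C L))"
    "\<And>t. t \<in> Arr C \<Longrightarrow> perp h t \<Longrightarrow> perp p t"
proof -
  obtain M where M: "invertible C M" "isomorphic C (L \<odot> M) (munit C)"
    using invertible_dual[OF L] by blast
  obtain \<rho> where \<rho>: "\<forall>A \<in> Obj C. is_iso C (\<rho> A) \<and> src C (\<rho> A) = (A \<odot> L) \<odot> M \<and> tgt C (\<rho> A) = A"
    "\<forall>f \<in> Arr C. f \<bullet> \<rho> (src C f) = \<rho> (tgt C f) \<bullet> ((f \<star> idn C L) \<star> idn C M)"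
    using untensor_ex[of L M] M L by auto
  note [simp] = A h invertible_Obj[OF L] invertible_Obj[OF M(1)]
  have \<rho>A [simp]: "\<rho> A \<in> Arr C" "src C (\<rho> A) = (A \<odot> L) \<odot> M" "tgt C (\<rho> A) = A" and i: "is_iso C (\<rho> A)"
    using \<rho>(1) A by simp_all
  obtain r where r [simp]: "r \<in> Arr C" "src C r = A" "tgt C r = (A \<odot> L) \<odot> M"
    and r\<rho>: "r \<bullet> \<rho> A = idn C ((A \<odot> L) \<odot> M)"
    using isoE[OF i] unfolding \<rho>A by blast
  define p where "p = (h \<star> idn C M) \<bullet> r"
  have "zero_arrow C (p \<bullet> x) \<longleftrightarrow> zero_arrow C (h \<bullet> (x \<star> idn C L))" if [simp]: "x \<in> Arr C" "tgt C x = A" for x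
  proof -
    let ?X = "src C x"
    have \<rho>X [simp]: "\<rho> ?X \<in> Arr C" "src C (\<rho> ?X) = (?X \<odot> L) \<odot> M" "tgt C (\<rho> ?X) = ?X" and iX: "is_iso C (\<rho> ?X)"
      using \<rho>(1) by simp_all
    have "(p \<bullet> x) \<bullet> \<rho> ?X = (h \<star> idn C M) \<bullet> (r \<bullet> (\<rho> A \<bullet> ((x \<star> idn C L) \<star> idn C M)))"
      unfolding p_def using \<rho>(2)[rule_format, of x] by simp
    also have "\<dots> = (h \<star> idn C M) \<bullet> ((x \<star> idn C L) \<star> idn C M)"
      using comp_assoc'[of "(x \<star> idn C L) \<star> idn C M" "\<rho> A" r] r\<rho> by simp
    also have "\<dots> = (h \<bullet> (x \<star> idn C L)) \<star> idn C M" by (simp add: interchange)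
    finally have eq: "(p \<bullet> x) \<bullet> \<rho> ?X = (h \<bullet> (x \<star> idn C L)) \<star> idn C M" .
    have "zero_arrow C (p \<bullet> x) \<longleftrightarrow> zero_arrow C ((p \<bullet> x) \<bullet> \<rho> ?X)"
      using epic_zeroD[OF iso_epic[OF iX], of "p \<bullet> x"] zero_comp_right[of "p \<bullet> x" "\<rho> ?X"]
      by (auto simp: p_def)
    then show ?thesis unfolding eq by (simp add: zero_invertible_iff[OF M(1)])
  qed
  moreover have "perp p t" if "t \<in> Arr C" "perp h t" for t
    unfolding p_def using that by (intro perp_comp_right perp_tensa) simp_all
  ultimately show ?thesis using that[of M p] M by (simp add: p_def)
qed

text \<open>Twists are iterated, so that new invertible factors can be appended without
  rebracketing.\<close>

inductive_set twists :: "'o \<Rightarrow> 'o set" for Y where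
  "Y \<in> twists Y"
| "W \<in> twists Y \<Longrightarrow> invertible C L \<Longrightarrow> W \<odot> L \<in> twists Y"

lemma twists_Obj: "W \<in> twists Y \<Longrightarrow> Y \<in> Obj C \<Longrightarrow> W \<in> Obj C"
  by (induction rule: twists.induct) simp_all

lemma twists_perp:
  assumes "W \<in> twists Y" "Y \<in> Obj C" "s \<in> Arr C" "perp (idn C Y) s"
  shows "perp (idn C W) s"
  using assms
proof (induction rule: twists.induct)
  case (2 W L)
  then have "perp (idn C W \<star> idn C L) s"
    by (intro perp_tensa) (simp_all add: twists_Obj)
  then show ?case using 2 by (simp add: twists_Obj)
qed

text \<open>The outermost twist \<open>E\<close> is removed by tensoring with its inverse
  \<open>E'\<close>, which is absorbed into the invertible factor of the source.\<close>

lemma twists_arrow: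
  assumes "W \<in> twists Y" "Y \<in> Obj C" "M \<in> Obj C" "invertible C L"
    "\<phi> \<in> Arr C" "src C \<phi> = M \<odot> L" "tgt C \<phi> = W" "\<not> zero_arrow C \<phi>"
  shows "\<exists>L' \<phi>'. invertible C L' \<and> \<phi>' \<in> Arr C \<and> src C \<phi>' = M \<odot> L' \<and> tgt C \<phi>' = Y \<and> \<not> zero_arrow C \<phi>'"
  using assms
proof (induction arbitrary: L \<phi> rule: twists.induct)
  case 1
  then show ?case by blast
next
  case (2 W E)
  have W [simp]: "W \<in> Obj C" using 2 by (simp add: twists_Obj)
  obtain E' where E': "invertible C E'" "isomorphic C (E \<odot> E') (munit C)"
    using invertible_dual[OF \<open>invertible C E\<close>] by blast
  note [simp] = invertible_Obj[OF E'(1)] invertible_Obj[OF \<open>invertible C E\<close>]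
    invertible_Obj[OF \<open>invertible C L\<close>] \<open>M \<in> Obj C\<close> \<open>\<phi> \<in> Arr C\<close> \<open>src C \<phi> = _\<close> \<open>tgt C \<phi> = _\<close>
  obtain \<rho> where \<rho>: "\<forall>A \<in> Obj C. is_iso C (\<rho> A) \<and> src C (\<rho> A) = (A \<odot> E) \<odot> E' \<and> tgt C (\<rho> A) = A"
    using untensor_ex[of E E'] E' by auto
  have \<rho>W [simp]: "\<rho> W \<in> Arr C" "src C (\<rho> W) = (W \<odot> E) \<odot> E'" "tgt C (\<rho> W) = W" and i: "is_iso C (\<rho> W)"
    using \<rho> W by simp_all
  have "is_iso C (asc C M L E')" by (simp add: asc_iso)
  then obtain a where ia: "is_iso C a" and "src C a = tgt C (asc C M L E')" "tgt C a = src C (asc C M L E')"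
    using isoE by blast
  then have a [simp]: "a \<in> Arr C" "src C a = M \<odot> (L \<odot> E')" "tgt C a = (M \<odot> L) \<odot> E'" by simp_all
  define \<phi>' where "\<phi>' = \<rho> W \<bullet> ((\<phi> \<star> idn C E') \<bullet> a)"
  have "\<not> zero_arrow C \<phi>'"
  proof
    assume "zero_arrow C \<phi>'"
    then have "zero_arrow C ((\<phi> \<star> idn C E') \<bullet> a)"
      unfolding \<phi>'_def by - (rule monic_zeroD[OF iso_monic[OF i]], simp_all)
    then have "zero_arrow C (\<phi> \<star> idn C E')"
      by - (rule epic_zeroD[OF iso_epic[OF ia]], simp_all)
    then show False using 2 zero_invertible_iff[OF E'(1), of \<phi>] by simp
  qed
  then show ?case
    using "2.IH"[of "L \<odot> E'" \<phi>'] \<open>Y \<in> Obj C\<close> invertible_tens[OF \<open>invertible C L\<close> E'(1)]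
    by (simp add: \<phi>'_def)
qed

end

section \<open>Primes in the annihilator calculus, and arrows into subobjects\<close>

locale invertibly_generated_category = abelian_closed_category +
  assumes invertible_arrow_ex: "J \<in> Obj C \<Longrightarrow> \<not> zero_arrow C (idn C J) \<Longrightarrow>
    \<exists>L g. invertible C L \<and> g \<in> Arr C \<and> src C g = L \<and> tgt C g = J \<and> \<not> zero_arrow C g"
begin

text \<open>The annihilator of the arrow found here plays the role of an associated prime of \<open>Y\<close>:
  among the nonzero arrows from a quotient of an invertible object to twists of \<open>Y\<close>, one with
  maximal kernel is chosen.\<close>

lemma prime_arrow_ex:
  assumes Y: "noetherian C Y" "\<not> zero_arrow C (idn C Y)"
  obtains L \<pi> where "invertible C L" "\<pi> \<in> Arr C" "src C \<pi> = L" "tgt C \<pi> \<in> twists Y"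
    "\<not> zero_arrow C \<pi>"
    "\<And>s t. s \<in> Arr C \<Longrightarrow> t \<in> Arr C \<Longrightarrow> invertible C (tgt C s) \<Longrightarrow> invertible C (tgt C t) \<Longrightarrow>
      perp \<pi> (s \<star> t) \<Longrightarrow> perp \<pi> s \<or> perp \<pi> t"
proof -
  have YO [simp]: "Y \<in> Obj C" using Y(1) by (rule noetherian_Obj)
  obtain L0 g0 where L0: "invertible C L0" and g0: "g0 \<in> Arr C" "src C g0 = L0" "tgt C g0 = Y"
    "\<not> zero_arrow C g0"
    using invertible_arrow_ex[OF YO Y(2)] by blast
  \<comment> \<open>The image \<open>Y0\<close> of \<open>g0\<close> plays the role of a cyclic
    submodule. Kernels are compared inside it, because it is noetherian as a subobject of
    \<open>Y\<close>.\<close>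
  obtain e j0 where e: "epic C e" and j0: "monic C j0"
    and ej: "src C e = src C g0" "tgt C j0 = tgt C g0" "src C j0 = tgt C e" "j0 \<bullet> e = g0"
    using factorization[OF g0(1)] by blast
  define Y0 where "Y0 = tgt C e"
  note [simp] = invertible_Obj[OF L0]
  have [simp]: "e \<in> Arr C" "src C e = L0" "tgt C e = Y0" "j0 \<in> Arr C" "src C j0 = Y0" "tgt C j0 = Y"
    using e j0 ej g0 by (simp_all add: Y0_def)
  have Y0: "noetherian C Y0" using noetherian_sub[OF j0] Y by simp
  then have [simp]: "Y0 \<in> Obj C" by (rule noetherian_Obj)
  define S where "S = {k. \<exists>p \<in> Arr C. src C p = Y0 \<and> tgt C p \<in> twists Y \<and> \<not> zero_arrow C p \<and> is_kernel C p k}"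
  have "\<not> zero_arrow C j0"
  proof
    assume "zero_arrow C j0"
    then have "zero_arrow C (j0 \<bullet> e)" by simp
    then show False using g0(4) unfolding ej(4) by simp
  qed
  moreover obtain k0 where "is_kernel C j0 k0" using has_kernels[of j0] by auto
  ultimately have "k0 \<in> S"
    unfolding S_def by (intro CollectI bexI[of _ j0]) (simp_all add: twists.intros(1))
  moreover have "monic C k \<and> tgt C k = Y0" if "k \<in> S" for k
    using that kernel_monic kernelD(3) unfolding S_def by blast
  ultimately obtain k where kS: "k \<in> S" and kmax: "\<And>n. n \<in> S \<Longrightarrow> sub_le C k n \<Longrightarrow> sub_le C n k"
    using noetherian_maximal[OF Y0, of S] by blast
  obtain p where p: "p \<in> Arr C" "src C p = Y0" "tgt C p \<in> twists Y" "\<not> zero_arrow C p" "is_kernel C p k"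
    using kS unfolding S_def by blast
  note [simp] = p(1,2)
  define \<pi> where "\<pi> = p \<bullet> e"
  define W where "W = tgt C p"
  have W: "W \<in> twists Y" and WO [simp]: "W \<in> Obj C" using p by (simp_all add: W_def)
  have \<pi> [simp]: "\<pi> \<in> Arr C" "src C \<pi> = L0" "tgt C \<pi> = W" by (simp_all add: \<pi>_def W_def)
  have \<pi>0: "\<not> zero_arrow C \<pi>" using epic_zeroD[OF e, of p] p(4) by (auto simp: \<pi>_def)
  obtain d1 m1 where d1: "epic C d1" and m1: "monic C m1"
    and dm: "src C d1 = src C p" "tgt C m1 = tgt C p" "src C m1 = tgt C d1" "m1 \<bullet> d1 = p"
    using factorization[OF p(1)] by blast
  have [simp]: "d1 \<in> Arr C" "src C d1 = Y0" "m1 \<in> Arr C" "tgt C m1 = W" "src C m1 = tgt C d1"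
    using d1 m1 dm by (simp_all add: W_def)
  have kd1: "is_kernel C d1 k" using kernel_comp_monic[OF m1, of d1 k] p(5) dm(4) by simp
  \<comment> \<open>As for modules: if \<open>s x\<close> is nonzero, its annihilator contains that
    of \<open>x\<close> and equals it by maximality, so whatever kills \<open>s x\<close> kills
    \<open>x\<close>. Here \<open>s x\<close> is \<open>\<pi> \<star> s\<close>.\<close>
  have "perp \<pi> t" if s: "s \<in> Arr C" "invertible C (tgt C s)" and t: "t \<in> Arr C" "invertible C (tgt C t)"
    and st: "perp \<pi> (s \<star> t)" and ns: "\<not> perp \<pi> s" for s t
  proof -
    note [simp] = s t
    have pst: "perp (\<pi> \<star> s) t" using st zero_asc_iff[of \<pi> s t] by (simp add: perp_def)
    have nz: "\<not> zero_arrow C (\<pi> \<star> s)" using ns by (simp add: perp_def)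
    obtain d m where d: "epic C d" and m: "monic C m" and dm':
      "src C d = src C (\<pi> \<star> s)" "tgt C m = tgt C (\<pi> \<star> s)" "src C m = tgt C d" "m \<bullet> d = \<pi> \<star> s"
      using factorization[of "\<pi> \<star> s"] by auto
    have [simp]: "d \<in> Arr C" "m \<in> Arr C" "tgt C m = W \<odot> tgt C s" "src C m = tgt C d"
      using d m dm' by simp_all
    have "\<not> zero_arrow C (idn C (tgt C d))"
    proof
      assume "zero_arrow C (idn C (tgt C d))"
      then have "zero_arrow C d" by (rule zero_idn_arrow) simp_all
      then have "zero_arrow C (m \<bullet> d)" by simp
      then show False using nz unfolding dm'(4) by simp
    qed
    then obtain L2 g where L2: "invertible C L2" and g [simp]: "g \<in> Arr C" "src C g = L2" "tgt C g = tgt C d"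
      and g0: "\<not> zero_arrow C g"
      using invertible_arrow_ex[of "tgt C d"] by auto
    note [simp] = invertible_Obj[OF L2]
    \<comment> \<open>The source of \<open>\<pi> \<star> s\<close> need not be invertible, so
      \<open>\<pi> \<star> s\<close> is replaced by a nonzero arrow \<open>f\<close> from an
      invertible object into its image. Whatever annihilates \<open>\<pi> \<star> s\<close>
      annihilates \<open>f\<close>.\<close>
    define f where "f = m \<bullet> g"
    have f [simp]: "f \<in> Arr C" "src C f = L2" "tgt C f = W \<odot> tgt C s" by (simp_all add: f_def)
    have f0: "\<not> zero_arrow C f" using monic_zeroD[OF m, of g] g0 by (auto simp: f_def)
    have perp_f: "perp f x" if "perp (\<pi> \<star> s) x" "x \<in> Arr C" for x
    proof -
      have "perp m x" by (rule perp_epic[OF d]) (use that dm' in simp_all)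
      then show ?thesis unfolding f_def by (rule perp_comp_right) (use that in simp_all)
    qed
    obtain c where c: "is_kernel C \<pi> c" using has_kernels[of \<pi>] by auto
    have [simp]: "c \<in> Arr C" "tgt C c = L0" "zero_arrow C (\<pi> \<bullet> c)" using kernelD[OF c] by simp_all
    \<comment> \<open>The kernel \<open>c\<close> of \<open>\<pi>\<close> lies in the annihilator of
      \<open>\<pi>\<close>, hence of \<open>f\<close>. So \<open>f \<star> idn C L0\<close> factors
      through the tensor product of \<open>L2\<close> with the image of
      \<open>\<pi>\<close>.\<close>
    have "perp \<pi> c" by (rule perp_of_zero_comp[OF L0]) simp_all
    then have "perp f c" by (intro perp_f perp_tensa) simp_all
    then have fc: "zero_arrow C ((f \<star> idn C L0) \<bullet> (idn C L2 \<star> c))" by (simp add: perp_def interchange)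
    have de: "epic C (d1 \<bullet> e)" using epic_comp[OF d1 e] by simp
    have "m1 \<bullet> (d1 \<bullet> e) = \<pi>" using comp_assoc'[of e d1 m1] dm(4) by (simp add: \<pi>_def)
    then have "is_kernel C (d1 \<bullet> e) c" using kernel_comp_monic[OF m1, of "d1 \<bullet> e" c] c by simp
    then have cc: "is_cokernel C c (d1 \<bullet> e)" by (rule epic_cokernel_of_kernel[OF de])
    obtain v where v [simp]: "v \<in> Arr C" "src C v = L2 \<odot> tgt C d1" "tgt C v = (W \<odot> tgt C s) \<odot> L0"
      and vde: "v \<bullet> (idn C L2 \<star> (d1 \<bullet> e)) = f \<star> idn C L0"
      using cokernel_tensa_right[OF cc, of L2 "f \<star> idn C L0"] fc by auto
    define h where "h = v \<bullet> swp C (tgt C d1) L2"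
    have h [simp]: "h \<in> Arr C" "src C h = tgt C d1 \<odot> L2" "tgt C h = (W \<odot> tgt C s) \<odot> L0"
      by (simp_all add: h_def)
    have h0: "\<not> zero_arrow C h"
    proof
      assume "zero_arrow C h"
      then have "zero_arrow C v"
        using epic_zeroD[OF iso_epic[OF swp_iso[of "tgt C d1" L2]], of v] by (simp add: h_def)
      then have "zero_arrow C (f \<star> idn C L0)" unfolding vde[symmetric] by simp
      then show False using f0 zero_invertible_iff[OF L0, of f] by simp
    qed
    have dO: "tgt C d1 \<in> Obj C" by simp
    obtain M p1 where M: "invertible C M" and p1 [simp]: "p1 \<in> Arr C" "src C p1 = tgt C d1" "tgt C p1 = tgt C h \<odot> M"
      and p1z: "\<And>x. x \<in> Arr C \<Longrightarrow> tgt C x = tgt C d1 \<Longrightarrow>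
        zero_arrow C (p1 \<bullet> x) \<longleftrightarrow> zero_arrow C (h \<bullet> (x \<star> idn C L2))"
      and p1t: "\<And>t. t \<in> Arr C \<Longrightarrow> perp h t \<Longrightarrow> perp p1 t"
      using untwist[OF L2 dO h(1,2)] by blast
    have p1n: "\<not> zero_arrow C p1" using p1z[of "idn C (tgt C d1)"] h0 by simp
    \<comment> \<open>A competitor to \<open>p\<close>: it is nonzero, lands in a twist of
      \<open>Y\<close>, and kills \<open>k\<close> because it factors through \<open>d1\<close>.
      Maximality makes its kernel equivalent to \<open>k\<close>.\<close>
    define p' where "p' = p1 \<bullet> d1"
    have p' [simp]: "p' \<in> Arr C" "src C p' = Y0" "tgt C p' = tgt C h \<odot> M" by (simp_all add: p'_def)
    have "tgt C p' \<in> twists Y" using W s L0 M by (simp add: twists.intros)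
    moreover have "\<not> zero_arrow C p'" using epic_zeroD[OF d1, of p1] p1n by (auto simp: p'_def)
    moreover obtain k2 where k2: "is_kernel C p' k2" using has_kernels[of p'] by auto
    ultimately have "k2 \<in> S" unfolding S_def using p' by blast
    have [simp]: "k2 \<in> Arr C" "tgt C k2 = Y0" using kernelD[OF k2] by simp_all
    have [simp]: "k \<in> Arr C" "tgt C k = Y0" "zero_arrow C (d1 \<bullet> k)" using kernelD[OF kd1] by simp_all
    have "zero_arrow C (p' \<bullet> k)" by (simp add: p'_def)
    then have "sub_le C k k2" using kernel_sub_le_iff[OF k2, of k] by simp
    then have "sub_le C k2 k" using kmax \<open>k2 \<in> S\<close> by blast
    then have dk2: "zero_arrow C (d1 \<bullet> k2)" using kernel_sub_le_iff[OF kd1, of k2] by simp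
    have "perp f t" by (rule perp_f[OF pst]) simp
    then have "perp (f \<star> idn C L0) t" by (intro perp_tensa) simp_all
    then have "perp (v \<bullet> (idn C L2 \<star> (d1 \<bullet> e))) t" unfolding vde .
    then have "perp v t" by - (rule perp_epic[OF epic_tensa_right[OF de, of L2]], simp_all)
    then have "perp h t" unfolding h_def by (intro perp_comp_right) simp_all
    then have "perp p1 t" by (intro p1t) simp_all
    then have pt: "perp p' t" unfolding p'_def by (intro perp_comp_right) simp_all
    \<comment> \<open>Equivalence of the kernels lets \<open>d1\<close> factor through the epic part
      \<open>d2\<close> of \<open>p'\<close>. So \<open>t\<close>, which annihilates
      \<open>p'\<close>, annihilates \<open>d1\<close>, then \<open>p\<close> and
      \<open>\<pi>\<close>.\<close>
    obtain d2 m2 where d2: "epic C d2" and m2: "monic C m2"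
      and dm2: "src C d2 = src C p'" "tgt C m2 = tgt C p'" "src C m2 = tgt C d2" "m2 \<bullet> d2 = p'"
      using factorization[OF p'(1)] by blast
    have [simp]: "d2 \<in> Arr C" "src C d2 = Y0" "m2 \<in> Arr C" "src C m2 = tgt C d2" using d2 m2 dm2 by simp_all
    have "is_kernel C d2 k2" using kernel_comp_monic[OF m2, of d2 k2] k2 dm2(4) by simp
    then have "is_cokernel C k2 d2" by (rule epic_cokernel_of_kernel[OF d2])
    then obtain u where u: "u \<in> Arr C" "src C u = tgt C d2" "tgt C u = tgt C d1" "u \<bullet> d2 = d1"
      using cokernel_factor[of k2 d2 d1] dk2 by auto
    have "perp d2 t" by (rule perp_monic[OF m2]) (use pt dm2(4) in simp_all)
    then have "perp (u \<bullet> d2) t" using u(1-3) by (intro perp_comp_left) simp_all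
    then have "perp (m1 \<bullet> d1) t" unfolding u(4) by (intro perp_comp_left) simp_all
    then show "perp \<pi> t" unfolding dm(4) \<pi>_def by (intro perp_comp_right) simp_all
  qed
  then show ?thesis using that[of L0 \<pi>] L0 \<pi> \<pi>0 W by metis
qed

lemma zero_sub_ex:
  assumes "A \<in> Obj C" "zero_object C Z"
  obtains k where "monic C k" "src C k = Z" "tgt C k = A" "zero_arrow C k" "is_cokernel C k (idn C A)"
proof -
  have [simp]: "Z \<in> Obj C" "A \<in> Obj C" using assms zero_object_Obj by auto
  obtain k where k: "zero_arrow C k" "src C k = Z" "tgt C k = A" using zero_ex[of Z A] by auto
  have "monic C k"
    by (rule monicI) (use k zero_object_arrow[OF assms(2)] in simp_all)
  moreover have "is_cokernel C k (idn C A)"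
    by (rule cokernelI) (use k epic_idn in auto)
  ultimately show ?thesis using that k by blast
qed

lemma invertible_arrow_to_subobject:
  assumes M: "noetherian C M" and i: "monic C i" "tgt C i = M"
    and Y: "\<not> zero_arrow C (idn C (src C i))"
  obtains L \<phi> where "invertible C L" "\<phi> \<in> Arr C" "src C \<phi> = M \<odot> L" "tgt C \<phi> = src C i"
    "\<not> zero_arrow C \<phi>"
proof -
  define Y where "Y = src C i"
  have MO [simp]: "M \<in> Obj C" using M by (rule noetherian_Obj)
  have [simp]: "i \<in> Arr C" "src C i = Y" "tgt C i = M" "Y \<in> Obj C" using i by (auto simp: Y_def)
  have "noetherian C Y" using noetherian_sub[OF i(1)] M by simp
  moreover have "\<not> zero_arrow C (idn C Y)" using Y by simp
  ultimately obtain L \<pi> where L: "invertible C L" and \<pi> [simp]: "\<pi> \<in> Arr C" "src C \<pi> = L"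
    and W: "tgt C \<pi> \<in> twists Y" and \<pi>0: "\<not> zero_arrow C \<pi>"
    and prime: "\<And>s t. s \<in> Arr C \<Longrightarrow> t \<in> Arr C \<Longrightarrow> invertible C (tgt C s) \<Longrightarrow> invertible C (tgt C t) \<Longrightarrow>
      perp \<pi> (s \<star> t) \<Longrightarrow> perp \<pi> s \<or> perp \<pi> t"
    using prime_arrow_ex by blast
  note [simp] = invertible_Obj[OF L]
  \<comment> \<open>For a finitely generated module this is the vanishing of its localization at the
    prime, which here is the annihilator of \<open>\<pi>\<close>.\<close>
  define bad where "bad Z \<longleftrightarrow> (\<exists>s \<in> Arr C. invertible C (tgt C s) \<and> \<not> perp \<pi> s \<and> perp (idn C Z) s)" for Z
  \<comment> \<open>An arrow annihilating \<open>M\<close> annihilates the subobject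
    \<open>Y\<close>, its twists, and hence \<open>\<pi>\<close>, whose target is such a
    twist.\<close>
  have M_bad: "\<not> bad M"
  proof
    assume "bad M"
    then obtain s where s [simp]: "s \<in> Arr C" "invertible C (tgt C s)" and ns: "\<not> perp \<pi> s"
      and Ms: "perp (idn C M) s" unfolding bad_def by blast
    have "perp (idn C M \<bullet> i) s" using Ms by (intro perp_comp_right) simp_all
    then have "perp (i \<bullet> idn C Y) s" by simp
    then have "perp (idn C Y) s" by - (rule perp_monic[OF i(1)], simp_all)
    then have "perp (idn C (tgt C \<pi>)) s" by (intro twists_perp[OF W]) simp_all
    then have "perp (idn C (tgt C \<pi>) \<bullet> \<pi>) s" by (intro perp_comp_right) simp_all
    then show False using ns by simp
  qed
  obtain Z where Z: "zero_object C Z" using zero_object_ex by blast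
  \<comment> \<open>For a maximal \<open>k\<close> the quotient \<open>M1\<close> is not
    \<open>bad\<close>, although each of its proper quotients is: the substitute for the residue
    field.\<close>
  define S where "S = {k. monic C k \<and> tgt C k = M \<and> (\<exists>q. is_cokernel C k q \<and> \<not> bad (tgt C q))}"
  obtain k0 where "monic C k0" "tgt C k0 = M" "is_cokernel C k0 (idn C M)"
    using zero_sub_ex[OF MO Z] by blast
  then have "k0 \<in> S" unfolding S_def using M_bad by auto
  moreover have "monic C k \<and> tgt C k = M" if "k \<in> S" for k using that unfolding S_def by blast
  ultimately obtain k where kS: "k \<in> S" and kmax: "\<And>n. n \<in> S \<Longrightarrow> sub_le C k n \<Longrightarrow> sub_le C n k"
    using noetherian_maximal[OF M, of S] by blast
  obtain q where k: "monic C k" "tgt C k = M" and kq: "is_cokernel C k q" and qbad: "\<not> bad (tgt C q)"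
    using kS unfolding S_def by blast
  define M1 where "M1 = tgt C q"
  have [simp]: "k \<in> Arr C" "tgt C k = M" "q \<in> Arr C" "src C q = M" "tgt C q = M1" "zero_arrow C (q \<bullet> k)" "M1 \<in> Obj C"
    using k cokernelD[OF kq] by (auto simp: M1_def)
  have eq: "epic C q" by (rule cokernel_epic[OF kq])
  have M1_bad: "perp \<pi> s" if "s \<in> Arr C" "invertible C (tgt C s)" "perp (idn C M1) s" for s
    using qbad that unfolding bad_def by auto
  \<comment> \<open>A zero object is annihilated by the identity of the unit, which does not
    annihilate \<open>\<pi>\<close>.\<close>
  have M1_nonzero: "\<not> zero_arrow C (idn C M1)"
  proof
    assume "zero_arrow C (idn C M1)"
    then have "perp (idn C M1) (idn C (munit C))"
      unfolding perp_def by (rule zero_tensa_left) simp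
    then have "perp \<pi> (idn C (munit C))" by (intro M1_bad) (simp_all add: invertible_munit)
    then show False using \<pi>0 zero_invertible_iff[OF invertible_munit, of \<pi>] by (simp add: perp_def)
  qed
  obtain L1 g where L1: "invertible C L1" and g [simp]: "g \<in> Arr C" "src C g = L1" "tgt C g = M1"
    and g0: "\<not> zero_arrow C g"
    using invertible_arrow_ex[OF _ M1_nonzero] by auto
  note [simp] = invertible_Obj[OF L1]
  obtain c where c: "is_cokernel C g c" using has_cokernels[of g] by auto
  define M2 where "M2 = tgt C c"
  have [simp]: "c \<in> Arr C" "src C c = M1" "tgt C c = M2" "zero_arrow C (c \<bullet> g)" "M2 \<in> Obj C"
    using cokernelD[OF c] by (auto simp: M2_def)
  have ec: "epic C c" by (rule cokernel_epic[OF c])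
  \<comment> \<open>Otherwise the kernel of \<open>c \<bullet> q\<close> lies in \<open>S\<close>
    above \<open>k\<close>, so by maximality \<open>q\<close> factors through
    \<open>c \<bullet> q\<close>. Then \<open>c\<close> has a left inverse, and \<open>g\<close>,
    which \<open>c\<close> kills, is zero.\<close>
  have "bad M2"
  proof (rule ccontr)
    assume nb: "\<not> bad M2"
    have ecq: "epic C (c \<bullet> q)" using epic_comp[OF ec eq] by simp
    obtain k' where k': "is_kernel C (c \<bullet> q) k'" using has_kernels[of "c \<bullet> q"] by auto
    have [simp]: "k' \<in> Arr C" "tgt C k' = M" using kernelD[OF k'] by simp_all
    have ck': "is_cokernel C k' (c \<bullet> q)" by (rule epic_cokernel_of_kernel[OF ecq k'])
    have "k' \<in> S" unfolding S_def using kernel_monic[OF k'] ck' nb by auto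
    moreover have "sub_le C k k'" using kernel_sub_le_iff[OF k', of k] by simp
    ultimately have "sub_le C k' k" using kmax by blast
    then have "zero_arrow C (q \<bullet> k')"
      using kernel_sub_le_iff[OF monic_kernel_of_cokernel[OF k(1) kq], of k'] by simp
    then obtain v where v: "v \<in> Arr C" "src C v = M2" "tgt C v = M1" "v \<bullet> (c \<bullet> q) = q"
      using cokernel_factor[OF ck', of q] by auto
    have "v \<bullet> c = idn C M1" by (rule epicD[OF eq]) (use v in simp_all)
    then have "g = v \<bullet> (c \<bullet> g)" using v comp_assoc'[of g c v] by simp
    moreover have "zero_arrow C (v \<bullet> (c \<bullet> g))" using v(1,2) by simp
    ultimately show False using g0 by simp
  qed
  then obtain s where s [simp]: "s \<in> Arr C" "invertible C (tgt C s)" and ns: "\<not> perp \<pi> s"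
    and M2s: "perp (idn C M2) s" unfolding bad_def by blast
  define E where "E = tgt C s"
  define D where "D = src C s"
  have E: "invertible C E" and [simp]: "tgt C s = E" "src C s = D" "D \<in> Obj C" by (auto simp: E_def D_def)
  note [simp] = invertible_Obj[OF E]
  have "perp (idn C M2 \<bullet> c) s" using M2s by (intro perp_comp_right) simp_all
  then have cs: "zero_arrow C ((c \<star> idn C E) \<bullet> (idn C M1 \<star> s))" by (simp add: perp_def interchange)
  obtain g' y where g': "epic C g'" and y: "monic C y"
    and gy: "src C g' = src C g" "tgt C y = tgt C g" "src C y = tgt C g'" "y \<bullet> g' = g"
    using factorization[OF g(1)] by blast
  define Y1 where "Y1 = tgt C g'"
  have [simp]: "g' \<in> Arr C" "src C g' = L1" "tgt C g' = Y1" "y \<in> Arr C" "src C y = Y1" "tgt C y = M1" "Y1 \<in> Obj C"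
    using g' y gy tgt_in_Obj[of g'] by (simp_all add: Y1_def)
  have "is_cokernel C y c" using cokernel_comp_epic[of y g' c] c gy(4) g' by simp
  then have ky: "is_kernel C c y" by (rule monic_kernel_of_cokernel[OF y])
  \<comment> \<open>As \<open>s\<close> annihilates the quotient of \<open>M1\<close> by the image
    \<open>Y1\<close> of \<open>g\<close>, acting by \<open>s\<close> sends \<open>M1\<close> into
    \<open>Y1\<close>. Invertibility of \<open>E\<close> is what makes
    \<open>y \<star> idn C E\<close> the kernel of \<open>c \<star> idn C E\<close>.\<close>
  obtain r where r [simp]: "r \<in> Arr C" "src C r = M1 \<odot> D" "tgt C r = Y1 \<odot> E"
    and yr: "(y \<star> idn C E) \<bullet> r = idn C M1 \<star> s"
    using invertible_kernel[OF E ky, of "idn C M1 \<star> s"] cs by auto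
  obtain k1 where k1: "is_kernel C g k1" using has_kernels[of g] by auto
  have [simp]: "k1 \<in> Arr C" "tgt C k1 = L1" using kernelD[OF k1] by simp_all
  have "is_kernel C g' k1" using kernel_comp_monic[OF y, of g' k1] k1 gy(4) by simp
  then have ck1: "is_cokernel C k1 g'" and [simp]: "zero_arrow C (g' \<bullet> k1)"
    using epic_cokernel_of_kernel[OF g'] kernelD(4) by blast+
  \<comment> \<open>\<open>k1\<close> annihilates the cyclic object \<open>Y1\<close>, and
    \<open>s\<close> maps \<open>M1\<close> into \<open>Y1\<close>, so \<open>s \<star> k1\<close>
    annihilates \<open>M1\<close>. As \<open>M1\<close> is not \<open>bad\<close>,
    \<open>s \<star> k1\<close> lies in the prime, and therefore \<open>k1\<close> does.\<close>
  have "perp g' k1" by (rule perp_of_zero_comp[OF L1]) simp_all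
  then have "perp (idn C Y1 \<bullet> g') k1" by simp
  then have "perp (idn C Y1) k1" by - (rule perp_epic[OF g'], simp_all)
  then have "perp (y \<bullet> idn C Y1) k1" by (intro perp_comp_left) simp_all
  then have "perp (y \<star> idn C E) k1" by (intro perp_tensa) simp_all
  then have "perp ((y \<star> idn C E) \<bullet> r) k1" by (intro perp_comp_right) simp_all
  then have "zero_arrow C (idn C M1 \<star> (s \<star> k1))"
    using zero_asc_iff[of "idn C M1" s k1] by (simp add: yr perp_def)
  then have "perp \<pi> (s \<star> k1)"
    by (intro M1_bad) (simp_all add: perp_def invertible_tens E L1)
  then have "perp \<pi> k1" using prime[of s k1] ns E L1 by simp
  then have "zero_arrow C ((\<pi> \<star> idn C L1) \<bullet> (idn C L \<star> k1))" by (simp add: perp_def interchange)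
  then obtain v where v [simp]: "v \<in> Arr C" "src C v = L \<odot> Y1" "tgt C v = tgt C \<pi> \<odot> L1"
    and vg: "v \<bullet> (idn C L \<star> g') = \<pi> \<star> idn C L1"
    using cokernel_tensa_right[OF ck1, of L "\<pi> \<star> idn C L1"] by auto
  have "is_iso C (asc C L Y1 E)" by (rule asc_iso) simp_all
  then obtain a where a0: "a \<in> Arr C" "src C a = tgt C (asc C L Y1 E)" "tgt C a = src C (asc C L Y1 E)"
    "a \<bullet> asc C L Y1 E = idn C (src C (asc C L Y1 E))"
    using isoE by blast
  then have a [simp]: "a \<in> Arr C" "src C a = L \<odot> (Y1 \<odot> E)" "tgt C a = (L \<odot> Y1) \<odot> E"
    and aa: "a \<bullet> asc C L Y1 E = idn C ((L \<odot> Y1) \<odot> E)" by simp_all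
  define \<theta> where "\<theta> = (v \<star> idn C E) \<bullet> (a \<bullet> (idn C L \<star> r))"
  define W where "W = (tgt C \<pi> \<odot> L1) \<odot> E"
  have WY: "W \<in> twists Y" and [simp]: "W \<in> Obj C" using W L1 E by (simp_all add: W_def twists.intros)
  have \<theta> [simp]: "\<theta> \<in> Arr C" "src C \<theta> = L \<odot> (M1 \<odot> D)" "tgt C \<theta> = W" by (simp_all add: \<theta>_def W_def)
  have rg: "r \<bullet> (g \<star> idn C D) = g' \<star> s"
  proof (rule monicD[OF invertible_monic[OF E y]])
    have "(y \<star> idn C E) \<bullet> (r \<bullet> (g \<star> idn C D)) = ((y \<star> idn C E) \<bullet> r) \<bullet> (g \<star> idn C D)" by simp
    also have "\<dots> = (y \<star> idn C E) \<bullet> (g' \<star> s)" unfolding yr by (simp add: interchange gy(4))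
    finally show "(y \<star> idn C E) \<bullet> (r \<bullet> (g \<star> idn C D)) = (y \<star> idn C E) \<bullet> (g' \<star> s)" .
  qed simp_all
  \<comment> \<open>Restricted along \<open>g\<close>, the arrow \<open>\<theta>\<close> becomes
    \<open>(\<pi> \<star> idn C L1) \<star> s\<close>, which is nonzero because \<open>s\<close>
    lies outside the prime.\<close>
  have \<theta>0: "\<not> zero_arrow C \<theta>"
  proof
    assume \<theta>z: "zero_arrow C \<theta>"
    have "\<theta> \<bullet> ((idn C L \<star> (g \<star> idn C D)) \<bullet> asc C L L1 D) =
        (v \<star> idn C E) \<bullet> (a \<bullet> ((idn C L \<star> (g' \<star> s)) \<bullet> asc C L L1 D))"
      by (simp add: \<theta>_def interchange' rg)
    also have "(idn C L \<star> (g' \<star> s)) \<bullet> asc C L L1 D = asc C L Y1 E \<bullet> ((idn C L \<star> g') \<star> s)"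
      using asc_nat[of "idn C L" g' s] by simp
    also have "a \<bullet> (asc C L Y1 E \<bullet> ((idn C L \<star> g') \<star> s)) = (idn C L \<star> g') \<star> s"
      using comp_assoc'[of "(idn C L \<star> g') \<star> s" "asc C L Y1 E" a] aa by simp
    also have "(v \<star> idn C E) \<bullet> ((idn C L \<star> g') \<star> s) = (\<pi> \<star> idn C L1) \<star> s"
      by (simp add: interchange vg)
    finally have "perp (\<pi> \<star> idn C L1) s"
      unfolding perp_def using zero_comp_right[OF \<theta>z, of "(idn C L \<star> (g \<star> idn C D)) \<bullet> asc C L L1 D"] by simp
    then show False using perp_invertible_iff[OF L1, of \<pi> s] ns by simp
  qed
  \<comment> \<open>The source of \<open>\<theta>\<close> contains the arbitrary object
    \<open>D\<close>. With \<open>M1\<close> moved to the last place, \<open>\<theta>\<close>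
    transposes to a nonzero arrow into the internal hom from \<open>M1\<close> to \<open>W\<close>;
    an invertible object mapping to this hom then replaces both \<open>L\<close> and
    \<open>D\<close>.\<close>
  define b where "b = (idn C L \<star> swp C D M1) \<bullet> asc C L D M1"
  have [simp]: "b \<in> Arr C" "src C b = (L \<odot> D) \<odot> M1" "tgt C b = L \<odot> (M1 \<odot> D)" by (simp_all add: b_def)
  have eb: "epic C b" unfolding b_def
    by (intro epic_comp epic_tensa_right iso_epic swp_iso asc_iso) simp_all
  have \<theta>b: "\<not> zero_arrow C (\<theta> \<bullet> b)" using epic_zeroD[OF eb, of \<theta>] \<theta>0 by auto
  have M1O: "M1 \<in> Obj C" and WO: "W \<in> Obj C" by simp_all
  obtain H ev where H: "H \<in> Obj C" "ev \<in> Arr C" "src C ev = H \<odot> M1" "tgt C ev = W"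
    and Hex: "\<forall>X \<in> Obj C. \<forall>f \<in> Arr C. src C f = X \<odot> M1 \<and> tgt C f = W \<longrightarrow>
      (\<exists>g \<in> Arr C. src C g = X \<and> tgt C g = H \<and> ev \<bullet> (g \<star> idn C M1) = f)"
    and Hz: "\<forall>g \<in> Arr C. tgt C g = H \<and> zero_arrow C (ev \<bullet> (g \<star> idn C M1)) \<longrightarrow> zero_arrow C g"
    using transpose_ex[OF M1O WO] by blast
  note [simp] = H
  obtain g2 where g2: "g2 \<in> Arr C" "src C g2 = L \<odot> D" "tgt C g2 = H" "ev \<bullet> (g2 \<star> idn C M1) = \<theta> \<bullet> b"
    using Hex[rule_format, of "L \<odot> D" "\<theta> \<bullet> b"] by auto
  have "\<not> zero_arrow C (idn C H)"
  proof
    assume "zero_arrow C (idn C H)"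
    then have "zero_arrow C g2" using zero_idn_arrow[of H g2] g2 by simp
    then have "zero_arrow C (ev \<bullet> (g2 \<star> idn C M1))" using g2(1-3) by simp
    then show False using \<theta>b unfolding g2(4) by simp
  qed
  then obtain L3 g3 where L3: "invertible C L3" and g3 [simp]: "g3 \<in> Arr C" "src C g3 = L3" "tgt C g3 = H"
    and g30: "\<not> zero_arrow C g3"
    using invertible_arrow_ex[of H] by auto
  note [simp] = invertible_Obj[OF L3]
  define \<psi> where "\<psi> = (ev \<bullet> (g3 \<star> idn C M1)) \<bullet> ((idn C L3 \<star> q) \<bullet> swp C M L3)"
  have \<psi> [simp]: "\<psi> \<in> Arr C" "src C \<psi> = M \<odot> L3" "tgt C \<psi> = W" by (simp_all add: \<psi>_def)
  have e3: "epic C ((idn C L3 \<star> q) \<bullet> swp C M L3)"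
    by (intro epic_comp epic_tensa_right[OF eq] iso_epic[OF swp_iso]) simp_all
  have "\<not> zero_arrow C \<psi>"
  proof
    assume "zero_arrow C \<psi>"
    then have "zero_arrow C (ev \<bullet> (g3 \<star> idn C M1))"
      unfolding \<psi>_def by - (rule epic_zeroD[OF e3], simp_all)
    then show False using bspec[OF Hz, of g3] g30 by simp
  qed
  then show ?thesis using twists_arrow[OF WY _ MO L3 \<psi>] that by auto
qed

end

section \<open>Nonzero arrows from invertible objects\<close>

lemma (in abelian_closed_category) invertible_filtered_arrow:
  assumes G: "invertible_filtered C G"
    and h: "h \<in> Arr C" "src C h = G" "\<not> zero_arrow C h"
  obtains L g where "invertible C L" "g \<in> Arr C" "src C g = L" "tgt C g = tgt C h" "\<not> zero_arrow C g"
proof -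
  obtain n :: nat and m u q where m: "\<forall>i \<le> n. monic C (m i) \<and> tgt C (m i) = G"
    and m0: "zero_object C (src C (m 0))" and mn: "is_iso C (m n)"
    and u: "\<forall>i < n. u i \<in> homs C (src C (m i)) (src C (m (Suc i))) \<and> m (Suc i) \<bullet> u i = m i \<and>
      is_cokernel C (u i) (q i) \<and> invertible C (tgt C (q i))"
    using G unfolding invertible_filtered_def by auto
  have mi: "m i \<in> Arr C" "tgt C (m i) = G" if "i \<le> n" for i using m that by simp_all
  \<comment> \<open>\<open>h\<close> vanishes on the zero stage of the filtration but not on the
    last, so somewhere it vanishes on one stage and not on the next. There it factors through an
    invertible quotient.\<close>
  have "\<exists>i < n. zero_arrow C (h \<bullet> m i) \<and> \<not> zero_arrow C (h \<bullet> m (Suc i))"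
  proof (rule ccontr)
    assume no: "\<not> ?thesis"
    have "zero_arrow C (h \<bullet> m i)" if "i \<le> n" for i
      using that
    proof (induction i)
      case 0
      have "zero_arrow C (m 0)" by (rule zero_object_arrow[OF m0]) (use mi in simp_all)
      then show ?case using h mi by simp
    next
      case (Suc i)
      then show ?case using no by simp
    qed
    then have "zero_arrow C (h \<bullet> m n)" by simp
    then have "zero_arrow C h" using epic_zeroD[OF iso_epic[OF mn], of h] h mi by simp
    then show False using h by simp
  qed
  then obtain i where i: "i < n" "zero_arrow C (h \<bullet> m i)" "\<not> zero_arrow C (h \<bullet> m (Suc i))" by blast
  have ui: "u i \<in> Arr C" "src C (u i) = src C (m i)" "tgt C (u i) = src C (m (Suc i))"
    "m (Suc i) \<bullet> u i = m i" "is_cokernel C (u i) (q i)" "invertible C (tgt C (q i))"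
    using u i(1) by (simp_all add: homs_iff)
  have "zero_arrow C ((h \<bullet> m (Suc i)) \<bullet> u i)" using ui(1-4) i h mi by simp
  then obtain v where v: "v \<in> Arr C" "src C v = tgt C (q i)" "tgt C v = tgt C h" "v \<bullet> q i = h \<bullet> m (Suc i)"
    using cokernel_factor[OF ui(5), of "h \<bullet> m (Suc i)"] i h mi ui(3) by auto
  have "\<not> zero_arrow C v"
  proof
    assume "zero_arrow C v"
    then have "zero_arrow C (v \<bullet> q i)" using v(2) cokernelD[OF ui(5)] by simp
    then show False using i(3) unfolding v(4) by simp
  qed
  then show ?thesis using that v ui(6) by blast
qed

text \<open>Separating the identity of \<open>J\<close> from its zero endomorphism gives a nonzero
  arrow from a generator.\<close>

lemma (in abelian_closed_category) invertibly_generated_categoryI: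
  assumes S: "generating C S" "\<forall>G \<in> S. invertible_filtered C G"
  shows "invertibly_generated_category C"
proof
  fix J assume J: "J \<in> Obj C" "\<not> zero_arrow C (idn C J)"
  obtain z where z: "zero_arrow C z" "src C z = J" "tgt C z = J" using zero_ex[of J J] J by auto
  have "idn C J \<noteq> z" using z J by auto
  then obtain G h where G: "G \<in> S" and h: "h \<in> homs C G J" "idn C J \<bullet> h \<noteq> z \<bullet> h"
    using S(1)[unfolded generating_def, THEN conjunct2, rule_format, of "idn C J" z] J z by auto
  have h': "h \<in> Arr C" "src C h = G" "tgt C h = J" using h by (simp_all add: homs_iff)
  have "\<not> zero_arrow C h"
  proof
    assume "zero_arrow C h"
    then have "h = z \<bullet> h" using z h' by - (rule zero_unique, simp_all)
    then show False using h h' by simp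
  qed
  then show "\<exists>L g. invertible C L \<and> g \<in> Arr C \<and> src C g = L \<and> tgt C g = J \<and> \<not> zero_arrow C g"
    using invertible_filtered_arrow[of G h] S(2) G h' by metis
qed

section \<open>The category of noetherian objects\<close>

context abelian_category
begin

abbreviation Noeth :: "('a, 'b) cat" where "Noeth \<equiv> noeth_cat C"

lemma noeth_simps [simp]:
  "Obj Noeth = {A. noetherian C A}"
  "Arr Noeth = {f \<in> Arr C. noetherian C (src C f) \<and> noetherian C (tgt C f)}"
  "src Noeth = src C" "tgt Noeth = tgt C" "idn Noeth = idn C" "comp Noeth = comp C"
  by (auto simp: full_subcategory_def)

lemma homs_noeth: "f \<in> homs Noeth A B \<longleftrightarrow> f \<in> homs C A B \<and> noetherian C A \<and> noetherian C B"
  by (auto simp: homs_def)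

lemma zero_object_noeth: "zero_object C Z \<Longrightarrow> zero_object Noeth Z"
  using noetherian_zero_object[of Z] noetherian_Obj unfolding zero_object_def by (simp add: homs_noeth)

lemma noeth_category_with_zero: "category_with_zero Noeth"
proof
  show "\<exists>Z. zero_object Noeth Z" using zero_object_ex zero_object_noeth by blast
qed (auto simp: homs_noeth homs_iff noetherian_Obj)

sublocale noeth: category_with_zero Noeth
  rewrites "Obj Noeth = {A. noetherian C A}"
    and "Arr Noeth = {f \<in> Arr C. noetherian C (src C f) \<and> noetherian C (tgt C f)}"
    and "src Noeth = src C" and "tgt Noeth = tgt C" and "idn Noeth = idn C" and "comp Noeth = comp C"
  by (rule noeth_category_with_zero) simp_all

text \<open>A zero arrow of the subcategory factors through a zero object of that subcategory, which
  is not assumed to be one of the whole category. Hence both notions are compared with an arrow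
  \<open>z\<close> that is zero in each.\<close>

lemma zero_arrow_noeth:
  assumes "f \<in> Arr C" "noetherian C (src C f)" "noetherian C (tgt C f)"
  shows "zero_arrow Noeth f \<longleftrightarrow> zero_arrow C f"
proof -
  have *: "zero_arrow Noeth g"
    if g: "zero_arrow C g" "noetherian C (src C g)" "noetherian C (tgt C g)" for g
  proof -
    obtain Z a b where Z: "zero_object C Z" "a \<in> Arr C" "src C a = src C g" "tgt C a = Z"
      "b \<in> Arr C" "src C b = Z" "tgt C b = tgt C g" "b \<bullet> a = g"
      using zero_arrowE[OF g(1)] by blast
    have "zero_arrow Noeth (b \<bullet> a)"
      by (rule noeth.zero_arrowI[OF zero_object_noeth[OF Z(1)]])
        (use Z g noetherian_zero_object[OF Z(1)] in simp_all)
    then show ?thesis using Z by simp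
  qed
  obtain z where z: "zero_arrow C z" "src C z = src C f" "tgt C z = tgt C f"
    using zero_ex[of "src C f" "tgt C f"] assms by auto
  have "zero_arrow Noeth z" using * z assms by simp
  then have "f = z" if "zero_arrow Noeth f" using noeth.zero_unique[of f z] that z by simp
  then show ?thesis using * assms z by auto
qed

lemma monic_noethI:
  assumes "monic C m" "noetherian C (tgt C m)"
  shows "monic Noeth m"
  unfolding monic_def
proof (intro conjI ballI impI; (elim conjE)?)
  show "m \<in> Arr Noeth" using assms noetherian_sub[OF assms] by simp
  fix f g assume "f \<in> Arr Noeth" "g \<in> Arr Noeth" "src Noeth f = src Noeth g" "tgt Noeth f = src Noeth m" "tgt Noeth g = src Noeth m"
    "m \<bullet>\<^bsub>Noeth\<^esub> f = m \<bullet>\<^bsub>Noeth\<^esub> g"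
  then show "f = g" by - (rule monicD[OF assms(1)], simp_all)
qed

lemma epic_noethI:
  assumes "epic C m" "noetherian C (src C m)"
  shows "epic Noeth m"
  unfolding epic_def
proof (intro conjI ballI impI; (elim conjE)?)
  show "m \<in> Arr Noeth" using assms noetherian_quotient[OF assms] by simp
  fix f g assume "f \<in> Arr Noeth" "g \<in> Arr Noeth" "tgt Noeth f = tgt Noeth g" "src Noeth f = tgt Noeth m" "src Noeth g = tgt Noeth m"
    "f \<bullet>\<^bsub>Noeth\<^esub> m = g \<bullet>\<^bsub>Noeth\<^esub> m"
  then show "f = g" by - (rule epicD[OF assms(1)], simp_all)
qed

text \<open>Subobjects of noetherian objects are noetherian, so a kernel formed in the whole
  category stays in the subcategory.\<close>

lemma kernel_noethI:
  assumes k: "is_kernel C f k" and f: "noetherian C (src C f)" "noetherian C (tgt C f)"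
  shows "is_kernel Noeth f k"
proof (rule noeth.kernelI)
  note K [simp] = kernelD[OF k]
  have n: "noetherian C (src C k)" using noetherian_sub[OF kernel_monic[OF k]] f by simp
  show "monic Noeth k" using monic_noethI[OF kernel_monic[OF k]] f by simp
  show "zero_arrow Noeth (f \<bullet> k)" using f n by (simp add: zero_arrow_noeth)
  fix h assume h: "h \<in> {f \<in> Arr C. noetherian C (src C f) \<and> noetherian C (tgt C f)}"
    "tgt C h = src C f" "zero_arrow Noeth (f \<bullet> h)"
  then have "zero_arrow C (f \<bullet> h)" using f zero_arrow_noeth[of "f \<bullet> h"] by simp
  then obtain u where u: "u \<in> Arr C" "src C u = src C h" "tgt C u = src C k" "k \<bullet> u = h"
    using kernel_factor[OF k, of h] h by auto
  then show "\<exists>u \<in> {f \<in> Arr C. noetherian C (src C f) \<and> noetherian C (tgt C f)}.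
      src C u = src C h \<and> tgt C u = src C k \<and> k \<bullet> u = h"
    using h n u by (intro bexI[of _ u]) simp_all
qed (use kernelD[OF k] f in simp_all)

lemma cokernel_noethI:
  assumes k: "is_cokernel C f k" and f: "noetherian C (src C f)" "noetherian C (tgt C f)"
  shows "is_cokernel Noeth f k"
proof (rule noeth.cokernelI)
  note K [simp] = cokernelD[OF k]
  have n: "noetherian C (tgt C k)" using noetherian_quotient[OF cokernel_epic[OF k]] f by simp
  show "epic Noeth k" using epic_noethI[OF cokernel_epic[OF k]] f by simp
  show "zero_arrow Noeth (k \<bullet> f)" using f n by (simp add: zero_arrow_noeth)
  fix h assume h: "h \<in> {f \<in> Arr C. noetherian C (src C f) \<and> noetherian C (tgt C f)}"
    "src C h = tgt C f" "zero_arrow Noeth (h \<bullet> f)"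
  then have "zero_arrow C (h \<bullet> f)" using f zero_arrow_noeth[of "h \<bullet> f"] by simp
  then obtain u where u: "u \<in> Arr C" "src C u = tgt C k" "tgt C u = tgt C h" "u \<bullet> k = h"
    using cokernel_factor[OF k, of h] h by auto
  then show "\<exists>u \<in> {f \<in> Arr C. noetherian C (src C f) \<and> noetherian C (tgt C f)}.
      src C u = tgt C k \<and> tgt C u = tgt C h \<and> u \<bullet> k = h"
    using h n u by (intro bexI[of _ u]) simp_all
qed (use cokernelD[OF k] f in simp_all)

text \<open>Test arrows in the whole category may have a source that is not noetherian. They factor
  through the kernel of \<open>m\<close>, which lies in the subcategory and vanishes there.\<close>

lemma monic_noethD:
  assumes m: "monic Noeth m" shows "monic C m"
proof (rule monicI)
  show mC [simp]: "m \<in> Arr C" using m[unfolded monic_def, THEN conjunct1] by simp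
  have n: "noetherian C (src C m)" "noetherian C (tgt C m)" using m[unfolded monic_def, THEN conjunct1] by simp_all
  fix x assume x: "x \<in> Arr C" "tgt C x = src C m" "zero_arrow C (m \<bullet> x)"
  obtain k where k: "is_kernel C m k" using has_kernels[OF mC] by blast
  note [simp] = kernelD[OF k]
  have nk: "noetherian C (src C k)" using noetherian_sub[OF kernel_monic[OF k]] n by simp
  have "zero_arrow Noeth (m \<bullet> k)" using n nk by (simp add: zero_arrow_noeth)
  then have "zero_arrow Noeth k" using noeth.monic_zeroD[OF m, of k] n nk by simp
  then have kz: "zero_arrow C k" using n nk by (simp add: zero_arrow_noeth)
  obtain u where u: "u \<in> Arr C" "src C u = src C x" "tgt C u = src C k" "k \<bullet> u = x"
    using kernel_factor[OF k, of x] x by auto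
  then show "zero_arrow C x" using zero_comp_right[OF kz, of u] u by simp
qed

lemma epic_noethD:
  assumes m: "epic Noeth m" shows "epic C m"
proof (rule epicI)
  show mC [simp]: "m \<in> Arr C" using m[unfolded epic_def, THEN conjunct1] by simp
  have n: "noetherian C (src C m)" "noetherian C (tgt C m)" using m[unfolded epic_def, THEN conjunct1] by simp_all
  fix x assume x: "x \<in> Arr C" "src C x = tgt C m" "zero_arrow C (x \<bullet> m)"
  obtain k where k: "is_cokernel C m k" using has_cokernels[OF mC] by blast
  note [simp] = cokernelD[OF k]
  have nk: "noetherian C (tgt C k)" using noetherian_quotient[OF cokernel_epic[OF k]] n by simp
  have "zero_arrow Noeth (k \<bullet> m)" using n nk by (simp add: zero_arrow_noeth)
  then have "zero_arrow Noeth k" using noeth.epic_zeroD[OF m, of k] n nk by simp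
  then have kz: "zero_arrow C k" using n nk by (simp add: zero_arrow_noeth)
  obtain u where u: "u \<in> Arr C" "src C u = tgt C k" "tgt C u = tgt C x" "u \<bullet> k = x"
    using cokernel_factor[OF k, of x] x by auto
  then show "zero_arrow C x" using zero_comp_left[OF kz, of u] u by simp
qed

section \<open>Closure conditions of the subcategory read in the whole category\<close>

lemma subcategory_noetherian: "subcategory Noeth X \<Longrightarrow> M \<in> X \<Longrightarrow> noetherian C M"
  unfolding subcategory_def by auto

lemma subcategory_iso:
  assumes X: "subcategory Noeth X" and f: "is_iso C f" "src C f \<in> X"
  shows "tgt C f \<in> X"
proof -
  have n: "noetherian C (src C f)" using subcategory_noetherian X f by blast
  have n': "noetherian C (tgt C f)" using noetherian_quotient[OF iso_epic[OF f(1)]] n by simp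
  obtain g where g: "g \<in> Arr C" "src C g = tgt C f" "tgt C g = src C f"
    "g \<bullet> f = idn C (src C f)" "f \<bullet> g = idn C (tgt C f)"
    using isoE[OF f(1)] by blast
  have "is_iso Noeth f" by (rule noeth.isoI[of f g]) (use g f n n' in simp_all)
  then have "isomorphic Noeth (src C f) (tgt C f)"
    using f(1) n n' unfolding noeth.isomorphic_iff by blast
  then show ?thesis using X f unfolding subcategory_def by blast
qed

lemma closed_under_cokernelsD:
  assumes "closed_under_cokernels Noeth X" "subcategory Noeth X"
    and "is_cokernel C f q" "src C f \<in> X" "tgt C f \<in> X"
  shows "tgt C q \<in> X"
proof -
  have n: "noetherian C (src C f)" "noetherian C (tgt C f)"
    using assms subcategory_noetherian by blast+
  have "f \<in> homs Noeth (src C f) (tgt C f)"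
    using n cokernelD(1)[OF assms(3)] by (simp add: homs_noeth homs_iff)
  then show ?thesis
    using assms cokernel_noethI[OF assms(3) n] unfolding closed_under_cokernels_def noeth_simps by blast
qed

lemma extension_closedD:
  assumes "extension_closed Noeth X" "subcategory Noeth X"
    and "short_exact C f g" "src C f \<in> X" "tgt C g \<in> X"
  shows "tgt C f \<in> X"
proof -
  have n: "noetherian C (src C f)" "noetherian C (tgt C g)"
    using assms subcategory_noetherian by blast+
  then have n': "noetherian C (tgt C f)" using noetherian_extension[OF assms(3)] by blast
  have *: "is_kernel C g f" "is_cokernel C f g" using assms(3) by (simp_all add: short_exact_def)
  have "short_exact Noeth f g"
    unfolding short_exact_def
    using kernel_noethI[OF *(1)] cokernel_noethI[OF *(2)] n n' kernelD(3)[OF *(1)] by simp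
  then show ?thesis using assms unfolding extension_closed_def noeth_simps by blast
qed

text \<open>Images are defined as kernels of cokernels; the monic part of any factorization with
  epic first part is such a kernel.\<close>

lemma closed_under_imagesD:
  assumes "closed_under_images Noeth X" "subcategory Noeth X"
    and "epic C e" "monic C m" "src C m = tgt C e" "src C e \<in> X" "tgt C m \<in> X"
  shows "src C m \<in> X"
proof -
  note [simp] = epic_arr[OF assms(3)] monic_arr[OF assms(4)] assms(5)
  have n: "noetherian C (src C e)" "noetherian C (tgt C m)"
    using assms subcategory_noetherian by blast+
  obtain q where q: "is_cokernel C (m \<bullet> e) q" using has_cokernels[of "m \<bullet> e"] by auto
  have "is_cokernel C m q" by (rule cokernel_comp_epic[OF q assms(3)]) simp_all
  then have "is_kernel C q m" by (rule monic_kernel_of_cokernel[OF assms(4)])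
  moreover have "src C q = tgt C m" using cokernelD[OF q] by simp
  moreover have "noetherian C (tgt C q)"
    using noetherian_quotient[OF cokernel_epic[OF q]] n \<open>src C q = tgt C m\<close> by simp
  ultimately have "is_image Noeth (m \<bullet> e) m"
    unfolding is_image_def using cokernel_noethI[OF q] kernel_noethI[of q m] n by (intro exI[of _ q]) simp
  moreover have "m \<bullet> e \<in> homs Noeth (src C e) (tgt C m)"
    using n by (simp add: homs_noeth homs_iff)
  ultimately show ?thesis
    using assms unfolding closed_under_images_def noeth_simps by blast
qed

lemma closed_under_quotientsD:
  assumes "closed_under_quotients Noeth X" "subcategory Noeth X"
    and "epic C e" "src C e \<in> X"
  shows "tgt C e \<in> X"
proof -
  have "epic Noeth e" using epic_noethI[OF assms(3)] subcategory_noetherian[OF assms(2,4)] by simp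
  then show ?thesis using assms unfolding closed_under_quotients_def noeth_simps by blast
qed

end

section \<open>Closure under quotients and under subobjects\<close>

locale noetherian_subcategory = invertibly_generated_category +
  fixes X :: "'a set"
  assumes subcategory: "subcategory Noeth X"
    and L_closed: "L_closed C X"
    and zero_mem: "zero_object C Z \<Longrightarrow> Z \<in> X"
begin

lemma X_noetherian: "M \<in> X \<Longrightarrow> noetherian C M"
  using subcategory_noetherian[OF subcategory] .

lemma X_tens: "M \<in> X \<Longrightarrow> invertible C L \<Longrightarrow> M \<odot> L \<in> X"
  using L_closed unfolding L_closed_def by blast

lemma quotients_if_cokernels:
  assumes cok: "closed_under_cokernels Noeth X"
  shows "closed_under_quotients Noeth X"
  unfolding closed_under_quotients_def noeth_simps
proof (intro allI impI, elim conjE)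
  fix e assume "epic Noeth e" and MX: "src C e \<in> X"
  then have e: "epic C e" by (simp add: epic_noethD)
  note cokD = closed_under_cokernelsD[OF cok subcategory]
  define M where "M = src C e"
  have M: "noetherian C M" "M \<in> X" using X_noetherian MX by (simp_all add: M_def)
  have [simp]: "e \<in> Arr C" "src C e = M" "M \<in> Obj C" using e M by (simp_all add: M_def noetherian_Obj)
  \<comment> \<open>The condition on \<open>e \<bullet> k\<close> confines the competing subobjects
    to the kernel of \<open>e\<close>; the zero subobject starts the search.\<close>
  define S where "S = {k. monic C k \<and> tgt C k = M \<and> zero_arrow C (e \<bullet> k) \<and>
    (\<exists>q. is_cokernel C k q \<and> tgt C q \<in> X)}"
  obtain Z where Z: "zero_object C Z" using zero_object_ex by blast
  obtain k0 where k0: "monic C k0" "tgt C k0 = M" "zero_arrow C k0" "is_cokernel C k0 (idn C M)"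
    using zero_sub_ex[OF _ Z, of M] by auto
  have "zero_arrow C (e \<bullet> k0)" using k0 by simp
  then have "k0 \<in> S" unfolding S_def using k0 M by auto
  moreover have "monic C k \<and> tgt C k = M" if "k \<in> S" for k using that unfolding S_def by blast
  ultimately obtain k where kS: "k \<in> S" and kmax: "\<And>n. n \<in> S \<Longrightarrow> sub_le C k n \<Longrightarrow> sub_le C n k"
    using noetherian_maximal[OF M(1), of S] by blast
  obtain q where k: "monic C k" "tgt C k = M" "zero_arrow C (e \<bullet> k)" and kq: "is_cokernel C k q"
    and qX: "tgt C q \<in> X"
    using kS unfolding S_def by blast
  have eq: "epic C q" by (rule cokernel_epic[OF kq])
  define M0 where "M0 = tgt C q"
  have [simp]: "k \<in> Arr C" "tgt C k = M" "q \<in> Arr C" "src C q = M" "tgt C q = M0" "zero_arrow C (q \<bullet> k)" "M0 \<in> Obj C"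
    using k cokernelD[OF kq] by (auto simp: M0_def)
  have M0X: "M0 \<in> X" using qX by simp
  obtain e0 where e0 [simp]: "e0 \<in> Arr C" "src C e0 = M0" "tgt C e0 = tgt C e" and e0q: "e0 \<bullet> q = e"
    using cokernel_factor[OF kq, of e] k(3) by auto
  \<comment> \<open>\<open>y\<close> is what remains of the kernel of \<open>e\<close> in the
    quotient \<open>M0\<close>. If it is zero, \<open>e0\<close> is an isomorphism from
    \<open>M0\<close> to the target of \<open>e\<close>.\<close>
  obtain y where y: "is_kernel C e0 y" using has_kernels[of e0] by auto
  have [simp]: "y \<in> Arr C" "tgt C y = M0" "zero_arrow C (e0 \<bullet> y)" using kernelD[OF y] by simp_all
  show "tgt C e \<in> X"
  proof (cases "zero_arrow C (idn C (src C y))")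
    case True
    have "monic C e0"
    proof (rule monicI)
      fix x assume x: "x \<in> Arr C" "tgt C x = src C e0" "zero_arrow C (e0 \<bullet> x)"
      obtain u where u: "u \<in> Arr C" "src C u = src C x" "tgt C u = src C y" "y \<bullet> u = x"
        using kernel_factor[OF y, of x] x by auto
      then have "zero_arrow C u" using zero_idn_arrow[OF True, of u] by simp
      then have "zero_arrow C (y \<bullet> u)" using u(1-3) by simp
      then show "zero_arrow C x" using u by simp
    qed simp
    moreover have "epic C e0" by (rule epic_cancel[of e0 q]) (use e0q e in simp_all)
    ultimately have "is_iso C e0" by (rule monic_epic_iso)
    then show ?thesis using subcategory_iso[OF subcategory, of e0] M0X by simp
  next
    case False
    obtain L \<phi> where L: "invertible C L" and \<phi> [simp]: "\<phi> \<in> Arr C" "src C \<phi> = M0 \<odot> L" "tgt C \<phi> = src C y"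
      and \<phi>0: "\<not> zero_arrow C \<phi>"
      using invertible_arrow_to_subobject[OF X_noetherian[OF M0X] kernel_monic[OF y] _ False] by auto
    \<comment> \<open>\<open>\<phi>\<close> ends in an object not known to lie in \<open>X\<close>.
      The cokernel of \<open>y \<bullet> \<phi>\<close> is taken instead, whose source and target
      both lie in \<open>X\<close>.\<close>
    obtain q1 where q1: "is_cokernel C (y \<bullet> \<phi>) q1" using has_cokernels[of "y \<bullet> \<phi>"] by auto
    have [simp]: "q1 \<in> Arr C" "src C q1 = M0" "zero_arrow C (q1 \<bullet> (y \<bullet> \<phi>))"
      using cokernelD[OF q1] by simp_all
    have q1X: "tgt C q1 \<in> X"
      by (rule cokD[OF q1]) (use X_tens[OF M0X L] M0X in simp_all)
    have eq1: "epic C (q1 \<bullet> q)" using epic_comp[OF cokernel_epic[OF q1] eq] by simp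
    obtain m1 where m1: "is_kernel C (q1 \<bullet> q) m1" using has_kernels[of "q1 \<bullet> q"] by auto
    have [simp]: "m1 \<in> Arr C" "tgt C m1 = M" and qm: "zero_arrow C (q1 \<bullet> (q \<bullet> m1))"
      using kernelD[OF m1] by simp_all
    have cm1: "is_cokernel C m1 (q1 \<bullet> q)" by (rule epic_cokernel_of_kernel[OF eq1 m1])
    have "zero_arrow C (e0 \<bullet> (y \<bullet> \<phi>))" by (rule zero_comp_assoc) simp_all
    then obtain e1 where e1: "e1 \<in> Arr C" "src C e1 = tgt C q1" "tgt C e1 = tgt C e" "e1 \<bullet> q1 = e0"
      using cokernel_factor[OF q1, of e0] by auto
    have "e \<bullet> m1 = e1 \<bullet> (q1 \<bullet> (q \<bullet> m1))"
      using e1 comp_assoc'[of m1 q e0] comp_assoc'[of "q \<bullet> m1" q1 e1] e0q by simp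
    moreover have "zero_arrow C (e1 \<bullet> (q1 \<bullet> (q \<bullet> m1)))"
      by (rule zero_comp_left[OF qm]) (use e1 in simp_all)
    ultimately have "zero_arrow C (e \<bullet> m1)" by simp
    moreover have "tgt C (q1 \<bullet> q) \<in> X" using q1X by simp
    ultimately have "m1 \<in> S" unfolding S_def using kernel_monic[OF m1] cm1 by auto
    moreover have "sub_le C k m1" using kernel_sub_le_iff[OF m1, of k] by simp
    ultimately have "sub_le C m1 k" using kmax by blast
    then have "zero_arrow C (q \<bullet> m1)"
      using kernel_sub_le_iff[OF monic_kernel_of_cokernel[OF k(1) kq], of m1] by simp
    \<comment> \<open>Now \<open>q\<close> factors through \<open>q1 \<bullet> q\<close>, so
      \<open>q1\<close> has a left inverse although it kills \<open>y \<bullet> \<phi>\<close>; this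
      forces \<open>\<phi>\<close> to be zero.\<close>
    then obtain v where v: "v \<in> Arr C" "src C v = tgt C q1" "tgt C v = M0" "v \<bullet> (q1 \<bullet> q) = q"
      using cokernel_factor[OF cm1, of q] by auto
    have "v \<bullet> q1 = idn C M0" by (rule epicD[OF eq]) (use v in simp_all)
    then have "y \<bullet> \<phi> = v \<bullet> (q1 \<bullet> (y \<bullet> \<phi>))" using v comp_assoc'[of "y \<bullet> \<phi>" q1 v] by simp
    moreover have "zero_arrow C (v \<bullet> (q1 \<bullet> (y \<bullet> \<phi>)))"
      by (rule zero_comp_left) (use v in simp_all)
    ultimately have "zero_arrow C (y \<bullet> \<phi>)" by simp
    then have "zero_arrow C \<phi>" using monic_zeroD[OF kernel_monic[OF y], of \<phi>] by simp
    then show ?thesis using \<phi>0 by simp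
  qed
qed

text \<open>Image closure is phrased by a factorization, so that it can be supplied either by
  closure under images or by closure under quotients.\<close>

lemma subobjects_if_images_extensions:
  assumes im: "\<And>e m. epic C e \<Longrightarrow> monic C m \<Longrightarrow> src C m = tgt C e \<Longrightarrow> src C e \<in> X \<Longrightarrow> tgt C m \<in> X \<Longrightarrow> src C m \<in> X"
    and ext: "extension_closed Noeth X"
  shows "closed_under_subobjects Noeth X"
  unfolding closed_under_subobjects_def noeth_simps
proof (intro allI impI, elim conjE)
  fix m assume "monic Noeth m" and MX: "tgt C m \<in> X"
  then have m: "monic C m" by (simp add: monic_noethD)
  note extD = extension_closedD[OF ext subcategory]
  define M where "M = tgt C m"
  have M: "noetherian C M" "M \<in> X" using X_noetherian MX by (simp_all add: M_def)
  have [simp]: "m \<in> Arr C" "tgt C m = M" "M \<in> Obj C" using m M by (simp_all add: M_def noetherian_Obj)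
  obtain w where w: "is_cokernel C m w" using has_cokernels[of m] by auto
  have km: "is_kernel C w m" by (rule monic_kernel_of_cokernel[OF m w])
  have [simp]: "w \<in> Arr C" "src C w = M" "zero_arrow C (w \<bullet> m)" using cokernelD[OF w] by simp_all
  define S where "S = {n. monic C n \<and> tgt C n = M \<and> sub_le C n m \<and> src C n \<in> X}"
  obtain Z where Z: "zero_object C Z" using zero_object_ex by blast
  obtain k0 where k0: "monic C k0" "src C k0 = Z" "tgt C k0 = M" "zero_arrow C k0"
    using zero_sub_ex[OF _ Z, of M] by auto
  have "sub_le C k0 m" using kernel_sub_le_iff[OF km, of k0] k0 by simp
  then have "k0 \<in> S" unfolding S_def using k0 zero_mem[OF Z] by auto
  moreover have "monic C k \<and> tgt C k = M" if "k \<in> S" for k using that unfolding S_def by blast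
  ultimately obtain n1 where nS: "n1 \<in> S" and nmax: "\<And>n. n \<in> S \<Longrightarrow> sub_le C n1 n \<Longrightarrow> sub_le C n n1"
    using noetherian_maximal[OF M(1), of S] by blast
  have n1: "monic C n1" and [simp]: "tgt C n1 = M" and n1m: "sub_le C n1 m" and n1X: "src C n1 \<in> X"
    using nS unfolding S_def by blast+
  have [simp]: "n1 \<in> Arr C" using n1 by simp
  obtain n where n [simp]: "n \<in> Arr C" "src C n = src C n1" "tgt C n = src C m" and mn: "m \<bullet> n = n1"
    using n1m by (auto elim: sub_leE)
  have mono_n: "monic C n" by (rule monic_cancel[of m n]) (use mn n1 in simp_all)
  obtain c where c: "is_cokernel C n1 c" using has_cokernels[of n1] by auto
  have [simp]: "c \<in> Arr C" "src C c = M" "zero_arrow C (c \<bullet> n1)" using cokernelD[OF c] by simp_all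
  have kc: "is_kernel C c n1" by (rule monic_kernel_of_cokernel[OF n1 c])
  define M1 where "M1 = tgt C c"
  have [simp]: "tgt C c = M1" "M1 \<in> Obj C" by (simp_all add: M1_def)
  have M1: "noetherian C M1" using noetherian_quotient[OF cokernel_epic[OF c]] M by simp
  \<comment> \<open>By this, the image \<open>i\<close> of \<open>c \<bullet> m\<close> is the
    quotient of \<open>src C m\<close> by \<open>n\<close>, embedded in \<open>M1\<close>.\<close>
  have kcm: "is_kernel C (c \<bullet> m) n"
  proof (rule kernelI)
    show "zero_arrow C ((c \<bullet> m) \<bullet> n)" using mn by simp
    fix h assume h: "h \<in> Arr C" "tgt C h = src C (c \<bullet> m)" "zero_arrow C ((c \<bullet> m) \<bullet> h)"
    then obtain u where u: "u \<in> Arr C" "src C u = src C h" "tgt C u = src C n1" "n1 \<bullet> u = m \<bullet> h"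
      using kernel_factor[OF kc, of "m \<bullet> h"] by auto
    have "n \<bullet> u = h"
      by (rule monicD[OF m]) (use u h mn comp_assoc'[of u n m] in simp_all)
    then show "\<exists>u \<in> Arr C. src C u = src C h \<and> tgt C u = src C n \<and> n \<bullet> u = h"
      using u by auto
  qed (use mono_n in simp_all)
  obtain e i where e: "epic C e" and i: "monic C i" and ei: "src C e = src C (c \<bullet> m)"
    "tgt C i = tgt C (c \<bullet> m)" "src C i = tgt C e" "i \<bullet> e = c \<bullet> m"
    using factorization[of "c \<bullet> m"] by auto
  have [simp]: "e \<in> Arr C" "src C e = src C m" "i \<in> Arr C" "tgt C i = M1" "src C i = tgt C e"
    using e i ei by simp_all
  have ke: "is_kernel C e n" using kernel_comp_monic[OF i, of e n] kcm ei(4) by simp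
  have [simp]: "zero_arrow C (e \<bullet> n)" using kernelD(4)[OF ke] .
  show "src C m \<in> X"
  proof (cases "zero_arrow C (idn C (src C i))")
    case True
    then have "zero_arrow C (e \<bullet> idn C (src C m))" using zero_idn_arrow[OF True, of e] by simp
    then obtain u where u: "u \<in> Arr C" "src C u = src C m" "tgt C u = src C n" "n \<bullet> u = idn C (src C m)"
      using kernel_factor[OF ke, of "idn C (src C m)"] by auto
    have "epic C n" by (rule epic_cancel[of n u]) (use u in \<open>simp_all add: epic_idn\<close>)
    with mono_n have "is_iso C n" by (rule monic_epic_iso)
    then show ?thesis using subcategory_iso[OF subcategory, of n] n1X by simp
  next
    case False
    obtain L \<phi> where L: "invertible C L" and \<phi> [simp]: "\<phi> \<in> Arr C" "src C \<phi> = M1 \<odot> L" "tgt C \<phi> = src C i"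
      and \<phi>0: "\<not> zero_arrow C \<phi>"
      using invertible_arrow_to_subobject[OF M1 i _ False] by auto
    note [simp] = invertible_Obj[OF L]
    \<comment> \<open>\<open>M1\<close> is noetherian but not known to lie in \<open>X\<close>;
      precomposing with \<open>c \<star> idn C L\<close> moves the source to
      \<open>M \<odot> L\<close>, which does.\<close>
    define p where "p = \<phi> \<bullet> (c \<star> idn C L)"
    have p [simp]: "p \<in> Arr C" "src C p = M \<odot> L" "tgt C p = tgt C e" by (simp_all add: p_def)
    have p0: "\<not> zero_arrow C p"
      using epic_zeroD[OF epic_tensa_left[OF cokernel_epic[OF c], of L], of \<phi>] \<phi>0 by (auto simp: p_def)
    obtain a b n' where a [simp]: "a \<in> Arr C" "src C a = tgt C n'" "tgt C a = src C e"
      and b [simp]: "b \<in> Arr C" "tgt C b = src C p" and ab: "e \<bullet> a = p \<bullet> b" and se: "short_exact C n' b"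
      and n' [simp]: "src C n' = src C n" and an: "a \<bullet> n' = n" and eb: "epic C b"
      using pullback_epic[OF e ke p(1) p(3)] by blast
    have kb: "is_kernel C b n'" using se by (simp add: short_exact_def)
    have [simp]: "n' \<in> Arr C" "src C b = tgt C n'" using kernelD[OF kb] by simp_all
    have EX: "tgt C n' \<in> X"
      by (rule extD[OF se]) (use n1X X_tens[OF M(2) L] in simp_all)
    \<comment> \<open>The image is taken in \<open>M\<close> and not in the source of
      \<open>m\<close>, since the target has to lie in \<open>X\<close>.\<close>
    obtain d j where d: "epic C d" and j: "monic C j" and dj: "src C d = src C (m \<bullet> a)"
      "tgt C j = tgt C (m \<bullet> a)" "src C j = tgt C d" "j \<bullet> d = m \<bullet> a"
      using factorization[of "m \<bullet> a"] by auto
    have [simp]: "d \<in> Arr C" "src C d = tgt C n'" "j \<in> Arr C" "tgt C j = M" "src C j = tgt C d"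
      using d j dj by simp_all
    have jX: "src C j \<in> X" by (rule im[OF d j]) (use EX M in simp_all)
    have "zero_arrow C (w \<bullet> (m \<bullet> a))" by (rule zero_comp_assoc) simp_all
    then have "zero_arrow C ((w \<bullet> j) \<bullet> d)" using dj(4) by simp
    then have "zero_arrow C (w \<bullet> j)" by - (rule epic_zeroD[OF d], simp_all)
    then have "sub_le C j m" using kernel_sub_le_iff[OF km, of j] by simp
    then have "j \<in> S" unfolding S_def using j jX by simp
    moreover have "j \<bullet> (d \<bullet> n') = n1"
      using comp_assoc'[of n' d j] comp_assoc'[of n' a m] dj(4) an mn by simp
    then have "sub_le C n1 j" by (intro sub_leI[of "d \<bullet> n'"]) simp_all
    ultimately have "sub_le C j n1" by (rule nmax)
    then obtain u where u: "u \<in> Arr C" "src C u = src C j" "tgt C u = src C n1" "n1 \<bullet> u = j"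
      by (rule sub_leE)
    \<comment> \<open>With \<open>j\<close> no larger than \<open>n1\<close>, the arrow
      \<open>a\<close> factors through \<open>n\<close> and is killed by \<open>e\<close>. As
      \<open>e \<bullet> a = p \<bullet> b\<close> with \<open>b\<close> epic, \<open>p\<close>
      vanishes, a contradiction.\<close>
    have "m \<bullet> (n \<bullet> (u \<bullet> d)) = n1 \<bullet> (u \<bullet> d)" using u(1-3) mn comp_assoc'[of "u \<bullet> d" n m] by simp
    also have "\<dots> = m \<bullet> a" using u dj(4) comp_assoc'[of d u n1] by simp
    finally have "n \<bullet> (u \<bullet> d) = a" by - (rule monicD[OF m], use u in simp_all)
    moreover have "zero_arrow C (e \<bullet> (n \<bullet> (u \<bullet> d)))" by (rule zero_comp_assoc) (use u in simp_all)
    ultimately have "zero_arrow C (p \<bullet> b)" using ab by simp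
    then have "zero_arrow C p" by - (rule epic_zeroD[OF eb], simp_all)
    then show ?thesis using p0 by simp
  qed
qed

end

section \<open>Formal implications and the equivalences\<close>

context abelian_category
begin

lemma kernels_if_subobjects: "closed_under_subobjects Noeth X \<Longrightarrow> closed_under_kernels Noeth X"
  unfolding closed_under_subobjects_def closed_under_kernels_def
  using noeth.kernel_monic noeth.kernelD(3) by (simp add: homs_noeth homs_iff)

lemma images_if_subobjects:
  assumes "closed_under_subobjects Noeth X"
  shows "closed_under_images Noeth X"
  unfolding closed_under_images_def is_image_def noeth_simps
proof (intro ballI allI impI, elim exE conjE)
  fix A B f m q
  assume "B \<in> X" "f \<in> homs Noeth A B" and q: "is_cokernel Noeth f q" and m: "is_kernel Noeth q m"
  then have "tgt C m \<in> X"
    using noeth.kernelD(3)[OF m] noeth.cokernelD(3)[OF q] by (simp add: homs_noeth homs_iff)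
  then show "src C m \<in> X"
    using assms noeth.kernel_monic[OF m] unfolding closed_under_subobjects_def noeth_simps by blast
qed

lemma cokernels_if_quotients: "closed_under_quotients Noeth X \<Longrightarrow> closed_under_cokernels Noeth X"
  unfolding closed_under_quotients_def closed_under_cokernels_def
  using noeth.cokernel_epic noeth.cokernelD(3) by (simp add: homs_noeth homs_iff)

end

theorem theorem2:
  fixes \<kappa> :: "'k rel"
    and A :: "('o, 'm) mon_cat"
    and X :: "'o set"
  assumes universe: "inaccessible \<kappa>"
    and cosmos: "grothendieck_cosmos \<kappa> A"
    and loc_noeth: "locally_noetherian \<kappa> A"
    and unit_fp: "finitely_presented \<kappa> A (munit A)"
    and inv_filt_gen:
      "\<exists>S. small \<kappa> S \<and> generating A S \<and> (\<forall>G \<in> S. invertible_filtered A G)"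
    and subcat: "subcategory (noeth_cat A) X"
    and L_closed: "L_closed A X"
  shows "((serre_subcategory (noeth_cat A) X \<longleftrightarrow> torsion_class (noeth_cat A) X) \<and>
          (serre_subcategory (noeth_cat A) X \<longleftrightarrow> wide_subcategory (noeth_cat A) X) \<and>
          (serre_subcategory (noeth_cat A) X \<longleftrightarrow> ICE_closed (noeth_cat A) X) \<and>
          (serre_subcategory (noeth_cat A) X \<longleftrightarrow> CE_closed (noeth_cat A) X)) \<and>
         ((torsion_free_class (noeth_cat A) X \<longleftrightarrow> IKE_closed (noeth_cat A) X) \<and>
          (torsion_free_class (noeth_cat A) X \<longleftrightarrow> IE_closed (noeth_cat A) X))"
proof -
  interpret grothendieck_cosmos \<kappa> A by (rule cosmos)
  interpret abelian_closed_category A ..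
  interpret invertibly_generated_category A
    using inv_filt_gen invertibly_generated_categoryI by blast
  have loc: "noetherian_subcategory A X" if "additive_subcategory (noeth_cat A) X"
  proof
    show "Z \<in> X" if "zero_object A Z" for Z
      using zero_object_noeth[OF that] \<open>additive_subcategory (noeth_cat A) X\<close>
      unfolding additive_subcategory_def by blast
  qed (rule subcat L_closed)+
  have CE_imp_serre: "serre_subcategory (noeth_cat A) X" if "CE_closed (noeth_cat A) X"
  proof -
    have add: "additive_subcategory (noeth_cat A) X" and cok: "closed_under_cokernels (noeth_cat A) X"
      and ext: "extension_closed (noeth_cat A) X"
      using that unfolding CE_closed_def by blast+
    note quot = noetherian_subcategory.quotients_if_cokernels[OF loc[OF add] cok]
    have "closed_under_subobjects (noeth_cat A) X"
      by (rule noetherian_subcategory.subobjects_if_images_extensions[OF loc[OF add] _ ext])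
        (metis closed_under_quotientsD[OF quot subcat])
    then show ?thesis using add quot ext unfolding serre_subcategory_def by blast
  qed
  have IE_imp_torsion_free: "torsion_free_class (noeth_cat A) X" if "IE_closed (noeth_cat A) X"
  proof -
    have add: "additive_subcategory (noeth_cat A) X" and im: "closed_under_images (noeth_cat A) X"
      and ext: "extension_closed (noeth_cat A) X"
      using that unfolding IE_closed_def by blast+
    have "closed_under_subobjects (noeth_cat A) X"
      by (rule noetherian_subcategory.subobjects_if_images_extensions[OF loc[OF add] _ ext])
        (rule closed_under_imagesD[OF im subcat])
    then show ?thesis using add ext unfolding torsion_free_class_def by blast
  qed
  \<comment> \<open>Each condition of the first part contains CE-closure, for torsion classes
    because cokernels are quotients; a Serre subcategory satisfies all of them because kernels and
    images are subobjects. The second part is closed in the same way through IE-closure.\<close>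
  show ?thesis
    using CE_imp_serre IE_imp_torsion_free kernels_if_subobjects images_if_subobjects cokernels_if_quotients
    unfolding serre_subcategory_def torsion_class_def wide_subcategory_def ICE_closed_def CE_closed_def
      torsion_free_class_def IKE_closed_def IE_closed_def
    by blast
qed

end
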